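(* Let $\mathcal{A}=-\Delta$ with homogeneous Dirichlet boundary conditions on a bounded domain $\Omega$, regarded as an isomorphism from $U=H_0^1(\Omega)\cap H^2(\Omega)$ onto $L^2(\Omega)$, and let $\widetilde{\mathcal{G}^*\mathcal{G}}$ be the transformed all-at-once normal operator of the inverse source problem on $L^2(\Omega)\times L^2(\Omega)$, $$\widetilde{\mathcal{G}^*\mathcal{G}}=\begin{pmatrix} I+\mathcal{A}^{-2} & -I\\ -I & I\end{pmatrix}.$$ The eigenvalue equation $\widetilde{\mathcal{G}^*\mathcal{G}}\,(f,g)^T=\lambda\,(f,g)^T$ results in $$\mathcal{A}^{-2}g=\frac{\lambda(2-\lambda)}{1-\lambda}\,g,\qquad f=(1-\lambda)g,$$ so that, with $\mu=\lambda\frac{2-\lambda}{1-\lambda}$ an eigenvalue of $\mathcal{A}^{-2}$, $\lambda$ solves the quadratic equation $\lambda^2-\lambda(2+\mu)+\mu=0$. The eigenvalues of $\widetilde{\mathcal{G}^*\mathcal{G}}$ are therefore given by the two solutions $$\lambda_{1,2}=\frac{2+\mu}{2}\pm\sqrt{\frac{\mu^2}{4}+1},\quad\text{i.e.}\quad \lambda_1=1+\frac{\mu}{2}+\sqrt{1+\frac{\mu^2}{4}},\qquad \lambda_2=\frac{\mu}{1+\frac{\mu}{2}+\sqrt{1+\frac{\mu^2}{4}}},$$ where $\mu$ ranges over the eigenvalues of $\mathcal{A}^{-2}$. As $\mu\to0$, the solutions $\lambda_1$ and $\lambda_2$ tend to $2$ and $0$, respectively. Therefore the eigenvalues of $\widetilde{\mathcal{G}^*\mathcal{G}}$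 accumulate at $0$ and $2$, at the same (basically linear) speed as $\mu\to0$.
   Context: The all-at-once forward operator of the inverse source problem (find $\theta$ in $-\Delta u=\theta$ in $\Omega$, $u=0$ on $\partial\Omega$, from observations of $u$ on all of $\Omega$) is $$\mathcal{G}=\begin{pmatrix}\mathcal{A} & -I\\ I & 0\end{pmatrix}: U\times L^2(\Omega)\to L^2(\Omega)\times L^2(\Omega),$$ where $U=H_0^1(\Omega)\cap H^2(\Omega)$ carries the inner product $\langle v,u\rangle_U=\int_\Omega \mathcal{A}v\,\mathcal{A}u\,dx$, and $I$ denotes both the embedding of $U$ into $L^2(\Omega)$ and the identity on $L^2(\Omega)$. With the unitary operator $\mathcal{T}=\begin{pmatrix}\mathcal{A}&0\\0&I\end{pmatrix}:U\times L^2(\Omega)\to L^2(\Omega)\times L^2(\Omega)$ one sets $\widetilde{\mathcal{G}^*\mathcal{G}}=(\mathcal{T}^{-1})^*\mathcal{G}^*\mathcal{G}\,\mathcal{T}^{-1}$, where ${}^*$ is the Hilbert space adjoint; this equals the block operator displayed in the claim. *)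

theory Defs
  imports "HOL-Analysis.Analysis"
begin

section \<open>The Hilbert space of square integrable functions on the whole space\<close>

text \<open>Classes of Borel functions modulo equality almost everywhere; every Lebesgue measurable
  function agrees almost everywhere with a Borel one, so this is the usual space.\<close>

definition square_int :: "('a::euclidean_space \<Rightarrow> real) \<Rightarrow> bool" where
  "square_int f \<longleftrightarrow> f \<in> borel_measurable lborel \<and> integrable lborel (\<lambda>x. (f x)\<^sup>2)"

definition ae_rel :: "('a::euclidean_space \<Rightarrow> real) \<Rightarrow> ('a \<Rightarrow> real) \<Rightarrow> bool" where
  "ae_rel f g \<longleftrightarrow> square_int f \<and> square_int g \<and> (AE x in lborel. f x = g x)"

lemma square_int_zero: "square_int (\<lambda>x. 0)"
  by (simp add: square_int_def)

lemma square_int_mult: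
  assumes "square_int f" "square_int g"
  shows "integrable lborel (\<lambda>x. f x * g x)"
proof (rule Bochner_Integration.integrable_bound)
  show "integrable lborel (\<lambda>x. (f x)\<^sup>2 + (g x)\<^sup>2)"
    using assms by (auto simp: square_int_def)
  show "(\<lambda>x. f x * g x) \<in> borel_measurable lborel"
    using assms by (auto simp: square_int_def)
  have "\<bar>f x * g x\<bar> \<le> (f x)\<^sup>2 + (g x)\<^sup>2" for x
  proof -
    have "2 * \<bar>f x * g x\<bar> \<le> (f x)\<^sup>2 + (g x)\<^sup>2"
      using sum_squares_bound[of "\<bar>f x\<bar>" "\<bar>g x\<bar>"] by (simp add: abs_mult mult.assoc)
    then show ?thesis by simp
  qed
  then show "AE x in lborel. norm (f x * g x) \<le> norm ((f x)\<^sup>2 + (g x)\<^sup>2)"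
    by simp
qed

lemma square_int_add:
  assumes "square_int f" "square_int g"
  shows "square_int (\<lambda>x. f x + g x)"
proof -
  have "(\<lambda>x. (f x + g x)\<^sup>2) = (\<lambda>x. (f x)\<^sup>2 + (g x)\<^sup>2 + 2 * (f x * g x))"
    by (auto simp: power2_sum)
  then show ?thesis
    using assms square_int_mult[OF assms] by (auto simp: square_int_def)
qed

lemma square_int_scale:
  assumes "square_int f"
  shows "square_int (\<lambda>x. c * f x)"
  using assms by (auto simp: square_int_def power_mult_distrib)

lemma part_equivp_ae_rel: "part_equivp (ae_rel :: ('a::euclidean_space \<Rightarrow> real) \<Rightarrow> _)"
proof (rule part_equivpI)
  have "ae_rel (\<lambda>x::'a. 0) (\<lambda>x. 0)"
    by (simp add: ae_rel_def square_int_zero)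
  then show "\<exists>f::'a \<Rightarrow> real. ae_rel f f" by blast
  show "symp (ae_rel :: ('a \<Rightarrow> real) \<Rightarrow> _)"
    by (rule sympI) (auto simp: ae_rel_def elim: eventually_mono)
  show "transp (ae_rel :: ('a \<Rightarrow> real) \<Rightarrow> _)"
  proof (rule transpI)
    fix f g h :: "'a \<Rightarrow> real"
    assume fg: "ae_rel f g" and gh: "ae_rel g h"
    then have "AE x in lborel. f x = g x" "AE x in lborel. g x = h x"
      by (auto simp: ae_rel_def)
    then have "AE x in lborel. f x = h x"
      by eventually_elim simp
    with fg gh show "ae_rel f h" by (auto simp: ae_rel_def)
  qed
qed

quotient_type (overloaded) 'a l2 = "'a::euclidean_space \<Rightarrow> real" / partial: ae_rel
  by (rule part_equivp_ae_rel)

instantiation l2 :: (euclidean_space) real_vector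
begin

lift_definition zero_l2 :: "'a l2" is "\<lambda>x. 0"
  by (simp add: ae_rel_def square_int_zero)

lift_definition plus_l2 :: "'a l2 \<Rightarrow> 'a l2 \<Rightarrow> 'a l2" is "\<lambda>f g x. f x + g x"
  unfolding ae_rel_def
  by (auto intro: square_int_add)

lift_definition scaleR_l2 :: "real \<Rightarrow> 'a l2 \<Rightarrow> 'a l2" is "\<lambda>c f x. c * f x"
  unfolding ae_rel_def
  by (auto intro: square_int_scale)

lift_definition uminus_l2 :: "'a l2 \<Rightarrow> 'a l2" is "\<lambda>f x. - f x"
  using square_int_scale[of _ "-1"] unfolding ae_rel_def
  by (auto elim: eventually_mono)

definition minus_l2 :: "'a l2 \<Rightarrow> 'a l2 \<Rightarrow> 'a l2" where
  "minus_l2 u v = u + - v"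

instance
proof
  fix a b c :: "'a l2" and r s :: real
  show "a + b + c = a + (b + c)"
    by transfer (auto simp: ae_rel_def add.assoc intro!: square_int_add)
  show "a + b = b + a"
    by transfer (auto simp: ae_rel_def add.commute intro!: square_int_add)
  show "0 + a = a"
    by transfer (auto simp: ae_rel_def)
  show "- a + a = 0"
    by transfer (auto simp: ae_rel_def square_int_zero)
  show "a - b = a + - b"
    by (rule minus_l2_def)
  show "r *\<^sub>R (a + b) = r *\<^sub>R a + r *\<^sub>R b"
    by transfer (auto simp: ae_rel_def distrib_left[symmetric] intro!: square_int_add square_int_scale)
  show "(r + s) *\<^sub>R a = r *\<^sub>R a + s *\<^sub>R a"
    by transfer (auto simp: ae_rel_def distrib_right intro!: square_int_add square_int_scale)
  show "r *\<^sub>R s *\<^sub>R a = (r * s) *\<^sub>R a"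
    by transfer (auto simp: ae_rel_def mult.assoc[symmetric] intro!: square_int_scale)
  show "1 *\<^sub>R a = a"
    by transfer (auto simp: ae_rel_def)
qed

end

instantiation l2 :: (euclidean_space) real_inner
begin

lift_definition inner_l2 :: "'a l2 \<Rightarrow> 'a l2 \<Rightarrow> real" is "\<lambda>f g. \<integral>x. f x * g x \<partial>lborel"
proof -
  fix f f' g g' :: "'a \<Rightarrow> real"
  assume *: "ae_rel f f'" "ae_rel g g'"
  then have "AE x in lborel. f x = f' x" "AE x in lborel. g x = g' x"
    by (auto simp: ae_rel_def)
  then have "AE x in lborel. f x * g x = f' x * g' x"
    by eventually_elim simp
  then show "(\<integral>x. f x * g x \<partial>lborel) = (\<integral>x. f' x * g' x \<partial>lborel)"
    using * by (intro integral_cong_AE) (auto simp: ae_rel_def square_int_def)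
qed

definition norm_l2 :: "'a l2 \<Rightarrow> real" where
  "norm_l2 u = sqrt (inner u u)"

definition dist_l2 :: "'a l2 \<Rightarrow> 'a l2 \<Rightarrow> real" where
  "dist_l2 u v = norm (u - v)"

definition sgn_l2 :: "'a l2 \<Rightarrow> 'a l2" where
  "sgn_l2 u = u /\<^sub>R norm u"

definition uniformity_l2 :: "('a l2 \<times> 'a l2) filter" where
  "uniformity_l2 = (INF e\<in>{0<..}. principal {(u, v). dist u v < e})"

definition open_l2 :: "'a l2 set \<Rightarrow> bool" where
  "open_l2 S = (\<forall>u\<in>S. \<forall>\<^sub>F (u', v) in uniformity. u' = u \<longrightarrow> v \<in> S)"

instance
proof
  fix a b c :: "'a l2" and r :: real
  show "sgn a = a /\<^sub>R norm a"
    by (rule sgn_l2_def)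
  show "dist a b = norm (a - b)"
    by (rule dist_l2_def)
  show "(uniformity :: ('a l2 \<times> 'a l2) filter) = (INF e\<in>{0<..}. principal {(x, y). dist x y < e})"
    by (rule uniformity_l2_def)
  show "open S = (\<forall>x\<in>S. \<forall>\<^sub>F (x', y) in uniformity. x' = x \<longrightarrow> y \<in> S)" for S :: "'a l2 set"
    by (rule open_l2_def)
  show "inner a b = inner b a"
    by transfer (simp add: mult.commute)
  show "inner (a + b) c = inner a c + inner b c"
    by transfer (auto simp: ae_rel_def distrib_right square_int_mult)
  show "inner (r *\<^sub>R a) b = r * inner a b"
    by transfer (auto simp: ae_rel_def mult.assoc)
  show "0 \<le> inner a a"
    by transfer auto
  show "(inner a a = 0) = (a = 0)"
  proof transfer
    fix f :: "'a \<Rightarrow> real"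
    assume f: "ae_rel f f"
    then have "integrable lborel (\<lambda>x. f x * f x)"
      by (auto simp: ae_rel_def square_int_mult)
    then have "(\<integral>x. f x * f x \<partial>lborel) = 0 \<longleftrightarrow> (AE x in lborel. f x * f x = 0)"
      by (intro integral_nonneg_eq_0_iff_AE) auto
    then show "((\<integral>x. f x * f x \<partial>lborel) = 0) = ae_rel f (\<lambda>x. 0)"
      using f by (simp add: ae_rel_def square_int_zero)
  qed
  show "norm a = sqrt (inner a a)"
    by (rule norm_l2_def)
qed

end

section \<open>Sobolev spaces on a domain\<close>

text \<open>An element of \<open>L\<^sup>2(\<Omega>)\<close> is identified with its extension by zero.\<close>

definition L2 :: "'a::euclidean_space set \<Rightarrow> 'a l2 set" where
  "L2 \<Omega> = {u. AE x in lborel. x \<notin> \<Omega> \<longrightarrow> rep_l2 u x = 0}"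

definition partial_deriv :: "'a::euclidean_space \<Rightarrow> ('a \<Rightarrow> real) \<Rightarrow> 'a \<Rightarrow> real" where
  "partial_deriv b f = (\<lambda>x. frechet_derivative f (at x) b)"

primrec cont_diff :: "nat \<Rightarrow> ('a::euclidean_space \<Rightarrow> real) \<Rightarrow> bool" where
  "cont_diff 0 f \<longleftrightarrow> continuous_on UNIV f"
| "cont_diff (Suc k) f \<longleftrightarrow>
     (\<forall>x. f differentiable (at x)) \<and> (\<forall>b\<in>Basis. cont_diff k (partial_deriv b f))"

definition test_fun :: "'a::euclidean_space set \<Rightarrow> ('a \<Rightarrow> real) \<Rightarrow> bool" where
  "test_fun \<Omega> \<phi> \<longleftrightarrow> (\<forall>k. cont_diff k \<phi>) \<and>
     compact (closure {x. \<phi> x \<noteq> 0}) \<and> closure {x. \<phi> x \<noteq> 0} \<subseteq> \<Omega>"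

definition is_weak_deriv :: "'a::euclidean_space set \<Rightarrow> 'a \<Rightarrow> 'a l2 \<Rightarrow> 'a l2 \<Rightarrow> bool" where
  "is_weak_deriv \<Omega> b u v \<longleftrightarrow> v \<in> L2 \<Omega> \<and>
     (\<forall>\<phi>. test_fun \<Omega> \<phi> \<longrightarrow>
        (LINT x:\<Omega>|lborel. rep_l2 u x * partial_deriv b \<phi> x) =
        - (LINT x:\<Omega>|lborel. rep_l2 v x * \<phi> x))"

definition weak_deriv :: "'a::euclidean_space set \<Rightarrow> 'a \<Rightarrow> 'a l2 \<Rightarrow> 'a l2" where
  "weak_deriv \<Omega> b u = (THE v. is_weak_deriv \<Omega> b u v)"

text \<open>\<open>sobolev k \<Omega>\<close> is \<open>H\<^sup>k(\<Omega>)\<close>.\<close>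

primrec sobolev :: "nat \<Rightarrow> 'a::euclidean_space set \<Rightarrow> 'a l2 set" where
  "sobolev 0 \<Omega> = L2 \<Omega>"
| "sobolev (Suc k) \<Omega> =
     {u \<in> L2 \<Omega>. \<forall>b\<in>Basis. \<exists>v\<in>sobolev k \<Omega>. is_weak_deriv \<Omega> b u v}"

text \<open>\<open>H\<^sub>0\<^sup>1(\<Omega>)\<close> is the closure of the test functions in the \<open>H\<^sup>1\<close> norm.\<close>

definition H01 :: "'a::euclidean_space set \<Rightarrow> 'a l2 set" where
  "H01 \<Omega> = {u \<in> sobolev 1 \<Omega>. \<exists>\<phi>. (\<forall>n. test_fun \<Omega> (\<phi> n)) \<and>
     (\<lambda>n. abs_l2 (\<phi> n)) \<longlonglongrightarrow> u \<and>
     (\<forall>b\<in>Basis. (\<lambda>n. abs_l2 (partial_deriv b (\<phi> n))) \<longlonglongrightarrow> weak_deriv \<Omega> b u)}"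

section \<open>The Dirichlet Laplacian and the all-at-once operator\<close>

definition dom_U :: "'a::euclidean_space set \<Rightarrow> 'a l2 set" where
  "dom_U \<Omega> = H01 \<Omega> \<inter> sobolev 2 \<Omega>"

definition neg_laplacian :: "'a::euclidean_space set \<Rightarrow> 'a l2 \<Rightarrow> 'a l2" where
  "neg_laplacian \<Omega> u = - (\<Sum>b\<in>Basis. weak_deriv \<Omega> b (weak_deriv \<Omega> b u))"

definition inv_laplacian :: "'a::euclidean_space set \<Rightarrow> 'a l2 \<Rightarrow> 'a l2" where
  "inv_laplacian \<Omega> = inv_into (dom_U \<Omega>) (neg_laplacian \<Omega>)"

text \<open>The inner product of \<open>U \<times> L\<^sup>2(\<Omega>)\<close>. The space \<open>L\<^sup>2(\<Omega>) \<times> L\<^sup>2(\<Omega>)\<close> carries the inner product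
  of the product type.\<close>

definition inner_UL2 ::
  "'a::euclidean_space set \<Rightarrow> 'a l2 \<times> 'a l2 \<Rightarrow> 'a l2 \<times> 'a l2 \<Rightarrow> real" where
  "inner_UL2 \<Omega> p q =
     inner (neg_laplacian \<Omega> (fst p)) (neg_laplacian \<Omega> (fst q)) + inner (snd p) (snd q)"

text \<open>The adjoint of \<open>T: X \<rightarrow> Y\<close>, for inner products \<open>ipX\<close> and \<open>ipY\<close> on the carriers \<open>X\<close> and \<open>Y\<close>.\<close>

definition hilbert_adjoint ::
  "'x set \<Rightarrow> ('x \<Rightarrow> 'x \<Rightarrow> real) \<Rightarrow> 'y set \<Rightarrow> ('y \<Rightarrow> 'y \<Rightarrow> real) \<Rightarrow> ('x \<Rightarrow> 'y) \<Rightarrow> 'y \<Rightarrow> 'x" where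
  "hilbert_adjoint X ipX Y ipY T =
     (\<lambda>y\<in>Y. THE x. x \<in> X \<and> (\<forall>z\<in>X. ipY (T z) y = ipX z x))"

definition forward_op :: "'a::euclidean_space set \<Rightarrow> 'a l2 \<times> 'a l2 \<Rightarrow> 'a l2 \<times> 'a l2" where
  "forward_op \<Omega> = (\<lambda>(u, \<theta>). (neg_laplacian \<Omega> u - \<theta>, u))"

definition transf_op :: "'a::euclidean_space set \<Rightarrow> 'a l2 \<times> 'a l2 \<Rightarrow> 'a l2 \<times> 'a l2" where
  "transf_op \<Omega> = (\<lambda>(u, \<theta>). (neg_laplacian \<Omega> u, \<theta>))"

definition normal_op :: "'a::euclidean_space set \<Rightarrow> 'a l2 \<times> 'a l2 \<Rightarrow> 'a l2 \<times> 'a l2" where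
  "normal_op \<Omega> =
    (let X = dom_U \<Omega> \<times> L2 \<Omega>; Y = L2 \<Omega> \<times> L2 \<Omega>;
         Tinv = inv_into X (transf_op \<Omega>)
     in hilbert_adjoint Y inner X (inner_UL2 \<Omega>) Tinv
        \<circ> hilbert_adjoint X (inner_UL2 \<Omega>) Y inner (forward_op \<Omega>)
        \<circ> forward_op \<Omega> \<circ> Tinv)"

definition eigenvalues :: "'v::real_vector set \<Rightarrow> ('v \<Rightarrow> 'v) \<Rightarrow> real set" where
  "eigenvalues X T = {c. \<exists>v\<in>X. v \<noteq> 0 \<and> T v = c *\<^sub>R v}"

definition lam1 :: "real \<Rightarrow> real" where
  "lam1 \<mu> = 1 + \<mu> / 2 + sqrt (1 + \<mu>\<^sup>2 / 4)"

definition lam2 :: "real \<Rightarrow> real" where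
  "lam2 \<mu> = \<mu> / (1 + \<mu> / 2 + sqrt (1 + \<mu>\<^sup>2 / 4))"

end

theory Submission
  imports Defs "HOL-Complex_Analysis.Great_Picard" "HOL-Real_Asymp.Real_Asymp"
begin

text \<open>
  Write \<open>H\<close> for \<open>L\<^sup>2(\<Omega>)\<close> and \<open>B\<close> for \<open>A\<^sup>-\<^sup>1\<close>. Test functions are dense in \<open>H\<^sub>0\<^sup>1\<close>, so the defining relation
  of weak derivatives extends to Green's formula
  \<open>\<langle>A u, v\<rangle> = \<Sum>\<^sub>b \<langle>\<partial>\<^sub>b u, \<partial>\<^sub>b v\<rangle>\<close> for \<open>u, v \<in> U\<close> (\<open>inner_neg_laplacian\<close>). Hence \<open>B\<close> is symmetric, and this gives
  both Hilbert adjoints in closed form: \<open>G\<^sup>*(p, q) = (B (p + B q), - p)\<close> and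
  \<open>(T\<^sup>-\<^sup>1)\<^sup>* (u, t) = (A u, t)\<close>. Composing them yields the block operator (\<open>normal_op_eq\<close>).

  The eigenvalue equation of the block operator is linear algebra. Its second row says
  \<open>f = (1 - \<lambda>) g\<close>; the first row then says \<open>(1 - \<lambda>) B\<^sup>2 g = \<lambda> (2 - \<lambda>) g\<close>, and \<open>\<lambda> = 1\<close> would force
  \<open>f = 0\<close> and then \<open>g = 0\<close>. Conversely each root of the quadratic, for an eigenvalue \<open>\<mu>\<close> of \<open>B\<^sup>2\<close>,
  gives an eigenvector \<open>((1 - \<lambda>) g, g)\<close>.

  The analytic content is the accumulation at \<open>2\<close> and \<open>0\<close>. As \<open>lam1\<close> and \<open>lam2\<close> are continuous at
  \<open>0\<close> and never take their limit values at a positive argument, it suffices that \<open>B\<^sup>2\<close>, whose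
  eigenvalues are all positive, has arbitrarily small ones. This is the spectral theorem for an injective
  compact symmetric operator on an infinite-dimensional Hilbert space, in the form
  \<open>small_eigenvalue_exists\<close>. Compactness enters as a Rellich-type inequality: for every \<open>e > 0\<close>
  there are finitely many \<open>w\<close> with
  \<open>\<parallel>u\<parallel>\<^sup>2 \<le> e \<parallel>\<nabla>u\<parallel>\<^sup>2 + \<Sum>\<^sub>w \<langle>u, w\<rangle>\<^sup>2\<close> on \<open>H\<^sub>0\<^sup>1\<close> (\<open>finite_rank_estimate_H01\<close>). The \<open>w\<close> are normalised
  indicators of the cells of a fine cubic grid, and the inequality follows from the \<open>L\<^sup>2\<close> bound
  \<open>\<parallel>\<phi>(\<cdot> + h) - \<phi>\<parallel> \<le> |h| \<parallel>\<nabla>\<phi>\<parallel>\<close> (\<open>translation_estimate\<close>) by averaging over the translations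
  \<open>h\<close> that connect points of one cell. The same bound with an \<open>h\<close> that moves \<open>\<Omega>\<close> off itself
  is the Poincare inequality.

  All of this speaks about \<open>weak_deriv\<close>, a definite description, so weak derivatives have to be unique: that is
  the fundamental lemma of the calculus of variations (\<open>orthogonal_to_test_imp_zero\<close>), for which
  smooth bump functions on boxes are constructed.
\<close>

section \<open>Small eigenvalues of compact symmetric operators\<close>

text \<open>The estimate \<open>est\<close> says that \<open>B\<close> is a compact operator: up to a small multiple of
  \<open>\<parallel>x\<parallel>\<close>, the image \<open>B x\<close> is controlled by finitely many of its
  coordinates. A diagonal argument makes all coordinates, for the errors \<open>1 / (k + 1)\<close>, converge
  simultaneously, and then the estimate applied to differences shows that the images form a Cauchy sequence.\<close>

lemma finite_rank_estimate_Cauchy_subseq: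
  fixes B :: "'v::real_inner \<Rightarrow> 'v"
  assumes lin: "\<And>x y. x \<in> H \<Longrightarrow> y \<in> H \<Longrightarrow> B (x - y) = B x - B y"
    and sub: "subspace H"
    and bound: "\<And>x. x \<in> H \<Longrightarrow> norm (B x) \<le> C * norm x"
    and est: "\<And>e. 0 < e \<Longrightarrow> \<exists>W. finite W \<and> (\<forall>w\<in>W. norm w \<le> 1) \<and>
      (\<forall>x\<in>H. (norm (B x))\<^sup>2 \<le> e * (norm x)\<^sup>2 + (\<Sum>w\<in>W. (inner (B x) w)\<^sup>2))"
    and xs: "\<And>n. x n \<in> H" "\<And>n. norm (x n) \<le> D"
  shows "\<exists>r::nat \<Rightarrow> nat. strict_mono r \<and> Cauchy (\<lambda>n. B (x (r n)))"
proof -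
  have D0: "0 \<le> D" using xs(2)[of 0] norm_ge_zero[of "x 0"] by linarith
  have "\<forall>k::nat. \<exists>W. finite W \<and> (\<forall>w\<in>W. norm w \<le> 1) \<and>
      (\<forall>x\<in>H. (norm (B x))\<^sup>2 \<le> inverse (Suc k) * (norm x)\<^sup>2 + (\<Sum>w\<in>W. (inner (B x) w)\<^sup>2))"
    using est by simp
  then obtain W where W: "\<And>k. finite (W k)" "\<And>k w. w \<in> W k \<Longrightarrow> norm w \<le> 1"
      "\<And>k x. x \<in> H \<Longrightarrow>
        (norm (B x))\<^sup>2 \<le> inverse (Suc k) * (norm x)\<^sup>2 + (\<Sum>w\<in>W k. (inner (B x) w)\<^sup>2)"
    by metis
  have "countable (\<Union>k. W k)" using W(1) by (auto intro: countable_finite)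
  moreover have "norm (inner (B (x n)) w) \<le> \<bar>C\<bar> * D" if "w \<in> (\<Union>k. W k)" for n w
  proof -
    have "norm (inner (B (x n)) w) \<le> norm (B (x n)) * norm w"
      by (simp add: Cauchy_Schwarz_ineq2)
    also have "\<dots> \<le> norm (B (x n)) * 1" using W(2) that by (intro mult_left_mono) auto
    also have "\<dots> \<le> C * norm (x n)" using bound xs by simp
    also have "\<dots> \<le> \<bar>C\<bar> * D" using xs(2)[of n] by (intro mult_mono) auto
    finally show ?thesis .
  qed
  ultimately obtain r :: "nat \<Rightarrow> nat" where r: "strict_mono r"
      "\<And>w. w \<in> (\<Union>k. W k) \<Longrightarrow> \<exists>l. (\<lambda>n. inner (B (x (r n))) w) \<longlonglongrightarrow> l"
    by (rule function_convergent_subsequence[of "\<Union>k. W k" "\<lambda>n w. inner (B (x n)) w" "\<bar>C\<bar> * D"]) auto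
  have "Cauchy (\<lambda>n. B (x (r n)))"
  proof (rule metric_CauchyI)
    fix e :: real assume e: "0 < e"
    obtain k :: nat where k: "inverse (Suc k) * (2 * D)\<^sup>2 < e\<^sup>2 / 2"
    proof -
      have "(\<lambda>k. inverse (real (Suc k)) * (2 * D)\<^sup>2) \<longlonglongrightarrow> 0 * (2 * D)\<^sup>2"
        by (intro tendsto_intros LIMSEQ_inverse_real_of_nat)
      then have "eventually (\<lambda>k. inverse (real (Suc k)) * (2 * D)\<^sup>2 < e\<^sup>2 / 2) sequentially"
        by (rule order_tendstoD) (use e in simp)
      then show ?thesis using that by (auto simp: eventually_sequentially)
    qed
    have *: "\<exists>N. \<forall>m\<ge>N. \<forall>n\<ge>N. (inner (B (x (r m)) - B (x (r n))) w)\<^sup>2 < e\<^sup>2 / (2 * Suc (card (W k)))"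
      if "w \<in> W k" for w
    proof -
      obtain l where "(\<lambda>n. inner (B (x (r n))) w) \<longlonglongrightarrow> l" using r(2) \<open>w \<in> W k\<close> by blast
      then have "Cauchy (\<lambda>n. inner (B (x (r n))) w)" by (rule LIMSEQ_imp_Cauchy)
      then obtain N where N: "\<And>m n. m \<ge> N \<Longrightarrow> n \<ge> N \<Longrightarrow>
          \<bar>inner (B (x (r m))) w - inner (B (x (r n))) w\<bar> < sqrt (e\<^sup>2 / (2 * Suc (card (W k))))"
        using e unfolding Cauchy_def dist_real_def
        by (metis (no_types, lifting) divide_pos_pos mult_pos_pos of_nat_0_less_iff real_sqrt_gt_zero zero_less_Suc zero_less_numeral zero_less_power)
      have "(inner (B (x (r m)) - B (x (r n))) w)\<^sup>2 < e\<^sup>2 / (2 * Suc (card (W k)))"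
        if "m \<ge> N" "n \<ge> N" for m n
      proof -
        have "\<bar>inner (B (x (r m)) - B (x (r n))) w\<bar>\<^sup>2 < (sqrt (e\<^sup>2 / (2 * Suc (card (W k)))))\<^sup>2"
          using N[OF that] by (intro power_strict_mono) (auto simp: inner_diff_left)
        then show ?thesis by (simp del: of_nat_Suc)
      qed
      then show ?thesis by blast
    qed
    then obtain N where N: "\<And>w m n. w \<in> W k \<Longrightarrow> m \<ge> N w \<Longrightarrow> n \<ge> N w \<Longrightarrow>
        (inner (B (x (r m)) - B (x (r n))) w)\<^sup>2 < e\<^sup>2 / (2 * Suc (card (W k)))"
      by metis
    define M where "M = (\<Sum>w\<in>W k. N w)"
    have NM: "N w \<le> M" if "w \<in> W k" for w
      unfolding M_def using W(1) that by (simp add: member_le_sum)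
    have "dist (B (x (r m))) (B (x (r n))) < e" if "m \<ge> M" "n \<ge> M" for m n
    proof -
      let ?d = "x (r m) - x (r n)"
      have d: "?d \<in> H" using sub xs by (simp add: subspace_diff)
      have nd: "norm ?d \<le> 2 * D" using norm_triangle_ineq4[of "x (r m)" "x (r n)"] xs(2)[of "r m"] xs(2)[of "r n"] by linarith
      have "(norm (B ?d))\<^sup>2 \<le> inverse (Suc k) * (norm ?d)\<^sup>2 + (\<Sum>w\<in>W k. (inner (B ?d) w)\<^sup>2)"
        by (rule W(3)[OF d])
      also have "inverse (Suc k) * (norm ?d)\<^sup>2 \<le> inverse (Suc k) * (2 * D)\<^sup>2"
        using nd by (intro mult_left_mono power_mono) auto
      also have "(\<Sum>w\<in>W k. (inner (B ?d) w)\<^sup>2) \<le> (\<Sum>w\<in>W k. e\<^sup>2 / (2 * Suc (card (W k))))"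
        using N NM that lin[OF xs(1) xs(1)] by (intro sum_mono) (metis less_imp_le le_trans)
      also have "\<dots> \<le> e\<^sup>2 / 2"
        by (auto simp: field_simps)
      finally have "(norm (B ?d))\<^sup>2 < e\<^sup>2" using k by linarith
      then have "norm (B ?d) < e" using e by (metis less_imp_le power_less_imp_less_base)
      then show ?thesis using lin[OF xs(1) xs(1)] by (simp add: dist_norm)
    qed
    then show "\<exists>M. \<forall>m\<ge>M. \<forall>n\<ge>M. dist (B (x (r m))) (B (x (r n))) < e" by blast
  qed
  with r(1) show ?thesis by blast
qed

text \<open>The defect of linearity lies in \<open>H\<close>, and by symmetry it is orthogonal to all of \<open>H\<close>.\<close>

lemma symmetric_imp_linear:
  fixes B :: "'v::real_inner \<Rightarrow> 'v"
  assumes sub: "subspace H"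
    and maps: "\<And>x. x \<in> H \<Longrightarrow> B x \<in> H"
    and sym: "\<And>x y. x \<in> H \<Longrightarrow> y \<in> H \<Longrightarrow> inner (B x) y = inner x (B y)"
    and xy: "x \<in> H" "y \<in> H"
  shows "B (a *\<^sub>R x + b *\<^sub>R y) = a *\<^sub>R B x + b *\<^sub>R B y"
proof -
  define z where "z = B (a *\<^sub>R x + b *\<^sub>R y) - (a *\<^sub>R B x + b *\<^sub>R B y)"
  have h: "a *\<^sub>R x + b *\<^sub>R y \<in> H" using sub xy by (simp add: subspace_add subspace_scale)
  then have zH: "z \<in> H" unfolding z_def
    using sub maps xy by (auto intro!: subspace_diff subspace_add subspace_scale)
  have "inner z z = inner (B (a *\<^sub>R x + b *\<^sub>R y)) z - (a * inner (B x) z + b * inner (B y) z)"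
    by (subst (1) z_def) (simp add: inner_diff_left inner_add_left)
  also have "\<dots> = 0"
    using sym[OF h zH] sym[OF xy(1) zH] sym[OF xy(2) zH] by (simp add: inner_add_left)
  finally show ?thesis by (simp add: z_def)
qed

lemma norm_diff_squared:
  fixes x y :: "'v::real_inner"
  shows "(norm (x - y))\<^sup>2 = (norm x)\<^sup>2 - 2 * inner x y + (norm y)\<^sup>2"
  by (simp add: power2_norm_eq_inner inner_diff_left inner_diff_right inner_commute)

text \<open>On \<open>V\<close> the Rayleigh quotient of \<open>B\<^sup>2\<close> is \<open>\<parallel>B
  x\<parallel>\<^sup>2 / \<parallel>x\<parallel>\<^sup>2\<close>; its supremum \<open>m\<close> is an
  eigenvalue. For a maximising sequence of unit vectors \<open>B\<^sup>2 x\<^sub>n - m x\<^sub>n \<rightarrow>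
  0\<close>, because \<open>\<parallel>B\<^sup>2 x\<parallel> \<le> m \<parallel>x\<parallel>\<close> on
  \<open>V\<close>; by compactness \<open>B\<^sup>2 x\<^sub>n\<close>, and with it \<open>x\<^sub>n\<close>,
  converges along a subsequence.\<close>

lemma rayleigh_eigenvector:
  fixes B :: "'v::real_inner \<Rightarrow> 'v"
  assumes sub: "subspace H" and comp: "complete H"
    and maps: "\<And>x. x \<in> H \<Longrightarrow> B x \<in> H"
    and sym: "\<And>x y. x \<in> H \<Longrightarrow> y \<in> H \<Longrightarrow> inner (B x) y = inner x (B y)"
    and inj: "\<And>x. x \<in> H \<Longrightarrow> B x = 0 \<Longrightarrow> x = 0"
    and bound: "\<And>x. x \<in> H \<Longrightarrow> norm (B x) \<le> C * norm x"
    and est: "\<And>e. 0 < e \<Longrightarrow> \<exists>W. finite W \<and> (\<forall>w\<in>W. norm w \<le> 1) \<and>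
      (\<forall>x\<in>H. (norm (B x))\<^sup>2 \<le> e * (norm x)\<^sup>2 + (\<Sum>w\<in>W. (inner (B x) w)\<^sup>2))"
    and V: "subspace V" "V \<subseteq> H" "closed V" "\<And>x. x \<in> V \<Longrightarrow> B (B x) \<in> V"
    and ne: "\<exists>x\<in>V. x \<noteq> 0"
  shows "\<exists>m>0. \<exists>x\<in>V. norm x = 1 \<and> B (B x) = m *\<^sub>R x"
proof -
  have lin: "B (a *\<^sub>R x + b *\<^sub>R y) = a *\<^sub>R B x + b *\<^sub>R B y" if "x \<in> H" "y \<in> H" for a b x y
    by (rule symmetric_imp_linear[OF sub maps sym that])
  have Bdiff: "B (x - y) = B x - B y" if "x \<in> H" "y \<in> H" for x y
    using lin[OF that, of 1 "-1"] by simp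
  have Bscale: "B (a *\<^sub>R x) = a *\<^sub>R B x" if "x \<in> H" for a x
    using lin[OF that that, of a 0] by simp
  define R where "R = (\<lambda>x. (norm (B x))\<^sup>2) ` {x \<in> V. norm x = 1}"
  define m where "m = Sup R"
  obtain x0 where x0: "x0 \<in> V" "x0 \<noteq> 0" using ne by blast
  define x1 where "x1 = x0 /\<^sub>R norm x0"
  have x1: "x1 \<in> V" "norm x1 = 1" using x0 V(1) by (auto simp: x1_def subspace_scale)
  have x1R: "(norm (B x1))\<^sup>2 \<in> R" using x1 by (auto simp: R_def)
  have bdd: "bdd_above R"
    unfolding R_def
  proof (rule bdd_aboveI2)
    fix x assume "x \<in> {x \<in> V. norm x = 1}"
    then have "norm (B x) \<le> C" using bound[of x] V(2) by auto
    then show "(norm (B x))\<^sup>2 \<le> C\<^sup>2" by (intro power_mono) auto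
  qed
  have mpos: "0 < m"
  proof -
    have "B x1 \<noteq> 0" using inj x1 V(2) by fastforce
    then have "0 < (norm (B x1))\<^sup>2" by simp
    also have "\<dots> \<le> m" unfolding m_def by (rule cSup_upper[OF x1R bdd])
    finally show ?thesis .
  qed
  have Bm: "(norm (B x))\<^sup>2 \<le> m * (norm x)\<^sup>2" if "x \<in> V" for x
  proof (cases "x = 0")
    case True
    then show ?thesis using Bscale[of 0 0] V by (auto simp: subspace_0 sub)
  next
    case False
    let ?y = "x /\<^sub>R norm x"
    have "?y \<in> V" "norm ?y = 1" using that False V(1) by (auto simp: subspace_scale)
    then have "(norm (B ?y))\<^sup>2 \<le> m" unfolding m_def
      by (intro cSup_upper[OF _ bdd]) (auto simp: R_def)
    moreover have "B ?y = B x /\<^sub>R norm x" using Bscale that V(2) by blast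
    ultimately show ?thesis using False by (simp add: field_simps)
  qed
  have KR: "inner (B (B x)) x = (norm (B x))\<^sup>2" if "x \<in> H" for x
    using sym[of "B x" x] that maps by (simp add: power2_norm_eq_inner)
  have Km: "norm (B (B x)) \<le> m * norm x" if x: "x \<in> V" for x
  proof -
    let ?k = "B (B x)"
    have kV: "?k \<in> V" using V(4) x by blast
    have xH: "x \<in> H" "?k \<in> H" using x kV V(2) by auto
    have "(norm ?k)\<^sup>2 = inner (B x) (B ?k)"
      using sym[of "B x" ?k] xH maps by (simp add: power2_norm_eq_inner)
    also have "\<dots> \<le> norm (B x) * norm (B ?k)" by (rule norm_cauchy_schwarz)
    also have "\<dots> \<le> (sqrt m * norm x) * (sqrt m * norm ?k)"
    proof (intro mult_mono)
      show "norm (B x) \<le> sqrt m * norm x"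
        by (rule power2_le_imp_le) (use Bm[OF x] mpos in \<open>auto simp: power_mult_distrib\<close>)
      show "norm (B ?k) \<le> sqrt m * norm ?k"
        by (rule power2_le_imp_le) (use Bm[OF kV] mpos in \<open>auto simp: power_mult_distrib\<close>)
    qed (use mpos in auto)
    also have "\<dots> = (m * norm x) * norm ?k" using mpos by (simp add: mult.assoc mult.left_commute)
    finally have "norm ?k * norm ?k \<le> (m * norm x) * norm ?k" by (simp add: power2_eq_square)
    then show ?thesis using mpos by (cases "norm ?k = 0") auto
  qed
  have "\<exists>x. x \<in> V \<and> norm x = 1 \<and> m - inverse (Suc n) < (norm (B x))\<^sup>2" for n
  proof -
    have "m - inverse (Suc n) < Sup R" by (simp add: m_def)
    then obtain y where "y \<in> R" "m - inverse (Suc n) < y"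
      using less_cSupD[of R] x1R by blast
    then show ?thesis by (auto simp: R_def)
  qed
  then obtain x where x: "\<And>n. x n \<in> V" "\<And>n. norm (x n) = 1"
      "\<And>n. m - inverse (Suc n) < (norm (B (x n)))\<^sup>2"
    by metis
  have xH: "x n \<in> H" for n using x V by blast
  have "\<exists>r::nat \<Rightarrow> nat. strict_mono r \<and> Cauchy (\<lambda>n. B (B (x (r n))))"
  proof (rule finite_rank_estimate_Cauchy_subseq[OF Bdiff sub bound est, where x = "\<lambda>n. B (x n)" and D = C])
    show "norm (B (x n)) \<le> C" for n using bound[OF xH, of n] x by simp
  qed (use xH maps in auto)
  then obtain r :: "nat \<Rightarrow> nat" where r: "strict_mono r" "Cauchy (\<lambda>n. B (B (x (r n))))" by blast
  then obtain y where y: "(\<lambda>n. B (B (x (r n)))) \<longlonglongrightarrow> y"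
    using comp xH maps unfolding complete_def by metis
  have gap: "(\<lambda>n. B (B (x (r n))) - m *\<^sub>R x (r n)) \<longlonglongrightarrow> 0"
  proof (rule Lim_null_comparison)
    have "(norm (B (B (x n)) - m *\<^sub>R x n))\<^sup>2 \<le> 2 * m * inverse (Suc n)" for n
    proof -
      have "(norm (B (B (x n)) - m *\<^sub>R x n))\<^sup>2
          = (norm (B (B (x n))))\<^sup>2 - 2 * m * (norm (B (x n)))\<^sup>2 + m\<^sup>2 * (norm (x n))\<^sup>2"
        using KR[OF xH, of n] norm_diff_squared[of "B (B (x n))" "m *\<^sub>R x n"]
        by (simp add: power_mult_distrib)
      also have "(norm (B (B (x n))))\<^sup>2 \<le> m\<^sup>2"
        using Km[OF x(1), of n] x(2) by (intro power_mono) auto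
      also have "m\<^sup>2 - 2 * m * (norm (B (x n)))\<^sup>2 + m\<^sup>2 * (norm (x n))\<^sup>2 = 2 * m * (m - (norm (B (x n)))\<^sup>2)"
        using x(2)[of n] by (simp add: power2_eq_square algebra_simps)
      also have "\<dots> \<le> 2 * m * inverse (Suc n)"
        using x(3)[of n] mpos by (intro mult_left_mono) auto
      finally show ?thesis by simp
    qed
    then have "norm (B (B (x n)) - m *\<^sub>R x n) \<le> sqrt (2 * m * inverse (Suc n))" for n
      by (rule real_le_rsqrt)
    then have "norm (B (B (x (r n))) - m *\<^sub>R x (r n)) \<le> sqrt (2 * m * inverse (Suc (r n)))" for n .
    then show "\<forall>\<^sub>F n in sequentially. norm (B (B (x (r n))) - m *\<^sub>R x (r n)) \<le> sqrt (2 * m * inverse (Suc (r n)))"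
      by simp
    have "(\<lambda>n. sqrt (2 * m * inverse (Suc n))) \<longlonglongrightarrow> sqrt (2 * m * 0)"
      by (intro tendsto_intros LIMSEQ_inverse_real_of_nat)
    then have "(\<lambda>n. sqrt (2 * m * inverse (Suc n))) \<longlonglongrightarrow> 0" by simp
    from LIMSEQ_subseq_LIMSEQ[OF this r(1)]
    show "(\<lambda>n. sqrt (2 * m * inverse (Suc (r n)))) \<longlonglongrightarrow> 0" by (simp add: o_def)
  qed
  define z where "z = y /\<^sub>R m"
  have "(\<lambda>n. (B (B (x (r n))) - (B (B (x (r n))) - m *\<^sub>R x (r n))) /\<^sub>R m) \<longlonglongrightarrow> (y - 0) /\<^sub>R m"
    by (intro tendsto_intros y gap)
  then have xz: "(\<lambda>n. x (r n)) \<longlonglongrightarrow> z" using mpos by (simp add: z_def)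
  have zV: "z \<in> V" by (rule closed_sequentially[OF V(3) _ xz]) (rule x(1))
  have "norm z = 1"
  proof -
    have "(\<lambda>n. norm (x (r n))) \<longlonglongrightarrow> norm z" by (intro tendsto_intros xz)
    then show ?thesis using x(2) by (simp add: LIMSEQ_const_iff)
  qed
  moreover have "B (B z) = m *\<^sub>R z"
  proof -
    have "(\<lambda>n. B (B (x (r n))) - B (B z)) \<longlonglongrightarrow> 0"
    proof (rule Lim_null_comparison)
      have "norm (B (B (x (r n))) - B (B z)) \<le> m * norm (x (r n) - z)" for n
      proof -
        have zH: "z \<in> H" using zV V(2) by blast
        have "x (r n) - z \<in> V" using V(1) x(1) zV by (simp add: subspace_diff)
        then have "norm (B (B (x (r n) - z))) \<le> m * norm (x (r n) - z)" by (rule Km)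
        then show ?thesis using Bdiff xH zH maps by simp
      qed
      then show "\<forall>\<^sub>F n in sequentially. norm (B (B (x (r n))) - B (B z)) \<le> m * norm (x (r n) - z)"
        by simp
      have "(\<lambda>n. m * norm (x (r n) - z)) \<longlonglongrightarrow> m * norm (z - z)" by (intro tendsto_intros xz)
      then show "(\<lambda>n. m * norm (x (r n) - z)) \<longlonglongrightarrow> 0" by simp
    qed
    then have "(\<lambda>n. B (B (x (r n)))) \<longlonglongrightarrow> B (B z)" by (simp add: LIM_zero_iff)
    then have "B (B z) = y" using y LIMSEQ_unique by blast
    then show ?thesis using mpos by (simp add: z_def)
  qed
  ultimately show ?thesis using mpos zV by blast
qed

text \<open>If all eigenvalues of \<open>B\<^sup>2\<close> were at least \<open>e\<close>, an orthonormal sequence of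
  eigenvectors could be built by applying the Rayleigh principle on the orthogonal complement of those already
  found, which is nonzero as \<open>H\<close> has infinite dimension. The images under \<open>B\<^sup>2\<close>
  would then have mutual distances above \<open>e\<close>, against compactness.\<close>

lemma small_eigenvalue_exists:
  fixes B :: "'v::real_inner \<Rightarrow> 'v"
  assumes sub: "subspace H" and comp: "complete H"
    and infd: "\<And>S. finite S \<Longrightarrow> \<not> H \<subseteq> span S"
    and maps: "\<And>x. x \<in> H \<Longrightarrow> B x \<in> H"
    and sym: "\<And>x y. x \<in> H \<Longrightarrow> y \<in> H \<Longrightarrow> inner (B x) y = inner x (B y)"
    and inj: "\<And>x. x \<in> H \<Longrightarrow> B x = 0 \<Longrightarrow> x = 0"
    and bound: "\<And>x. x \<in> H \<Longrightarrow> norm (B x) \<le> C * norm x"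
    and est: "\<And>e. 0 < e \<Longrightarrow> \<exists>W. finite W \<and> (\<forall>w\<in>W. norm w \<le> 1) \<and>
      (\<forall>x\<in>H. (norm (B x))\<^sup>2 \<le> e * (norm x)\<^sup>2 + (\<Sum>w\<in>W. (inner (B x) w)\<^sup>2))"
    and e: "0 < e"
  shows "\<exists>m. 0 < m \<and> m < e \<and> m \<in> eigenvalues H (B \<circ> B)"
proof (rule ccontr)
  assume "\<not> ?thesis"
  then have big: "e \<le> m" if "0 < m" "x \<in> H" "x \<noteq> 0" "B (B x) = m *\<^sub>R x" for m x
    using that by (force simp: eigenvalues_def not_less)
  define P where "P S \<longleftrightarrow> finite S \<and> S \<subseteq> {x \<in> H. norm x = 1 \<and> (\<exists>m. B (B x) = m *\<^sub>R x)} \<and> pairwise orthogonal S" for S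
  have ext: "\<exists>x. x \<in> H \<and> norm x = 1 \<and> (\<exists>m>0. B (B x) = m *\<^sub>R x) \<and> (\<forall>s\<in>S. inner x s = 0)" if P: "P S" for S
  proof -
    define V where "V = {x \<in> H. \<forall>s\<in>S. inner x s = 0}"
    have "subspace V" using sub by (auto simp: V_def subspace_def inner_add_left)
    moreover have "V \<subseteq> H" by (auto simp: V_def)
    moreover have "closed V"
    proof -
      have "V = H \<inter> (\<Inter>s\<in>S. {x. inner s x = 0})" by (auto simp: V_def inner_commute)
      then show ?thesis using complete_imp_closed[OF comp] by (auto intro!: closed_INT closed_hyperplane)
    qed
    moreover have "B (B x) \<in> V" if "x \<in> V" for x
    proof -
      have xH: "x \<in> H" using that by (simp add: V_def)
      have "inner (B (B x)) s = 0" if "s \<in> S" for s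
      proof -
        have "s \<in> {x \<in> H. norm x = 1 \<and> (\<exists>m. B (B x) = m *\<^sub>R x)}"
          using P that unfolding P_def by (meson subsetD)
        then obtain m where m: "s \<in> H" "B (B s) = m *\<^sub>R s" by auto
        have "inner (B (B x)) s = inner x (B (B s))" using sym m(1) xH maps by metis
        then show ?thesis using m \<open>x \<in> V\<close> that by (simp add: V_def)
      qed
      then show ?thesis using maps xH by (simp add: V_def)
    qed
    moreover have "\<exists>x\<in>V. x \<noteq> 0"
    proof (rule ccontr)
      assume none: "\<not> (\<exists>x\<in>V. x \<noteq> 0)"
      have "x \<in> span S" if "x \<in> H" for x
      proof -
        let ?p = "\<Sum>s\<in>S. inner x s *\<^sub>R s"
        have "inner (x - ?p) t = 0" if t: "t \<in> S" for t
        proof -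
          have "inner ?p t = (\<Sum>s\<in>S. if s = t then inner x t else 0)"
            unfolding inner_sum_left
          proof (rule sum.cong)
            fix s assume s: "s \<in> S"
            have "norm t = 1" using P t by (auto simp: P_def)
            then have "inner t t = 1" by (simp add: norm_eq_1)
            moreover have "inner s t = 0" if "s \<noteq> t"
              using P s t that by (auto simp: P_def pairwise_def orthogonal_def)
            ultimately show "inner (inner x s *\<^sub>R s) t = (if s = t then inner x t else 0)" by auto
          qed simp
          also have "\<dots> = inner x t" using t P by (simp add: P_def)
          finally show ?thesis by (simp add: inner_diff_left)
        qed
        moreover have "x - ?p \<in> H" using sub P \<open>x \<in> H\<close>
          by (auto simp: P_def intro!: subspace_diff subspace_sum subspace_scale)
        ultimately have "x - ?p \<in> V" by (auto simp: V_def)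
        then have "x = ?p" using none by auto
        then show ?thesis by (metis (no_types, lifting) span_base span_scale span_sum)
      qed
      then show False using infd[of S] P by (auto simp: P_def)
    qed
    ultimately have "\<exists>m>0. \<exists>x\<in>V. norm x = 1 \<and> B (B x) = m *\<^sub>R x"
      by (intro rayleigh_eigenvector[OF sub comp maps sym inj bound est])
    then show ?thesis by (auto simp: V_def)
  qed
  \<comment> \<open>\<open>f n\<close> carries the set of eigenvectors found so far and the next one.\<close>
  have "\<exists>f. \<forall>n. (P (fst (f n)) \<and> snd (f n) \<in> H \<and> norm (snd (f n)) = 1 \<and>
       (\<exists>m>0. B (B (snd (f n))) = m *\<^sub>R snd (f n)) \<and> (\<forall>s\<in>fst (f n). inner (snd (f n)) s = 0))
      \<and> fst (f (Suc n)) = insert (snd (f n)) (fst (f n))"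
  proof (rule dependent_nat_choice)
    have "P {}" by (simp add: P_def)
    then show "\<exists>p. P (fst p) \<and> snd p \<in> H \<and> norm (snd p) = 1 \<and>
       (\<exists>m>0. B (B (snd p)) = m *\<^sub>R snd p) \<and> (\<forall>s\<in>fst p. inner (snd p) s = 0)"
      using ext[of "{}"] by (metis fst_conv snd_conv)
  next
    fix p :: "'v set \<times> 'v" and n :: nat
    assume p: "P (fst p) \<and> snd p \<in> H \<and> norm (snd p) = 1 \<and>
       (\<exists>m>0. B (B (snd p)) = m *\<^sub>R snd p) \<and> (\<forall>s\<in>fst p. inner (snd p) s = 0)"
    then have "P (insert (snd p) (fst p))"
      by (auto simp: P_def pairwise_insert orthogonal_def inner_commute)
    with ext show "\<exists>q. (P (fst q) \<and> snd q \<in> H \<and> norm (snd q) = 1 \<and>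
       (\<exists>m>0. B (B (snd q)) = m *\<^sub>R snd q) \<and> (\<forall>s\<in>fst q. inner (snd q) s = 0)) \<and>
       fst q = insert (snd p) (fst p)"
      by (metis fst_conv snd_conv)
  qed
  then obtain f where f: "\<And>n. snd (f n) \<in> H" "\<And>n. norm (snd (f n)) = 1"
       "\<And>n. \<exists>m>0. B (B (snd (f n))) = m *\<^sub>R snd (f n)"
       "\<And>n s. s \<in> fst (f n) \<Longrightarrow> inner (snd (f n)) s = 0"
       "\<And>n. fst (f (Suc n)) = insert (snd (f n)) (fst (f n))"
    by blast
  define v where "v n = snd (f n)" for n
  have mem: "v m \<in> fst (f n)" if "m < n" for m n
    using that by (induction n) (auto simp: f(5) v_def less_Suc_eq)
  have orth: "inner (v n) (v m) = 0" if "m \<noteq> n" for m n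
    using f(4) mem that unfolding v_def by (metis inner_commute linorder_neqE_nat)
  obtain m where m: "\<And>n. 0 < m n" "\<And>n. B (B (v n)) = m n *\<^sub>R v n"
    using f(3) unfolding v_def by metis
  have vH: "v n \<in> H" and nv: "norm (v n) = 1" for n using f by (auto simp: v_def)
  have me: "e \<le> m n" for n
    by (rule big[OF m(1) vH _ m(2)]) (use nv[of n] in auto)
  have Bdiff: "B (x - y) = B x - B y" if "x \<in> H" "y \<in> H" for x y
    using symmetric_imp_linear[OF sub maps sym that, of 1 "-1"] by simp
  have "\<exists>r::nat \<Rightarrow> nat. strict_mono r \<and> Cauchy (\<lambda>n. B (B (v (r n))))"
  proof (rule finite_rank_estimate_Cauchy_subseq[OF Bdiff sub bound est, where x = "\<lambda>n. B (v n)" and D = C])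
    show "norm (B (v n)) \<le> C" for n using bound[OF vH, of n] nv by simp
  qed (use vH maps in auto)
  then obtain r :: "nat \<Rightarrow> nat" where r: "strict_mono r" "Cauchy (\<lambda>n. B (B (v (r n))))" by blast
  then obtain N where N: "\<And>i j. i \<ge> N \<Longrightarrow> j \<ge> N \<Longrightarrow> dist (B (B (v (r i)))) (B (B (v (r j)))) < e"
    using e unfolding Cauchy_def by meson
  let ?i = "r N" and ?j = "r (Suc N)"
  have ij: "?i \<noteq> ?j" using r(1) by (metis n_not_Suc_n strict_mono_eq)
  have "(norm (m ?i *\<^sub>R v ?i - m ?j *\<^sub>R v ?j))\<^sup>2 = (m ?i)\<^sup>2 + (m ?j)\<^sup>2"
    using nv[of ?i] nv[of ?j] orth[OF ij] orth[OF ij[symmetric]] norm_diff_squared[of "m ?i *\<^sub>R v ?i" "m ?j *\<^sub>R v ?j"]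
    by (simp add: power_mult_distrib)
  moreover have "e\<^sup>2 \<le> (m ?i)\<^sup>2" using me[of ?i] e by (intro power_mono) auto
  moreover have "(norm (m ?i *\<^sub>R v ?i - m ?j *\<^sub>R v ?j))\<^sup>2 < e\<^sup>2"
    using N[of N "Suc N"] by (intro power_strict_mono) (auto simp: m(2) dist_norm)
  ultimately show False using zero_le_power2[of "m ?j"] by linarith
qed

section \<open>The Hilbert space of square integrable functions\<close>

lemma square_int_rep: "square_int (rep_l2 u)"
  using Quotient_rep_reflp[OF Quotient_l2, of u] by (simp add: ae_rel_def)

lemma abs_rep_l2: "abs_l2 (rep_l2 u) = u"
  by (rule Quotient_abs_rep[OF Quotient_l2])

lemma rep_abs_l2: "square_int f \<Longrightarrow> AE x in lborel. rep_l2 (abs_l2 f) x = f x"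
  using Quotient_rep_abs[OF Quotient_l2, of f] by (simp add: ae_rel_def)

lemma rep_measurable [measurable]: "rep_l2 u \<in> borel_measurable lborel"
  using square_int_rep[of u] by (simp add: square_int_def)

lemma abs_eqI: "square_int f \<Longrightarrow> square_int g \<Longrightarrow> AE x in lborel. f x = g x \<Longrightarrow> abs_l2 f = abs_l2 g"
  using Quotient_rel_abs[OF Quotient_l2, of f g] by (simp add: ae_rel_def)

lemma l2_eqI: "AE x in lborel. rep_l2 u x = rep_l2 v x \<Longrightarrow> u = v"
  using abs_eqI[OF square_int_rep square_int_rep, of u v] by (simp add: abs_rep_l2)

lemma inner_abs_right: "square_int g \<Longrightarrow> inner u (abs_l2 g) = (\<integral>x. rep_l2 u x * g x \<partial>lborel)"
  using inner_l2.abs_eq[of "rep_l2 u" g] square_int_rep[of u]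
  by (simp add: abs_rep_l2 ae_rel_def)

lemma abs_add: "square_int f \<Longrightarrow> square_int g \<Longrightarrow> abs_l2 f + abs_l2 g = abs_l2 (\<lambda>x. f x + g x)"
  by (rule plus_l2.abs_eq) (auto simp: ae_rel_def)

lemma abs_minus: "square_int f \<Longrightarrow> - abs_l2 f = abs_l2 (\<lambda>x. - f x)"
  by (rule uminus_l2.abs_eq) (auto simp: ae_rel_def)

lemma abs_diff: 
  assumes "square_int f" "square_int g" shows "abs_l2 f - abs_l2 g = abs_l2 (\<lambda>x. f x - g x)"
  using assms abs_add[of f "\<lambda>x. - g x"] abs_minus[of g] square_int_scale[of g "-1"]
  by (simp add: minus_l2_def)

lemma norm_abs_sq: "square_int f \<Longrightarrow> (norm (abs_l2 f))\<^sup>2 = (\<integral>x. (f x)\<^sup>2 \<partial>lborel)"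
  unfolding power2_norm_eq_inner using inner_l2.abs_eq[of f f] by (simp add: ae_rel_def power2_eq_square)

lemma rep_add: "AE x in lborel. rep_l2 (u + v) x = rep_l2 u x + rep_l2 v x"
  using abs_add[OF square_int_rep square_int_rep, of u v]
    rep_abs_l2[OF square_int_add[OF square_int_rep square_int_rep], of u v] by (simp add: abs_rep_l2)

lemma rep_scale: "AE x in lborel. rep_l2 (c *\<^sub>R u) x = c * rep_l2 u x"
  using scaleR_l2.abs_eq[of "rep_l2 u" c] square_int_rep[of u]
    rep_abs_l2[OF square_int_scale[OF square_int_rep], of c u] by (simp add: abs_rep_l2 ae_rel_def)

lemma nn_integral_square: "square_int f \<Longrightarrow> (\<integral>\<^sup>+x. ennreal ((f x)\<^sup>2) \<partial>lborel) = ennreal ((norm (abs_l2 f))\<^sup>2)"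
  by (subst nn_integral_eq_integral) (auto simp: square_int_def norm_abs_sq)

lemma square_intI:
  assumes "f \<in> borel_measurable lborel" "(\<integral>\<^sup>+x. ennreal ((f x)\<^sup>2) \<partial>lborel) < \<infinity>"
  shows "square_int f"
  using assms by (auto simp: square_int_def intro!: integrableI_nonneg)

lemma subspace_L2: "subspace (L2 \<Omega>)"
  unfolding subspace_def
proof (intro conjI ballI allI)
  have "AE x in lborel. rep_l2 (0::'a l2) x = 0"
    using rep_abs_l2[OF square_int_zero] by (simp add: zero_l2_def)
  then show "(0::'a l2) \<in> L2 \<Omega>" unfolding L2_def by (auto elim: eventually_mono)
next
  fix u v :: "'a l2" assume "u \<in> L2 \<Omega>" "v \<in> L2 \<Omega>"
  then show "u + v \<in> L2 \<Omega>"
    using rep_add[of u v] unfolding L2_def mem_Collect_eq by eventually_elim auto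
next
  fix u :: "'a l2" and c assume "u \<in> L2 \<Omega>"
  then show "c *\<^sub>R u \<in> L2 \<Omega>"
    using rep_scale[of c u] unfolding L2_def mem_Collect_eq by eventually_elim auto
qed

lemma abs_in_L2:
  assumes "square_int f" "\<And>x. x \<notin> \<Omega> \<Longrightarrow> f x = 0"
  shows "abs_l2 f \<in> L2 \<Omega>"
  using rep_abs_l2[OF assms(1)] assms(2) unfolding L2_def by (auto elim: eventually_mono)

lemma square_int_indicator_mult:
  assumes "square_int f" "S \<in> sets borel"
  shows "square_int (\<lambda>x. indicator S x * f x)"
proof -
  have [measurable]: "f \<in> borel_measurable borel" using assms by (simp add: square_int_def)
  have "(\<integral>\<^sup>+x. ennreal ((indicator S x * f x)\<^sup>2) \<partial>lborel) \<le> (\<integral>\<^sup>+x. ennreal ((f x)\<^sup>2) \<partial>lborel)"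
    by (intro nn_integral_mono) (auto simp: indicator_def)
  also have "\<dots> < \<infinity>" using nn_integral_square[OF assms(1)] by simp
  finally show ?thesis using assms(2) by (intro square_intI) auto
qed

text \<open>The part of a limit that lives off \<open>\<Omega>\<close> is a fixed vector orthogonal to every element of
  the sequence, hence orthogonal to the limit, that is, to itself.\<close>

lemma closed_L2:
  assumes "open (\<Omega> :: 'a::euclidean_space set)"
  shows "closed (L2 \<Omega>)"
proof (rule closed_sequential_limits[THEN iffD2], intro allI impI, elim conjE)
  fix f :: "nat \<Rightarrow> 'a l2" and u
  assume f: "\<forall>n. f n \<in> L2 \<Omega>" and lim: "f \<longlonglongrightarrow> u"
  let ?r = "\<lambda>x. indicator (- \<Omega>) x * rep_l2 u x"
  have sq: "square_int ?r"
    using assms by (intro square_int_indicator_mult square_int_rep) auto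
  have "inner (f n) (abs_l2 ?r) = 0" for n
  proof -
    have "AE x in lborel. rep_l2 (f n) x * ?r x = 0"
      using f[rule_format, of n] unfolding L2_def by (auto elim!: eventually_mono simp: indicator_def)
    then show ?thesis unfolding inner_abs_right[OF sq] by (rule integral_eq_zero_AE)
  qed
  moreover have "(\<lambda>n. inner (f n) (abs_l2 ?r)) \<longlonglongrightarrow> inner u (abs_l2 ?r)"
    by (intro tendsto_intros lim)
  ultimately have "inner u (abs_l2 ?r) = 0" by (simp add: LIMSEQ_const_iff)
  then have "(\<integral>x. (?r x)\<^sup>2 \<partial>lborel) = 0"
    unfolding inner_abs_right[OF sq]
    by (subst Bochner_Integration.integral_cong[OF refl, of _ _ "\<lambda>x. rep_l2 u x * ?r x"])
       (auto simp: power2_eq_square indicator_def)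
  then have "AE x in lborel. (?r x)\<^sup>2 = 0"
    using sq by (subst (asm) integral_nonneg_eq_0_iff_AE) (auto simp: square_int_def)
  then show "u \<in> L2 \<Omega>" unfolding L2_def by (auto elim!: eventually_mono simp: indicator_def)
qed

text \<open>Even \<open>\<Sum>\<^sub>k 4\<^sup>k d\<^sub>k\<^sup>2\<close> has finite integral, so almost everywhere
  \<open>d\<^sub>k\<close> is bounded by a multiple of \<open>2\<^sup>-\<^sup>k\<close>.\<close>

lemma AE_summable_of_geometric:
  fixes d :: "nat \<Rightarrow> 'a::euclidean_space \<Rightarrow> real"
  assumes d: "\<And>k. square_int (d k)" "\<And>k. norm (abs_l2 (d k)) \<le> (1/4)^k"
  shows "AE x in lborel. summable (\<lambda>k. d k x)"
proof -
  have [measurable]: "d k \<in> borel_measurable borel" for k using d by (simp add: square_int_def)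
  have "(\<integral>\<^sup>+x. (\<Sum>k. ennreal (4^k * (d k x)\<^sup>2)) \<partial>lborel) = (\<Sum>k. \<integral>\<^sup>+x. ennreal (4^k * (d k x)\<^sup>2) \<partial>lborel)"
    by (rule nn_integral_suminf) auto
  also have "\<dots> \<le> (\<Sum>k. ennreal ((1/4)^k))"
  proof (intro suminf_le)
    fix k
    have "(\<integral>\<^sup>+x. ennreal (4^k * (d k x)\<^sup>2) \<partial>lborel) = ennreal (4^k) * ennreal ((norm (abs_l2 (d k)))\<^sup>2)"
      unfolding nn_integral_square[OF d(1), symmetric]
      by (subst nn_integral_cmult[symmetric]) (auto simp: ennreal_mult)
    also have "\<dots> = ennreal (4^k * (norm (abs_l2 (d k)))\<^sup>2)" by (simp add: ennreal_mult)
    also have "\<dots> \<le> ennreal (4^k * ((1/4)^k)\<^sup>2)"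
      using d(2) by (intro ennreal_leI mult_left_mono power_mono) auto
    also have "(4::real)^k * ((1/4)^k)\<^sup>2 = (1/4)^k"
      by (simp add: power2_eq_square power_one_over)
    finally show "(\<integral>\<^sup>+x. ennreal (4^k * (d k x)\<^sup>2) \<partial>lborel) \<le> ennreal ((1/4)^k)" .
  qed auto
  also have "\<dots> = ennreal (\<Sum>k. (1/4)^k)" by (rule suminf_ennreal2) auto
  also have "\<dots> < \<infinity>" by simp
  finally have "(\<integral>\<^sup>+x. (\<Sum>k. ennreal (4^k * (d k x)\<^sup>2)) \<partial>lborel) \<noteq> \<infinity>" by simp
  then have "AE x in lborel. (\<Sum>k. ennreal (4^k * (d k x)\<^sup>2)) \<noteq> \<infinity>"
    by (intro nn_integral_PInf_AE) auto
  then show ?thesis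
  proof eventually_elim
    case (elim x)
    then have "summable (\<lambda>k. 4^k * (d k x)\<^sup>2)"
      by (intro summable_suminf_not_top) auto
    then obtain C where C: "\<And>k. norm (4^k * (d k x)\<^sup>2) \<le> C"
      using summable_imp_Bseq[unfolded Bseq_def] by blast
    have "norm (d k x) \<le> sqrt C * (1/2)^k" for k
    proof -
      have "(2^k * d k x)\<^sup>2 \<le> C"
      proof -
        have "((2::real)^k)\<^sup>2 = 4^k" by (simp add: power2_eq_square flip: power_mult_distrib)
        then show ?thesis using C[of k] by (simp add: power_mult_distrib abs_mult)
      qed
      then have "\<bar>2^k * d k x\<bar> \<le> sqrt C" by (intro real_le_rsqrt) simp
      then show ?thesis by (simp add: abs_mult power_one_over field_simps)
    qed
    moreover have "summable (\<lambda>k. sqrt C * (1/2)^k)" by (intro summable_mult summable_geometric) auto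
    ultimately show ?case by (rule summable_comparison_test'[rotated])
  qed
qed

text \<open>The Riesz-Fischer theorem: a fast subsequence converges almost everywhere, and Fatou's lemma bounds the
  distance of its members to the pointwise limit.\<close>

lemma Cauchy_l2_convergent: 
  fixes X :: "nat \<Rightarrow> 'a::euclidean_space l2"
  assumes "Cauchy X"
  shows "convergent X"
proof -
  have "\<exists>N. \<forall>m\<ge>N. \<forall>n\<ge>N. norm (X m - X n) < (1/4)^k" for k
    using assms unfolding Cauchy_def dist_norm by simp
  then obtain N where N: "\<And>k m n. m \<ge> N k \<Longrightarrow> n \<ge> N k \<Longrightarrow> norm (X m - X n) < (1/4)^k" by metis
  \<comment> \<open>Adding \<open>k\<close> and the earlier thresholds makes \<open>r\<close> strictly increasing.\<close>
  define r where "r k = k + (\<Sum>i\<le>k. N i)" for k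
  have rN: "N k \<le> r k" for k unfolding r_def by (simp add: member_le_sum trans_le_add2)
  have rS: "r k \<le> r (Suc k)" for k unfolding r_def by simp
  have "strict_mono r" unfolding strict_mono_Suc_iff by (simp add: r_def)
  define g where "g k = rep_l2 (X (r k))" for k
  have gs: "square_int (g k)" for k unfolding g_def by (rule square_int_rep)
  have [measurable]: "g k \<in> borel_measurable borel" for k using gs by (simp add: square_int_def)
  have ds: "square_int (\<lambda>x. g j x - g k x)" for j k
    using square_int_add[OF gs square_int_scale[OF gs, of "-1"]] by simp
  have da: "abs_l2 (\<lambda>x. g j x - g k x) = X (r j) - X (r k)" for j k
    using abs_diff[OF gs gs, of j k] by (simp add: g_def abs_rep_l2)
  have "AE x in lborel. summable (\<lambda>k. g (Suc k) x - g k x)"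
  proof (rule AE_summable_of_geometric[OF ds])
    fix k show "norm (abs_l2 (\<lambda>x. g (Suc k) x - g k x)) \<le> (1/4)^k"
      unfolding da using N[of k "r (Suc k)" "r k"] rN[of k] rS[of k] by simp
  qed
  then have conv: "AE x in lborel. convergent (\<lambda>k. g k x)"
  proof eventually_elim
    case (elim x)
    then have "(\<lambda>n. \<Sum>k<n. g (Suc k) x - g k x) \<longlonglongrightarrow> (\<Sum>k. g (Suc k) x - g k x)" by (rule summable_LIMSEQ)
    then have "(\<lambda>n. (g n x - g 0 x) + g 0 x) \<longlonglongrightarrow> (\<Sum>k. g (Suc k) x - g k x) + g 0 x"
      by (intro tendsto_add tendsto_const) (simp add: sum_lessThan_telescope[of "\<lambda>k. g k x"])
    then show ?case by (auto simp: convergent_def)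
  qed
  define h where "h x = lim (\<lambda>k. g k x)" for x
  have [measurable]: "h \<in> borel_measurable borel" unfolding h_def by (rule borel_measurable_lim_metric) simp
  have hlim: "AE x in lborel. (\<lambda>k. g k x) \<longlonglongrightarrow> h x"
    using conv by eventually_elim (simp add: h_def convergent_LIMSEQ_iff)
  have dist: "(\<integral>\<^sup>+x. ennreal ((h x - g k x)\<^sup>2) \<partial>lborel) \<le> ennreal (((1/4)^k)\<^sup>2)" for k
  proof -
    have "(\<integral>\<^sup>+x. ennreal ((h x - g k x)\<^sup>2) \<partial>lborel) = (\<integral>\<^sup>+x. liminf (\<lambda>j. ennreal ((g j x - g k x)\<^sup>2)) \<partial>lborel)"
    proof (rule nn_integral_cong_AE)
      show "AE x in lborel. ennreal ((h x - g k x)\<^sup>2) = liminf (\<lambda>j. ennreal ((g j x - g k x)\<^sup>2))"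
        using hlim
      proof eventually_elim
        case (elim x)
        have "(\<lambda>j. ennreal ((g j x - g k x)\<^sup>2)) \<longlonglongrightarrow> ennreal ((h x - g k x)\<^sup>2)"
          by (intro tendsto_intros elim)
        from lim_imp_Liminf[OF _ this] show ?case by simp
      qed
    qed
    also have "\<dots> \<le> liminf (\<lambda>j. \<integral>\<^sup>+x. ennreal ((g j x - g k x)\<^sup>2) \<partial>lborel)"
      by (rule nn_integral_liminf) auto
    also have "\<dots> \<le> ennreal (((1/4)^k)\<^sup>2)"
    proof (rule Liminf_le)
      show "\<forall>\<^sub>F j in sequentially. (\<integral>\<^sup>+x. ennreal ((g j x - g k x)\<^sup>2) \<partial>lborel) \<le> ennreal (((1/4)^k)\<^sup>2)"
        using eventually_ge_at_top[of k]
      proof eventually_elim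
        case (elim j)
        have "r k \<le> r j" using \<open>strict_mono r\<close> elim by (simp add: strict_mono_less_eq)
        then have "norm (X (r j) - X (r k)) < (1/4)^k" using rN[of k] by (intro N) auto
        then show ?case unfolding nn_integral_square[OF ds] da
          by (intro ennreal_leI power_mono) auto
      qed
    qed simp
    finally show ?thesis .
  qed
  have hs: "square_int h"
  proof -
    have "square_int (\<lambda>x. h x - g 0 x)"
      using dist[of 0] by (intro square_intI) (auto intro: le_less_trans)
    from square_int_add[OF this gs[of 0]] show ?thesis by simp
  qed
  have hg: "square_int (\<lambda>x. h x - g k x)" for k
    using square_int_add[OF hs square_int_scale[OF gs, of "-1"]] by simp
  have "norm (X (r k) - abs_l2 h) \<le> (1/4)^k" for k
  proof -
    have "ennreal ((norm (abs_l2 h - X (r k)))\<^sup>2) \<le> ennreal (((1/4)^k)\<^sup>2)"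
      using dist[of k] nn_integral_square[OF hg, of k] abs_diff[OF hs gs, of k] by (simp add: g_def abs_rep_l2)
    then have "norm (abs_l2 h - X (r k)) \<le> (1/4)^k"
      by (subst (asm) ennreal_le_iff) (auto intro: power2_le_imp_le)
    then show ?thesis by (simp add: norm_minus_commute)
  qed
  then have "\<forall>\<^sub>F k in sequentially. norm (X (r k) - abs_l2 h) \<le> (1/4)^k" by simp
  moreover have "(\<lambda>k. (1/4::real)^k) \<longlonglongrightarrow> 0" by (rule LIMSEQ_power_zero) simp
  ultimately have "(\<lambda>k. X (r k) - abs_l2 h) \<longlonglongrightarrow> 0" by (rule Lim_null_comparison)
  then have "(X \<circ> r) \<longlonglongrightarrow> abs_l2 h" unfolding LIM_zero_iff o_def .
  then have "X \<longlonglongrightarrow> abs_l2 h"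
    by (rule Cauchy_converges_subseq[OF assms \<open>strict_mono r\<close>])
  then show ?thesis by (auto simp: convergent_def)
qed

lemma complete_L2:
  assumes "open \<Omega>" shows "complete (L2 \<Omega>)"
  unfolding complete_def
proof (intro allI impI, elim conjE)
  fix f assume f: "\<forall>n. f n \<in> L2 \<Omega>" and "Cauchy f"
  then obtain l where l: "f \<longlonglongrightarrow> l" using Cauchy_l2_convergent by (auto simp: convergent_def)
  moreover have "l \<in> L2 \<Omega>" by (rule closed_sequentially[OF closed_L2[OF assms] _ l]) (simp add: f)
  ultimately show "\<exists>l\<in>L2 \<Omega>. f \<longlonglongrightarrow> l" by blast
qed

text \<open>The indicators of infinitely many disjoint spherical shells in \<open>\<Omega>\<close> are orthogonal and
  nonzero.\<close>

lemma L2_not_finite_dim: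
  fixes \<Omega> :: "'a::euclidean_space set"
  assumes "open \<Omega>" "\<Omega> \<noteq> {}" "finite S"
  shows "\<not> L2 \<Omega> \<subseteq> span S"
proof
  assume sub: "L2 \<Omega> \<subseteq> span S"
  obtain c r where r: "0 < r" "ball c r \<subseteq> \<Omega>"
    using assms open_contains_ball by (metis ex_in_conv)
  define D where "D n = ball c (r / Suc n) - cball c (r / Suc (Suc n))" for n
  have oD: "open (D n)" for n unfolding D_def by auto
  have [measurable]: "D n \<in> sets borel" for n using oD by simp
  have Dsub: "D n \<subseteq> \<Omega>" for n
  proof -
    have "r / Suc n \<le> r" using r by (simp add: field_simps)
    then show ?thesis using r subset_ball[of "r / Suc n" r c] unfolding D_def by blast
  qed
  have Ddisj: "D m \<inter> D n = {}" if "m < n" for m n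
  proof -
    have "r / Suc n \<le> r / Suc (Suc m)" using that r by (intro divide_left_mono) auto
    then show ?thesis unfolding D_def by auto
  qed
  have Dfin: "emeasure lborel (D n) < \<infinity>" for n
    by (rule emeasure_bounded_finite, rule bounded_subset[OF bounded_ball]) (auto simp: D_def)
  define i where "i n = abs_l2 (indicator (D n) :: 'a \<Rightarrow> real)" for n
  have sqD: "square_int (indicator (D n) :: 'a \<Rightarrow> real)" for n
    using Dfin[of n] by (intro square_intI) (auto simp: power2_eq_square ennreal_mult ennreal_indicator simp flip: indicator_inter_arith)
  have inD: "inner (i m) (i n) = (\<integral>x. indicator (D m) x * indicator (D n) x \<partial>lborel)" for m n
    unfolding i_def by (rule inner_l2.abs_eq) (auto simp: ae_rel_def sqD)
  have ne: "i n \<noteq> 0" for n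
  proof
    assume "i n = 0"
    then have "emeasure lborel (D n) = 0"
      using inD[of n n] Dfin[of n] by (auto simp: measure_def enn2real_eq_0_iff simp flip: indicator_inter_arith)
    then have "negligible (D n)"
      by (simp add: negligible_iff_null_sets null_setsI null_sets_completionI)
    moreover have "D n \<noteq> {}"
    proof -
      obtain b :: 'a where b: "b \<in> Basis" using nonempty_Basis by blast
      obtain t where t: "r / Suc (Suc n) < t" "t < r / Suc n"
        using dense[of "r / Suc (Suc n)" "r / Suc n"] r by (auto simp: field_simps)
      have "0 < r / Suc (Suc n)" using r by simp
      then have "c + t *\<^sub>R b \<in> D n" using t b by (auto simp: D_def dist_norm)
      then show ?thesis by blast
    qed
    ultimately show False using open_not_negligible[OF oD] by blast
  qed
  have orth: "inner (i m) (i n) = 0" if "m \<noteq> n" for m n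
  proof -
    have "D m \<inter> D n = {}" using Ddisj[of m n] Ddisj[of n m] that by (cases m n rule: linorder_cases) auto
    then show ?thesis unfolding inD indicator_inter_arith[symmetric] by simp
  qed
  have "inj i" using orth ne by (metis injI inner_eq_zero_iff)
  then have "infinite (range i)" by (simp add: range_inj_infinite)
  moreover have "0 \<notin> range i" using ne by (metis rangeE)
  then have "independent (range i)"
    by (rule pairwise_orthogonal_independent[rotated])
       (auto simp: pairwise_def orthogonal_def intro!: orth)
  moreover have "i n \<in> L2 \<Omega>" for n
    unfolding i_def using sqD Dsub[of n] by (intro abs_in_L2) (auto simp: indicator_def)
  ultimately show False using sub independent_span_bound[OF assms(3), of "range i"] by blast
qed

section \<open>Smooth bump functions on boxes\<close>

text \<open>The functions \<open>p(1/x) exp(-1/x)\<close>, extended by \<open>0\<close> to \<open>x \<le> 0\<close>.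
  Admitting a polynomial factor makes the family closed under differentiation.\<close>

definition flat :: "real poly \<Rightarrow> real \<Rightarrow> real" where
  "flat p x = (if 0 < x then poly p (1 / x) * exp (- (1 / x)) else 0)"

text \<open>After the substitution \<open>y = 1/x\<close> the exponential dominates the polynomial.\<close>

lemma flat_tendsto_0: "(flat p \<longlongrightarrow> 0) (at_right 0)"
proof -
  have "((\<lambda>y. poly p y * exp (- y)) \<longlongrightarrow> 0) at_top"
  proof -
    have "((\<lambda>y. \<Sum>i\<le>degree p. coeff p i * (y ^ i / exp y)) \<longlongrightarrow> (\<Sum>i\<le>degree p. coeff p i * 0)) at_top"
      by (intro tendsto_sum tendsto_mult tendsto_const tendsto_power_div_exp_0)
    then show ?thesis
      by (simp add: poly_altdef exp_minus divide_inverse sum_distrib_right mult.assoc)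
  qed
  then have "((\<lambda>x. poly p (inverse x) * exp (- inverse x)) \<longlongrightarrow> 0) (at_right 0)"
    using filterlim_inverse_at_top_right by (rule filterlim_compose)
  moreover have "eventually (\<lambda>x. poly p (inverse x) * exp (- inverse x) = flat p x) (at_right 0)"
    by (auto simp: eventually_at_right_field flat_def divide_inverse intro!: exI[of _ 1])
  ultimately show ?thesis by (rule Lim_transform_eventually)
qed

text \<open>At \<open>0\<close> the difference quotient is again a member of the family, with \<open>p\<close> multiplied
  by the variable, and so tends to \<open>0\<close>.\<close>

lemma flat_deriv: "(flat p has_real_derivative flat ([:0, 0, 1:] * (p - pderiv p)) x) (at x)"
proof -
  consider "0 < x" | "x < 0" | "x = 0" by linarith
  then show ?thesis
  proof cases
    case 1
    have "((\<lambda>x. poly p (1 / x) * exp (- (1 / x))) has_real_derivative flat ([:0, 0, 1:] * (p - pderiv p)) x) (at x)"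
      using 1 by (auto simp: flat_def field_simps power2_eq_square intro!: derivative_eq_intros DERIV_chain2[OF poly_DERIV])
    then show ?thesis
      by (rule has_field_derivative_transform_within_open[of _ _ _ "{0<..}"]) (use 1 in \<open>auto simp: flat_def\<close>)
  next
    case 2
    have "((\<lambda>x. 0) has_real_derivative flat ([:0, 0, 1:] * (p - pderiv p)) x) (at x)"
      using 2 by (simp add: flat_def)
    then show ?thesis
      by (rule has_field_derivative_transform_within_open[of _ _ _ "{..<0}"]) (use 2 in \<open>auto simp: flat_def\<close>)
  next
    case 3
    have q: "flat p h / h = flat (pCons 0 p) h" for h by (simp add: flat_def)
    have "((\<lambda>h. flat p h / h) \<longlongrightarrow> 0) (at 0)"
      unfolding q filterlim_at_split
    proof
      show "(flat (pCons 0 p) \<longlongrightarrow> 0) (at_right 0)" by (rule flat_tendsto_0)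
      have "((\<lambda>h. 0) \<longlongrightarrow> (0::real)) (at_left 0)" by simp
      moreover have "eventually (\<lambda>h. 0 = flat (pCons 0 p) h) (at_left 0)"
        by (auto simp: eventually_at_left_field flat_def intro!: exI[of _ "-1"])
      ultimately show "(flat (pCons 0 p) \<longlongrightarrow> 0) (at_left 0)" by (rule Lim_transform_eventually)
    qed
    then show ?thesis using 3 by (simp add: DERIV_def flat_def)
  qed
qed

definition smooth1 :: "(real \<Rightarrow> real) \<Rightarrow> bool" where
  "smooth1 h \<longleftrightarrow> (\<exists>g::nat \<Rightarrow> real \<Rightarrow> real. g 0 = h \<and> (\<forall>n x. (g n has_real_derivative g (Suc n) x) (at x)))"

lemma smooth1_of_invariant:
  assumes "h \<in> S" and "\<And>f. f \<in> S \<Longrightarrow> \<exists>f'\<in>S. \<forall>x. (f has_real_derivative f' x) (at x)"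
  shows "smooth1 h"
proof -
  obtain D where D: "\<And>f. f \<in> S \<Longrightarrow> D f \<in> S" "\<And>f x. f \<in> S \<Longrightarrow> (f has_real_derivative D f x) (at x)"
    using assms(2) by metis
  have "(D ^^ n) h \<in> S" for n using assms(1) D(1) by (induction n) auto
  then show ?thesis unfolding smooth1_def
    by (intro exI[of _ "\<lambda>n. (D ^^ n) h"]) (auto intro!: D(2))
qed

lemma smooth1_flat: "smooth1 (flat p)"
  by (rule smooth1_of_invariant[of _ "range flat"]) (use flat_deriv in blast)+

lemma smooth1D: 
  assumes "smooth1 h"
  obtains h' where "smooth1 h'" "\<And>x. (h has_real_derivative h' x) (at x)"
proof -
  obtain g where g: "g 0 = h" "\<And>n x. (g n has_real_derivative g (Suc n) x) (at x)"
    using assms by (auto simp: smooth1_def)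
  have "smooth1 (g 1)" unfolding smooth1_def by (rule exI[of _ "\<lambda>n. g (Suc n)"]) (auto simp: g)
  moreover have "(h has_real_derivative g 1 x) (at x)" for x using g(2)[of 0 x] by (simp add: g(1))
  ultimately show ?thesis by (rule that)
qed

text \<open>Smoothness of one function cannot be proved alone by induction on the order; a family that is stable under
  partial derivatives can.\<close>

lemma cont_diff_of_invariant:
  assumes "\<And>f x. f \<in> S \<Longrightarrow> f differentiable (at x)"
    and "\<And>f b. f \<in> S \<Longrightarrow> b \<in> Basis \<Longrightarrow> partial_deriv b f \<in> S"
  shows "f \<in> S \<Longrightarrow> cont_diff k f"
proof (induction k arbitrary: f)
  case 0
  then show ?case using assms(1)
    by (auto simp: continuous_on_eq_continuous_at intro: differentiable_imp_continuous_within)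
next
  case (Suc k)
  then show ?case using assms by simp
qed

text \<open>A partial derivative of a product of functions of separate coordinates is again such a product.\<close>

lemma cont_diff_product:
  fixes h :: "'a::euclidean_space \<Rightarrow> real \<Rightarrow> real"
  assumes "\<And>b. b \<in> Basis \<Longrightarrow> smooth1 (h b)"
  shows "cont_diff k (\<lambda>x. \<Prod>b\<in>Basis. h b (x \<bullet> b))"
proof -
  define S where "S = {f. \<exists>h. (\<forall>b\<in>Basis. smooth1 (h b)) \<and> f = (\<lambda>x::'a. \<Prod>b\<in>Basis. h b (x \<bullet> b))}"
  have D: "f differentiable (at x)" "partial_deriv b f \<in> S" if f: "f \<in> S" and b: "b \<in> Basis" for f b x
  proof -
    obtain h where h: "\<And>b. b \<in> Basis \<Longrightarrow> smooth1 (h b)" "f = (\<lambda>x::'a. \<Prod>b\<in>Basis. h b (x \<bullet> b))"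
      using f by (auto simp: S_def)
    have "\<forall>b. \<exists>h'. b \<in> Basis \<longrightarrow> smooth1 h' \<and> (\<forall>x. (h b has_real_derivative h' x) (at x))"
      using h(1) smooth1D by metis
    then obtain h' where h': "\<And>b. b \<in> Basis \<Longrightarrow> smooth1 (h' b)"
        "\<And>b x. b \<in> Basis \<Longrightarrow> (h b has_real_derivative h' b x) (at x)"
      by metis
    have d: "(f has_derivative (\<lambda>v. \<Sum>c\<in>Basis. (h' c (x \<bullet> c) * (v \<bullet> c)) * (\<Prod>b\<in>Basis - {c}. h b (x \<bullet> b)))) (at x)" for x
      unfolding h(2)
    proof (rule has_derivative_prod)
      fix c :: 'a assume c: "c \<in> Basis"
      have "((\<lambda>y. h c (y \<bullet> c)) has_derivative (\<lambda>v. (v \<bullet> c) * h' c (x \<bullet> c))) (at x)"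
        using h'(2)[OF c]
        by (intro DERIV_compose_FDERIV[where f = "h c"] derivative_intros)
      then show "((\<lambda>y. h c (y \<bullet> c)) has_derivative (\<lambda>v. h' c (x \<bullet> c) * (v \<bullet> c))) (at x)"
        by (simp add: mult.commute)
    qed
    show "f differentiable (at x)" using d by (auto simp: differentiable_def)
    define k where "k c = (if c = b then h' b else h c)" for c
    have "partial_deriv b f x = (\<Prod>c\<in>Basis. k c (x \<bullet> c))" for x
    proof -
      have "partial_deriv b f x = (\<Sum>c\<in>Basis. (h' c (x \<bullet> c) * (b \<bullet> c)) * (\<Prod>b\<in>Basis - {c}. h b (x \<bullet> b)))"
        unfolding partial_deriv_def frechet_derivative_at[OF d[of x], symmetric] ..
      also have "\<dots> = (\<Sum>c\<in>Basis. if c = b then h' b (x \<bullet> b) * (\<Prod>c\<in>Basis - {b}. h c (x \<bullet> c)) else 0)"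
        using b by (intro sum.cong) (auto simp: inner_Basis)
      also have "\<dots> = h' b (x \<bullet> b) * (\<Prod>c\<in>Basis - {b}. h c (x \<bullet> c))" using b by simp
      also have "\<dots> = (\<Prod>c\<in>Basis. k c (x \<bullet> c))"
        using b by (subst prod.remove[of Basis b]) (auto simp: k_def intro!: prod.cong)
      finally show ?thesis .
    qed
    then have "partial_deriv b f = (\<lambda>x. \<Prod>c\<in>Basis. k c (x \<bullet> c))" by auto
    moreover have "smooth1 (k c)" if "c \<in> Basis" for c using that b h h' by (simp add: k_def)
    ultimately show "partial_deriv b f \<in> S" by (auto simp: S_def)
  qed
  show ?thesis
  proof (rule cont_diff_of_invariant[of S])
    show "f differentiable (at x)" if "f \<in> S" for f x
      using D(1)[OF that] nonempty_Basis by blast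
    show "(\<lambda>x. \<Prod>b\<in>Basis. h b (x \<bullet> b)) \<in> S" using assms by (auto simp: S_def)
  qed (rule D(2))
qed

lemma smooth1_affine:
  assumes "smooth1 f" shows "smooth1 (\<lambda>x. f (c * x + d))"
proof (rule smooth1_of_invariant[where S = "{\<lambda>x. k * g (c * x + d) |k g. smooth1 g}"])
  show "(\<lambda>x. f (c * x + d)) \<in> {\<lambda>x. k * g (c * x + d) |k g. smooth1 g}"
    using assms by (auto intro!: exI[of _ 1] exI[of _ f])
next
  fix F assume "F \<in> {\<lambda>x. k * g (c * x + d) |k g. smooth1 g}"
  then obtain k g where g: "smooth1 g" "F = (\<lambda>x. k * g (c * x + d))" by auto
  obtain g' where g': "smooth1 g'" "\<And>x. (g has_real_derivative g' x) (at x)" using smooth1D[OF g(1)] by metis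
  have "(F has_real_derivative (k * c) * g' (c * x + d)) (at x)" for x
    unfolding g(2) by (auto intro!: derivative_eq_intros DERIV_chain2[OF g'(2)])
  then show "\<exists>f'\<in>{\<lambda>x. k * g (c * x + d) |k g. smooth1 g}. \<forall>x. (F has_real_derivative f' x) (at x)"
    using g'(1) by (intro bexI[of _ "\<lambda>x. (k * c) * g' (c * x + d)"]) auto
qed

text \<open>Finite sums of products of smooth functions are closed under differentiation.\<close>

lemma smooth1_mult:
  assumes "smooth1 f" "smooth1 g" shows "smooth1 (\<lambda>x. f x * g x)"
proof -
  define S where "S = {\<lambda>x::real. \<Sum>(f, g)\<leftarrow>L. f x * g x |L. \<forall>(f, g)\<in>set L. smooth1 f \<and> smooth1 g}"
  show ?thesis
  proof (rule smooth1_of_invariant[of _ S])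
    show "(\<lambda>x. f x * g x) \<in> S" unfolding S_def
      using assms by (intro CollectI exI[of _ "[(f, g)]"]) auto
  next
    fix F assume "F \<in> S"
    then obtain L where "F = (\<lambda>x. \<Sum>(f, g)\<leftarrow>L. f x * g x)" "\<forall>(f, g)\<in>set L. smooth1 f \<and> smooth1 g"
      by (auto simp: S_def)
    then show "\<exists>f'\<in>S. \<forall>x. (F has_real_derivative f' x) (at x)"
    proof (induction L arbitrary: F)
      case Nil
      then show ?case
        by (intro bexI[of _ "\<lambda>x. 0"]) (auto simp: S_def intro!: exI[of _ "[]"])
    next
      case (Cons p L)
      obtain f g where p: "p = (f, g)" by (cases p)
      have fg: "smooth1 f" "smooth1 g" using Cons.prems(2) p by auto
      obtain f' where f': "smooth1 f'" "\<And>x. (f has_real_derivative f' x) (at x)" using smooth1D[OF fg(1)] by metis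
      obtain g' where g': "smooth1 g'" "\<And>x. (g has_real_derivative g' x) (at x)" using smooth1D[OF fg(2)] by metis
      obtain G where G: "G \<in> S" "\<And>x. ((\<lambda>x. \<Sum>(f, g)\<leftarrow>L. f x * g x) has_real_derivative G x) (at x)"
        using Cons.IH[OF refl] Cons.prems(2) by auto
      obtain L' where L': "G = (\<lambda>x. \<Sum>(f, g)\<leftarrow>L'. f x * g x)" "\<forall>(f, g)\<in>set L'. smooth1 f \<and> smooth1 g"
        using G(1) by (auto simp: S_def)
      have "(F has_real_derivative f' x * g x + f x * g' x + G x) (at x)" for x
        unfolding Cons.prems(1) p
        using DERIV_add[OF DERIV_mult[OF f'(2)[of x] g'(2)[of x]] G(2)[of x]] by (simp add: ac_simps)
      moreover have "(\<lambda>x. f' x * g x + f x * g' x + G x) \<in> S" unfolding S_def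
        using L' fg f'(1) g'(1) by (intro CollectI exI[of _ "(f', g) # (f, g') # L'"]) (auto simp: add.assoc)
      ultimately show ?case
        by (intro bexI[of _ "\<lambda>x. f' x * g x + f x * g' x + G x"]) auto
    qed
  qed
qed

text \<open>Smooth and positive exactly inside the box (for \<open>n > 0\<close>); the factor \<open>n\<close> steepens
  the flanks, so that the sequence tends to the indicator of the box.\<close>

definition box_bump :: "'a::euclidean_space \<Rightarrow> 'a \<Rightarrow> nat \<Rightarrow> 'a \<Rightarrow> real" where
  "box_bump a b n x = (\<Prod>i\<in>Basis. flat 1 (real n * (x \<bullet> i - a \<bullet> i)) * flat 1 (real n * (b \<bullet> i - x \<bullet> i)))"

lemma box_bump_nonneg: "0 \<le> box_bump a b n x"
  unfolding box_bump_def by (intro prod_nonneg) (auto simp: flat_def)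

lemma box_bump_le_1: "box_bump a b n x \<le> 1"
  unfolding box_bump_def by (intro prod_le_1) (auto simp: flat_def mult_le_one)

lemma box_bump_eq_0: "x \<notin> box a b \<Longrightarrow> box_bump a b n x = 0"
proof -
  assume "x \<notin> box a b"
  then obtain i where i: "i \<in> Basis" "\<not> (a \<bullet> i < x \<bullet> i \<and> x \<bullet> i < b \<bullet> i)" by (auto simp: mem_box)
  then have "flat 1 (real n * (x \<bullet> i - a \<bullet> i)) * flat 1 (real n * (b \<bullet> i - x \<bullet> i)) = 0"
    by (auto simp: flat_def zero_less_mult_iff)
  then show ?thesis unfolding box_bump_def using i(1) by (intro prod_zero) auto
qed

lemma test_fun_box_bump:
  assumes "cbox a b \<subseteq> \<Omega>"
  shows "test_fun \<Omega> (box_bump a b n)"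
proof -
  have "cont_diff k (box_bump a b n)" for k
  proof -
    have "smooth1 (\<lambda>t. flat 1 (real n * (t - a \<bullet> i)) * flat 1 (real n * (b \<bullet> i - t)))" for i
      using smooth1_mult[OF smooth1_affine[OF smooth1_flat, of 1 "real n" "- (real n * (a \<bullet> i))"]
          smooth1_affine[OF smooth1_flat, of 1 "- real n" "real n * (b \<bullet> i)"]]
      by (simp add: algebra_simps)
    then have "cont_diff k (\<lambda>x. \<Prod>i\<in>Basis. (\<lambda>t. flat 1 (real n * (t - a \<bullet> i)) * flat 1 (real n * (b \<bullet> i - t))) (x \<bullet> i))"
      by (rule cont_diff_product)
    then show ?thesis unfolding box_bump_def[abs_def] .
  qed
  moreover have "closure {x. box_bump a b n x \<noteq> 0} \<subseteq> cbox a b"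
  proof (rule closure_minimal)
    show "{x. box_bump a b n x \<noteq> 0} \<subseteq> cbox a b"
      using box_bump_eq_0[of _ a b n] box_subset_cbox[of a b] by blast
  qed (rule closed_cbox)
  moreover from this have "compact (closure {x. box_bump a b n x \<noteq> 0})"
    using bounded_cbox bounded_subset closed_closure compact_eq_bounded_closed by blast
  ultimately show ?thesis unfolding test_fun_def using assms by auto
qed

lemma box_bump_tendsto: "(\<lambda>n. box_bump a b n x) \<longlonglongrightarrow> indicator (box a b) x"
proof (cases "x \<in> box a b")
  case True
  have lim: "(\<lambda>n. flat 1 (real n * t)) \<longlonglongrightarrow> 1" if "0 < t" for t
  proof -
    have "(\<lambda>n. exp (- (1 / (real n * t)))) \<longlonglongrightarrow> 1" using that by real_asymp
    moreover have "eventually (\<lambda>n. exp (- (1 / (real n * t))) = flat 1 (real n * t)) sequentially"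
      using eventually_gt_at_top[of 0] by eventually_elim (use that in \<open>simp add: flat_def\<close>)
    ultimately show ?thesis by (rule Lim_transform_eventually)
  qed
  have "(\<lambda>n. box_bump a b n x) \<longlonglongrightarrow> (\<Prod>i\<in>(Basis::'a set). 1 * 1)"
    unfolding box_bump_def
    by (intro tendsto_prod tendsto_mult lim) (use True in \<open>auto simp: mem_box\<close>)
  then show ?thesis using True by simp
next
  case False
  then show ?thesis by (simp add: box_bump_eq_0)
qed

section \<open>Uniqueness of weak derivatives and Green's formula\<close>

lemma test_fun_deriv:
  assumes "test_fun \<Omega> \<phi>"
  shows "(\<phi> has_derivative (\<lambda>h. \<Sum>b\<in>Basis. (h \<bullet> b) * partial_deriv b \<phi> x)) (at x)"
proof -
  have "cont_diff (Suc 0) \<phi>" using assms unfolding test_fun_def by blast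
  then have "\<phi> differentiable (at x)" by simp
  then have d: "(\<phi> has_derivative frechet_derivative \<phi> (at x)) (at x)" by (rule frechet_derivative_works[THEN iffD1])
  then interpret bounded_linear "frechet_derivative \<phi> (at x)" by (rule has_derivative_bounded_linear)
  have "frechet_derivative \<phi> (at x) h = (\<Sum>b\<in>Basis. (h \<bullet> b) * partial_deriv b \<phi> x)" for h
  proof -
    have "frechet_derivative \<phi> (at x) (\<Sum>b\<in>Basis. (h \<bullet> b) *\<^sub>R b) = (\<Sum>b\<in>Basis. (h \<bullet> b) * partial_deriv b \<phi> x)"
      by (simp add: sum scale partial_deriv_def)
    then show ?thesis by (simp add: euclidean_representation)
  qed
  then show ?thesis using d by presburger
qed

lemma test_fun_outside: "test_fun \<Omega> \<phi> \<Longrightarrow> x \<notin> \<Omega> \<Longrightarrow> \<phi> x = 0"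
  unfolding test_fun_def using closure_subset[of "{x. \<phi> x \<noteq> 0}"] by blast

lemma test_fun_continuous: "test_fun \<Omega> \<phi> \<Longrightarrow> continuous_on UNIV \<phi>"
  unfolding test_fun_def by (metis cont_diff.simps(1))

lemma test_fun_partial:
  assumes "test_fun \<Omega> \<phi>" "b \<in> Basis"
  shows "test_fun \<Omega> (partial_deriv b \<phi>)"
proof -
  have cd: "cont_diff k (partial_deriv b \<phi>)" for k
  proof -
    have "cont_diff (Suc k) \<phi>" using assms unfolding test_fun_def by blast
    then show ?thesis using assms(2) by simp
  qed
  let ?K = "closure {x. \<phi> x \<noteq> 0}"
  have "partial_deriv b \<phi> x = 0" if "x \<notin> ?K" for x
  proof -
    have "((\<lambda>x. 0::real) has_derivative (\<lambda>h. 0)) (at x)" by simp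
    then have "(\<phi> has_derivative (\<lambda>h. 0)) (at x)"
    proof (rule has_derivative_transform_within_open)
      show "open (- ?K)" by (rule open_Compl[OF closed_closure])
      show "x \<in> - ?K" using that by simp
      show "0 = \<phi> y" if "y \<in> - ?K" for y using that closure_subset[of "{x. \<phi> x \<noteq> 0}"] by auto
    qed
    from frechet_derivative_at[OF this, symmetric] show ?thesis by (simp add: partial_deriv_def)
  qed
  then have "closure {x. partial_deriv b \<phi> x \<noteq> 0} \<subseteq> ?K"
    by (intro closure_minimal) auto
  moreover have "compact ?K" "?K \<subseteq> \<Omega>" using assms(1) by (auto simp: test_fun_def)
  ultimately show ?thesis using cd unfolding test_fun_def
    by (meson closed_closure compact_Int_closed compact_imp_bounded compact_eq_bounded_closed bounded_subset subset_trans)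
qed

lemma square_int_test:
  assumes "test_fun \<Omega> \<phi>"
  shows "square_int \<phi>"
proof -
  let ?K = "closure {x. \<phi> x \<noteq> 0}"
  have c: "continuous_on UNIV \<phi>" by (rule test_fun_continuous[OF assms])
  have "compact ?K" using assms by (simp add: test_fun_def)
  moreover have "continuous_on ?K (\<lambda>x. (\<phi> x)\<^sup>2)"
    by (intro continuous_intros continuous_on_subset[OF c]) auto
  ultimately have "integrable lborel (\<lambda>x. indicator ?K x *\<^sub>R (\<phi> x)\<^sup>2)" by (rule borel_integrable_compact)
  moreover have "(\<lambda>x. indicator ?K x *\<^sub>R (\<phi> x)\<^sup>2) = (\<lambda>x. (\<phi> x)\<^sup>2)"
  proof
    fix x show "indicator ?K x *\<^sub>R (\<phi> x)\<^sup>2 = (\<phi> x)\<^sup>2"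
      using closure_subset[of "{x. \<phi> x \<noteq> 0}"] by (cases "\<phi> x = 0") (auto simp: subset_iff)
  qed
  moreover have "\<phi> \<in> borel_measurable borel" using c by (rule borel_measurable_continuous_onI)
  ultimately show ?thesis by (simp add: square_int_def)
qed

text \<open>Test functions vanish off \<open>\<Omega>\<close>, so the integrals over \<open>\<Omega>\<close> in the
  definition are inner products on the whole space.\<close>

lemma is_weak_deriv_iff:
  assumes b: "b \<in> Basis"
  shows "is_weak_deriv \<Omega> b u v \<longleftrightarrow> v \<in> L2 \<Omega> \<and>
    (\<forall>\<phi>. test_fun \<Omega> \<phi> \<longrightarrow> inner u (abs_l2 (partial_deriv b \<phi>)) = - inner v (abs_l2 \<phi>))"
proof -
  have *: "(LINT x:\<Omega>|lborel. rep_l2 u x * \<phi> x) = inner u (abs_l2 \<phi>)" if "test_fun \<Omega> \<phi>" for u \<phi>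
    unfolding inner_abs_right[OF square_int_test[OF that]] set_lebesgue_integral_def
    by (rule Bochner_Integration.integral_cong) (auto simp: indicator_def test_fun_outside[OF that])
  then show ?thesis unfolding is_weak_deriv_def
    by (simp add: test_fun_partial[OF _ b] cong: conj_cong imp_cong)
qed

text \<open>Boxes form an intersection-stable generator of the Borel sets, so the integral over every Borel subset
  vanishes, in particular over the sets where \<open>f\<close> is positive and where it is negative.\<close>

lemma AE_zero_on_box_of_integrals:
  fixes f :: "'a::euclidean_space \<Rightarrow> real"
  assumes f: "integrable lborel (\<lambda>x. f x * indicator (box c d) x)"
    and zero: "\<And>a b. box a b \<subseteq> box c d \<Longrightarrow> (\<integral>x. f x * indicator (box a b) x \<partial>lborel) = 0"
  shows "AE x in lborel. x \<in> box c d \<longrightarrow> f x = 0"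
proof -
  let ?g = "\<lambda>x. f x * indicator (box c d) x"
  have gS: "integrable lborel (\<lambda>x. ?g x * indicator S x)" if "S \<in> sets borel" for S
    using integrable_mult_indicator[OF _ f, of S] that by (simp add: mult.commute)
  have P: "(\<integral>x. ?g x * indicator S x \<partial>lborel) = 0" if "S \<in> sets borel" for S
  proof -
    have "Int_stable (range (\<lambda>(a, b). box a b :: 'a set))"
      by (auto simp: Int_stable_def box_Int_box)
    moreover have "range (\<lambda>(a, b). box a b :: 'a set) \<subseteq> Pow UNIV" by simp
    moreover have "S \<in> sigma_sets UNIV (range (\<lambda>(a, b). box a b))"
      using that by (simp add: borel_eq_box)
    ultimately show ?thesis
    proof (induction rule: sigma_sets_induct_disjoint)
      case (basic A)
      then obtain a b where A: "A = box a b" by auto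
      obtain a' b' where ab: "box c d \<inter> box a b = box a' b'"
        using box_Int_box[of c d a b] by blast
      have "(\<lambda>x. ?g x * indicator A x) = (\<lambda>x. f x * indicator (box a' b') x)"
        unfolding A ab[symmetric] by (auto simp: indicator_def)
      moreover have "box a' b' \<subseteq> box c d" using ab by blast
      ultimately show ?case using zero by simp
    next
      case empty
      show ?case by simp
    next
      case (compl A)
      then have A: "A \<in> sets borel" by (simp add: borel_eq_box)
      have "(\<lambda>x. ?g x * indicator (UNIV - A) x) = (\<lambda>x. ?g x - ?g x * indicator A x)"
        by (auto simp: indicator_def)
      then show ?case using compl gS[OF A] f zero[of c d] by simp
    next
      case (union A)
      then have A: "A i \<in> sets lborel" for i by (auto simp: borel_eq_box)
      have "(\<integral>x\<in>(\<Union>i. A i). ?g x \<partial>lborel) = (\<Sum>i. (\<integral>x\<in>(A i). ?g x \<partial>lborel))"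
      proof (rule lebesgue_integral_countable_add)
        show "A i \<inter> A j = {}" if "i \<noteq> j" for i j
          using union(1) that by (auto simp: disjoint_family_on_def)
        show "set_integrable lborel (\<Union>i. A i) ?g"
          unfolding set_integrable_def using gS[of "\<Union>i. A i"] A by (simp add: mult.commute)
      qed (rule A)
      also have "\<dots> = 0" using union(3) by (simp add: set_lebesgue_integral_def mult.commute)
      finally show ?case by (simp add: set_lebesgue_integral_def mult.commute)
    qed
  qed
  have [measurable]: "?g \<in> borel_measurable borel" using borel_measurable_integrable[OF f] by simp
  have nn: "AE x in lborel. k x = 0" if "integrable lborel k" "\<And>x. 0 \<le> k x" "(\<integral>x. k x \<partial>lborel) = 0"
    for k :: "'a \<Rightarrow> real"
    using integral_nonneg_eq_0_iff_AE[of lborel k] that by simp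
  have m: "{x. 0 < ?g x} \<in> sets borel" "{x. ?g x < 0} \<in> sets borel" by measurable
  have "AE x in lborel. ?g x * indicator {x. 0 < ?g x} x = 0"
    by (rule nn[OF gS[OF m(1)] _ P[OF m(1)]]) (simp add: indicator_def)
  moreover have "AE x in lborel. - (?g x * indicator {x. ?g x < 0} x) = 0"
    by (rule nn) (use gS[OF m(2)] P[OF m(2)] in \<open>auto simp: mult_less_0_iff indicator_def\<close>)
  ultimately show ?thesis
  proof eventually_elim
    case (elim x)
    show ?case
    proof
      assume x: "x \<in> box c d"
      then have i: "indicator (box c d) x = (1::real)" by (rule indicator_simps(1))
      show "f x = 0"
      proof (rule ccontr)
        assume "f x \<noteq> 0"
        then consider "0 < f x" | "f x < 0" by linarith
        then show False
        proof cases
          case 1 then show False using elim(1) x by (simp add: i)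
        next
          case 2 then show False using elim(2) x by (simp add: i)
        qed
      qed
    qed
  qed
qed

text \<open>The fundamental lemma of the calculus of variations. Bump functions converge to the indicators of boxes with
  closure in \<open>\<Omega>\<close>, and countably many such boxes cover \<open>\<Omega>\<close>.\<close>

lemma orthogonal_to_test_imp_zero:
  fixes \<Omega> :: "'a::euclidean_space set"
  assumes "open \<Omega>" and w: "w \<in> L2 \<Omega>"
    and orth: "\<And>\<phi>. test_fun \<Omega> \<phi> \<Longrightarrow> inner w (abs_l2 \<phi>) = 0"
  shows "w = 0"
proof -
  have int: "integrable lborel (\<lambda>x. rep_l2 w x * indicator (box a b) x)" for a b
  proof (rule square_int_mult[OF square_int_rep])
    have "emeasure lborel (box a b) < \<infinity>" by (rule emeasure_bounded_finite) (rule bounded_box)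
    then show "square_int (indicator (box a b) :: 'a \<Rightarrow> real)"
      by (intro square_intI) (auto simp: power2_eq_square ennreal_mult ennreal_indicator simp flip: indicator_inter_arith)
  qed
  have zero: "(\<integral>x. rep_l2 w x * indicator (box a b) x \<partial>lborel) = 0" if ab: "cbox a b \<subseteq> \<Omega>" for a b
  proof -
    have "(\<lambda>n. \<integral>x. rep_l2 w x * box_bump a b n x \<partial>lborel) \<longlonglongrightarrow> (\<integral>x. rep_l2 w x * indicator (box a b) x \<partial>lborel)"
    proof (rule integral_dominated_convergence)
      show "integrable lborel (\<lambda>x. norm (rep_l2 w x * indicator (box a b) x))" using int by (rule integrable_norm)
      show "(\<lambda>x. rep_l2 w x * indicator (box a b) x) \<in> borel_measurable lborel" by measurable
      show "(\<lambda>x. rep_l2 w x * box_bump a b n x) \<in> borel_measurable lborel" for n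
        using square_int_mult[OF square_int_rep square_int_test[OF test_fun_box_bump[OF ab]], of w n] by auto
      show "AE x in lborel. (\<lambda>n. rep_l2 w x * box_bump a b n x) \<longlonglongrightarrow> rep_l2 w x * indicator (box a b) x"
        by (intro AE_I2 tendsto_mult tendsto_const box_bump_tendsto)
      show "AE x in lborel. norm (rep_l2 w x * box_bump a b n x) \<le> norm (rep_l2 w x * indicator (box a b) x)" for n
      proof (rule AE_I2)
        fix x
        have "\<bar>box_bump a b n x\<bar> \<le> \<bar>indicator (box a b) x\<bar>"
          using box_bump_nonneg[of a b n x] box_bump_le_1[of a b n x] box_bump_eq_0[of x a b n]
          by (cases "x \<in> box a b") auto
        then show "norm (rep_l2 w x * box_bump a b n x) \<le> norm (rep_l2 w x * indicator (box a b) x)"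
          by (simp add: abs_mult mult_left_mono)
      qed
    qed
    moreover have "(\<integral>x. rep_l2 w x * box_bump a b n x \<partial>lborel) = 0" for n
      using orth[OF test_fun_box_bump[OF ab], of n] inner_abs_right[OF square_int_test[OF test_fun_box_bump[OF ab]], of w n]
      by simp
    ultimately show ?thesis by (simp add: LIMSEQ_const_iff)
  qed
  have box: "AE x in lborel. x \<in> cbox c d \<longrightarrow> rep_l2 w x = 0" if cd: "cbox c d \<subseteq> \<Omega>" for c d
  proof -
    have "AE x in lborel. x \<in> box c d \<longrightarrow> rep_l2 w x = 0"
    proof (rule AE_zero_on_box_of_integrals[OF int])
      fix a b assume sub: "box a b \<subseteq> box c d"
      show "(\<integral>x. rep_l2 w x * indicator (box a b) x \<partial>lborel) = 0"
      proof (cases "box a b = {}")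
        case False
        then have "cbox a b = closure (box a b)" by (simp add: closure_box)
        also have "\<dots> \<subseteq> cbox c d" using sub box_subset_cbox by (intro closure_minimal) auto
        finally show ?thesis using zero cd by blast
      qed simp
    qed
    moreover have "AE x in lborel. x \<notin> cbox c d - box c d"
    proof (rule AE_not_in)
      have "negligible (cbox c d - box c d)" by (rule negligible_frontier_interval)
      then show "cbox c d - box c d \<in> null_sets lborel"
        by (simp add: negligible_iff_null_sets null_sets_completion_iff)
    qed
    ultimately show ?thesis by eventually_elim auto
  qed
  obtain \<D> where \<D>: "countable \<D>" "\<D> \<subseteq> Pow \<Omega>" "\<And>X. X \<in> \<D> \<Longrightarrow> \<exists>a b. X = cbox a b" "\<Union>\<D> = \<Omega>"
    using open_countable_Union_open_cbox[OF assms(1)] by metis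
  have "AE x in lborel. \<forall>X\<in>\<D>. x \<in> X \<longrightarrow> rep_l2 w x = 0"
  proof (subst AE_ball_countable[OF \<D>(1)], rule ballI)
    fix X assume X: "X \<in> \<D>"
    then obtain a b where "X = cbox a b" using \<D>(3) by blast
    then show "AE x in lborel. x \<in> X \<longrightarrow> rep_l2 w x = 0" using box[of a b] \<D>(2) X by blast
  qed
  moreover have "AE x in lborel. x \<notin> \<Omega> \<longrightarrow> rep_l2 w x = 0" using w by (simp add: L2_def)
  moreover have "AE x in lborel. rep_l2 (0::'a l2) x = 0"
    using rep_abs_l2[OF square_int_zero] by (simp add: zero_l2_def)
  ultimately show ?thesis
    by (intro l2_eqI, eventually_elim) (use \<D>(4) in auto)
qed

lemma weak_deriv_eq:
  assumes "open \<Omega>" "b \<in> Basis" and v: "is_weak_deriv \<Omega> b u v"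
  shows "weak_deriv \<Omega> b u = v"
  unfolding weak_deriv_def
proof (rule the_equality, rule v)
  fix v' assume v': "is_weak_deriv \<Omega> b u v'"
  have "v' - v = 0"
  proof (rule orthogonal_to_test_imp_zero[OF assms(1)])
    show "v' - v \<in> L2 \<Omega>" 
    proof (rule subspace_diff[OF subspace_L2])
      show "v' \<in> L2 \<Omega>" using v' unfolding is_weak_deriv_def by (rule conjunct1)
      show "v \<in> L2 \<Omega>" using v unfolding is_weak_deriv_def by (rule conjunct1)
    qed
    show "inner (v' - v) (abs_l2 \<phi>) = 0" if "test_fun \<Omega> \<phi>" for \<phi>
      using v v' that by (simp add: is_weak_deriv_iff[OF assms(2)] inner_diff_left)
  qed
  then show "v' = v" by simp
qed

lemma sobolev_weak_deriv:
  assumes "open \<Omega>" "b \<in> Basis" "u \<in> sobolev (Suc k) \<Omega>"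
  shows "is_weak_deriv \<Omega> b u (weak_deriv \<Omega> b u)" "weak_deriv \<Omega> b u \<in> sobolev k \<Omega>"
proof -
  obtain v where v: "v \<in> sobolev k \<Omega>" "is_weak_deriv \<Omega> b u v" using assms(2,3) by auto
  with weak_deriv_eq[OF assms(1,2) v(2)]
  show "is_weak_deriv \<Omega> b u (weak_deriv \<Omega> b u)" "weak_deriv \<Omega> b u \<in> sobolev k \<Omega>" by auto
qed

lemma sobolev_L2: "u \<in> sobolev k \<Omega> \<Longrightarrow> u \<in> L2 \<Omega>"
  by (cases k) auto

text \<open>For \<open>v\<close> a test function this is the definition of the weak derivative of \<open>w\<close>; both
  sides are continuous for the convergence that defines \<open>H\<^sub>0\<^sup>1\<close>.\<close>

lemma H01_parts:
  assumes "open \<Omega>" "b \<in> Basis" and w: "w \<in> sobolev 1 \<Omega>" and v: "v \<in> H01 \<Omega>"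
  shows "inner (weak_deriv \<Omega> b w) v = - inner w (weak_deriv \<Omega> b v)"
proof -
  obtain \<phi> where \<phi>: "\<And>n. test_fun \<Omega> (\<phi> n)" "(\<lambda>n. abs_l2 (\<phi> n)) \<longlonglongrightarrow> v"
     "\<And>b. b \<in> Basis \<Longrightarrow> (\<lambda>n. abs_l2 (partial_deriv b (\<phi> n))) \<longlonglongrightarrow> weak_deriv \<Omega> b v"
    using v by (auto simp: H01_def)
  have "is_weak_deriv \<Omega> b w (weak_deriv \<Omega> b w)"
    by (rule sobolev_weak_deriv(1)[OF assms(1,2), of w 0]) (use w in simp)
  then have "inner (weak_deriv \<Omega> b w) (abs_l2 (\<phi> n)) = - inner w (abs_l2 (partial_deriv b (\<phi> n)))" for n
    using \<phi>(1) unfolding is_weak_deriv_iff[OF assms(2)] by simp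
  moreover have "(\<lambda>n. inner (weak_deriv \<Omega> b w) (abs_l2 (\<phi> n))) \<longlonglongrightarrow> inner (weak_deriv \<Omega> b w) v"
    by (intro tendsto_intros \<phi>)
  moreover have "(\<lambda>n. - inner w (abs_l2 (partial_deriv b (\<phi> n)))) \<longlonglongrightarrow> - inner w (weak_deriv \<Omega> b v)"
    by (intro tendsto_intros \<phi> assms(2))
  ultimately show ?thesis by (simp add: LIMSEQ_unique)
qed

lemma inner_neg_laplacian:
  fixes \<Omega> :: "'a::euclidean_space set"
  assumes "open \<Omega>" and u: "u \<in> sobolev 2 \<Omega>" and v: "v \<in> H01 \<Omega>"
  shows "inner (neg_laplacian \<Omega> u) v = (\<Sum>b\<in>Basis. inner (weak_deriv \<Omega> b u) (weak_deriv \<Omega> b v))"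
proof -
  have "inner (weak_deriv \<Omega> b (weak_deriv \<Omega> b u)) v = - inner (weak_deriv \<Omega> b u) (weak_deriv \<Omega> b v)"
    if "b \<in> Basis" for b
    by (rule H01_parts[OF assms(1) that _ v], rule sobolev_weak_deriv(2)[OF assms(1) that])
       (use u in \<open>simp add: numeral_2_eq_2\<close>)
  then show ?thesis
    by (simp add: neg_laplacian_def inner_sum_left sum_negf)
qed

section \<open>Poincare and Rellich inequalities for test functions\<close>

definition dirichlet_energy :: "('a::euclidean_space \<Rightarrow> real) \<Rightarrow> real" where
  "dirichlet_energy \<phi> = (\<Sum>b\<in>Basis. (norm (abs_l2 (partial_deriv b \<phi>)))\<^sup>2)"

lemma dirichlet_energy_nonneg: "0 \<le> dirichlet_energy \<phi>"
  unfolding dirichlet_energy_def by (intro sum_nonneg) auto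

lemma nn_integral_translate:
  fixes f :: "'a::euclidean_space \<Rightarrow> ennreal"
  assumes "f \<in> borel_measurable borel"
  shows "(\<integral>\<^sup>+x. f (c + x) \<partial>lborel) = (\<integral>\<^sup>+x. f x \<partial>lborel)"
proof -
  have "(\<integral>\<^sup>+x. f x \<partial>lborel) = (\<integral>\<^sup>+x. f x \<partial>(distr lborel borel ((+) c)))"
    by (simp add: lborel_distr_plus)
  also have "\<dots> = (\<integral>\<^sup>+x. f (c + x) \<partial>lborel)" using assms by (subst nn_integral_distr) auto
  finally show ?thesis by simp
qed

text \<open>The fundamental theorem of calculus along the segment from \<open>x\<close> to \<open>x + h\<close>, followed
  by the Cauchy-Schwarz inequality for the integral over \<open>[0, 1]\<close> and for the directional
  derivative.\<close>

lemma increment_square_le: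
  fixes \<phi> :: "'a::euclidean_space \<Rightarrow> real"
  assumes \<phi>: "test_fun \<Omega> \<phi>"
  shows "ennreal ((\<phi> (x + h) - \<phi> x)\<^sup>2) \<le>
    (\<integral>\<^sup>+t. ennreal ((norm h)\<^sup>2 * (\<Sum>b\<in>Basis. (partial_deriv b \<phi> (x + t *\<^sub>R h))\<^sup>2)) * indicator {0..1} t \<partial>lborel)"
proof -
  define k where "k t = (\<Sum>b\<in>Basis. (h \<bullet> b) * partial_deriv b \<phi> (x + t *\<^sub>R h))" for t :: real
  define c where "c = \<phi> (x + h) - \<phi> x"
  have cont_d: "continuous_on UNIV (partial_deriv b \<phi>)" if "b \<in> Basis" for b
    by (rule test_fun_continuous[OF test_fun_partial[OF \<phi> that]])
  have "continuous_on UNIV (\<lambda>t::real. partial_deriv b \<phi> (x + t *\<^sub>R h))" if "b \<in> Basis" for b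
    by (rule continuous_on_compose2[OF cont_d[OF that]]) (auto intro!: continuous_intros)
  then have k: "continuous_on UNIV k" unfolding k_def by (intro continuous_intros)
  have d: "((\<lambda>t. \<phi> (x + t *\<^sub>R h)) has_real_derivative k t) (at t)" for t
  proof -
    have 1: "((\<lambda>t. x + t *\<^sub>R h) has_derivative (\<lambda>s. s *\<^sub>R h)) (at t)"
      by (auto intro!: derivative_eq_intros)
    have "((\<lambda>t. \<phi> (x + t *\<^sub>R h)) has_derivative
        (\<lambda>s. \<Sum>b\<in>Basis. ((s *\<^sub>R h) \<bullet> b) * partial_deriv b \<phi> (x + t *\<^sub>R h))) (at t)"
      by (rule has_derivative_compose[OF 1 test_fun_deriv[OF \<phi>]])
    moreover have "(\<lambda>s. \<Sum>b\<in>Basis. ((s *\<^sub>R h) \<bullet> b) * partial_deriv b \<phi> (x + t *\<^sub>R h)) = (*) (k t)"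
      by (auto simp: k_def sum_distrib_right sum_distrib_left ac_simps)
    ultimately show ?thesis by (simp add: has_field_derivative_def)
  qed
  have isC: "isCont k t" for t using k by (simp add: continuous_on_eq_continuous_at)
  have c: "(\<integral>t. k t * indicator {0..1} t \<partial>lborel) = c"
    using integral_FTC_Icc_real[of 0 1 "\<lambda>t. \<phi> (x + t *\<^sub>R h)" k] d isC by (simp add: c_def)
  have int: "integrable lborel (\<lambda>t. f t * indicator {0..1} t)" if "continuous_on UNIV f" for f :: "real \<Rightarrow> real"
    using borel_integrable_compact[of "{0..1::real}" f] continuous_on_subset[OF that] by (simp add: mult.commute)
  have one: "(\<integral>t. indicator {0..1::real} t \<partial>lborel) = (1::real)" by simp
  \<comment> \<open>As \<open>c\<close> is the mean of \<open>k\<close> over the unit interval, the next integral is the variance of \<open>k\<close>.\<close>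
  have "0 \<le> (\<integral>t. (k t - c)\<^sup>2 * indicator {0..1} t \<partial>lborel)"
    by (intro integral_nonneg_AE AE_I2) auto
  also have "\<dots> = (\<integral>t. (k t)\<^sup>2 * indicator {0..1} t - 2 * c * (k t * indicator {0..1} t) + c\<^sup>2 * indicator {0..1} t \<partial>lborel)"
    by (intro Bochner_Integration.integral_cong) (auto simp: power2_diff algebra_simps)
  also have "\<dots> = (\<integral>t. (k t)\<^sup>2 * indicator {0..1} t \<partial>lborel) - 2 * c * (\<integral>t. k t * indicator {0..1} t \<partial>lborel)
      + c\<^sup>2 * (\<integral>t. indicator {0..1::real} t \<partial>lborel)"
  proof -
    have "integrable lborel (\<lambda>t. (k t)\<^sup>2 * indicator {0..1} t)" by (intro int continuous_intros k)
    moreover have "integrable lborel (\<lambda>t. 2 * c * (k t * indicator {0..1} t))" by (intro integrable_mult_right int k)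
    moreover have "integrable lborel (\<lambda>t::real. c\<^sup>2 * indicator {0..1} t)" by (intro int continuous_intros)
    ultimately show ?thesis by simp
  qed
  finally have "c\<^sup>2 \<le> (\<integral>t. (k t)\<^sup>2 * indicator {0..1} t \<partial>lborel)"
    unfolding c one by (simp add: power2_eq_square)
  then have "ennreal (c\<^sup>2) \<le> ennreal (\<integral>t. (k t)\<^sup>2 * indicator {0..1} t \<partial>lborel)" by (rule ennreal_leI)
  also have "\<dots> = (\<integral>\<^sup>+t. ennreal ((k t)\<^sup>2 * indicator {0..1} t) \<partial>lborel)"
    by (rule nn_integral_eq_integral[symmetric]) (auto intro!: int continuous_intros k)
  also have "\<dots> \<le> (\<integral>\<^sup>+t. ennreal ((norm h)\<^sup>2 * (\<Sum>b\<in>Basis. (partial_deriv b \<phi> (x + t *\<^sub>R h))\<^sup>2)) * indicator {0..1} t \<partial>lborel)"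
  proof (rule nn_integral_mono)
    fix t :: real
    have "(k t)\<^sup>2 \<le> (\<Sum>b\<in>Basis. (h \<bullet> b)\<^sup>2) * (\<Sum>b\<in>Basis. (partial_deriv b \<phi> (x + t *\<^sub>R h))\<^sup>2)"
      unfolding k_def by (rule Cauchy_Schwarz_ineq_sum)
    also have "(\<Sum>b\<in>Basis. (h \<bullet> b)\<^sup>2) = (norm h)\<^sup>2"
      unfolding power2_norm_eq_inner euclidean_inner[of h h] by (simp add: power2_eq_square)
    finally show "ennreal ((k t)\<^sup>2 * indicator {0..1} t) \<le>
      ennreal ((norm h)\<^sup>2 * (\<Sum>b\<in>Basis. (partial_deriv b \<phi> (x + t *\<^sub>R h))\<^sup>2)) * indicator {0..1} t"
      by (auto simp: indicator_def intro: ennreal_leI)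
  qed
  finally show ?thesis by (simp add: c_def)
qed

text \<open>Integrate the pointwise bound over \<open>x\<close>, exchange the integrals, and use that the gradient norm is
  translation invariant.\<close>

lemma translation_estimate:
  fixes \<phi> :: "'a::euclidean_space \<Rightarrow> real"
  assumes \<phi>: "test_fun \<Omega> \<phi>"
  shows "(\<integral>\<^sup>+x. ennreal ((\<phi> (x + h) - \<phi> x)\<^sup>2) \<partial>lborel) \<le> ennreal ((norm h)\<^sup>2 * dirichlet_energy \<phi>)"
proof -
  define G where "G y = ennreal ((norm h)\<^sup>2 * (\<Sum>b\<in>Basis. (partial_deriv b \<phi> y)\<^sup>2))" for y
  have sq: "square_int (partial_deriv b \<phi>)" if "b \<in> Basis" for b
    by (rule square_int_test[OF test_fun_partial[OF \<phi> that]])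
  have pm: "partial_deriv b \<phi> \<in> borel_measurable borel" if "b \<in> Basis" for b
    using sq[OF that] by (simp add: square_int_def)
  have [measurable]: "G \<in> borel_measurable borel"
    unfolding G_def[abs_def] using pm by (intro measurable_compose[OF _ measurable_ennreal] borel_measurable_times borel_measurable_const borel_measurable_sum borel_measurable_power)
  have "(\<integral>\<^sup>+x. ennreal ((\<phi> (x + h) - \<phi> x)\<^sup>2) \<partial>lborel)
      \<le> (\<integral>\<^sup>+x. (\<integral>\<^sup>+t. G (x + t *\<^sub>R h) * indicator {0..1::real} t \<partial>lborel) \<partial>lborel)"
    unfolding G_def by (intro nn_integral_mono increment_square_le[OF \<phi>])
  also have "\<dots> = (\<integral>\<^sup>+t. (\<integral>\<^sup>+x. G (x + t *\<^sub>R h) * indicator {0..1::real} t \<partial>lborel) \<partial>lborel)"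
    by (rule lborel_pair.Fubini') measurable
  also have "\<dots> = (\<integral>\<^sup>+t. (\<integral>\<^sup>+x. G x \<partial>lborel) * indicator {0..1::real} t \<partial>lborel)"
  proof (rule nn_integral_cong)
    fix t :: real
    have "(\<integral>\<^sup>+x. G (x + t *\<^sub>R h) \<partial>lborel) = (\<integral>\<^sup>+x. G x \<partial>lborel)"
      using nn_integral_translate[of G "t *\<^sub>R h"] by (simp add: add.commute)
    then show "(\<integral>\<^sup>+x. G (x + t *\<^sub>R h) * indicator {0..1} t \<partial>lborel) = (\<integral>\<^sup>+x. G x \<partial>lborel) * indicator {0..1} t"
      by (simp add: nn_integral_multc)
  qed
  also have "\<dots> = (\<integral>\<^sup>+x. G x \<partial>lborel)" by (simp add: nn_integral_cmult)
  also have "\<dots> = ennreal ((norm h)\<^sup>2) * (\<integral>\<^sup>+x. (\<Sum>b\<in>Basis. ennreal ((partial_deriv b \<phi> x)\<^sup>2)) \<partial>lborel)"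
    unfolding G_def using pm
    by (subst nn_integral_cmult[symmetric]) (auto simp: ennreal_mult sum_nonneg sum_ennreal)
  also have "(\<integral>\<^sup>+x. (\<Sum>b\<in>Basis. ennreal ((partial_deriv b \<phi> x)\<^sup>2)) \<partial>lborel) = ennreal (dirichlet_energy \<phi>)"
    using pm sq unfolding dirichlet_energy_def
    by (subst nn_integral_sum) (auto simp: nn_integral_square sum_ennreal)
  also have "ennreal ((norm h)\<^sup>2) * ennreal (dirichlet_energy \<phi>) = ennreal ((norm h)\<^sup>2 * dirichlet_energy \<phi>)"
    by (simp add: ennreal_mult dirichlet_energy_nonneg)
  finally show ?thesis .
qed

text \<open>A translation of length \<open>2 R\<close> separates the supports of \<open>\<phi>\<close> and its translate,
  so the squared norm of the difference is \<open>2 \<parallel>\<phi>\<parallel>\<^sup>2\<close>.\<close>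

lemma poincare_test:
  fixes \<phi> :: "'a::euclidean_space \<Rightarrow> real"
  assumes \<phi>: "test_fun \<Omega> \<phi>" and R: "\<Omega> \<subseteq> ball 0 R" "0 < R"
  shows "(norm (abs_l2 \<phi>))\<^sup>2 \<le> 2 * R\<^sup>2 * dirichlet_energy \<phi>"
proof -
  obtain b :: 'a where b: "b \<in> Basis" using nonempty_Basis by blast
  define h where "h = (2 * R) *\<^sub>R b"
  have nh: "norm h = 2 * R" using R b by (simp add: h_def)
  have sq: "square_int \<phi>" by (rule square_int_test[OF \<phi>])
  have [measurable]: "\<phi> \<in> borel_measurable borel" using sq by (simp add: square_int_def)
  have "\<phi> (x + h) * \<phi> x = 0" for x
  proof (rule ccontr)
    assume "\<phi> (x + h) * \<phi> x \<noteq> 0"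
    then have "x + h \<in> \<Omega>" "x \<in> \<Omega>" using test_fun_outside[OF \<phi>] by fastforce+
    then have "norm (x + h) < R" "norm x < R" using R(1) by auto
    moreover have "norm h \<le> norm (x + h) + norm x" using norm_triangle_ineq4[of "x + h" x] by simp
    ultimately show False using nh by simp
  qed
  then have "(\<phi> (x + h) - \<phi> x)\<^sup>2 = (\<phi> (h + x))\<^sup>2 + (\<phi> x)\<^sup>2" for x
    by (simp add: power2_diff add.commute[of h x])
  then have "(\<integral>\<^sup>+x. ennreal ((\<phi> (x + h) - \<phi> x)\<^sup>2) \<partial>lborel)
     = (\<integral>\<^sup>+x. ennreal ((\<phi> (h + x))\<^sup>2) \<partial>lborel) + (\<integral>\<^sup>+x. ennreal ((\<phi> x)\<^sup>2) \<partial>lborel)"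
    by (simp add: nn_integral_add)
  also have "(\<integral>\<^sup>+x. ennreal ((\<phi> (h + x))\<^sup>2) \<partial>lborel) = (\<integral>\<^sup>+x. ennreal ((\<phi> x)\<^sup>2) \<partial>lborel)"
    by (rule nn_integral_translate) measurable
  finally have "ennreal (2 * (norm (abs_l2 \<phi>))\<^sup>2) \<le> ennreal ((norm h)\<^sup>2 * dirichlet_energy \<phi>)"
    using translation_estimate[OF \<phi>, of h] unfolding nn_integral_square[OF sq]
    by (simp flip: ennreal_plus)
  then have "2 * (norm (abs_l2 \<phi>))\<^sup>2 \<le> (norm h)\<^sup>2 * dirichlet_energy \<phi>"
    by (subst (asm) ennreal_le_iff) (auto simp: dirichlet_energy_nonneg)
  then show ?thesis by (simp add: nh power_mult_distrib mult.assoc mult.left_commute mult.commute)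
qed

text \<open>The variance identity: half the mean square of the differences is the mean square minus the squared mean.
  Extended nonnegative integrals are used on the left so that the order of integration and sums can be changed
  freely later.\<close>

lemma double_integral_variance:
  fixes f :: "'a::euclidean_space \<Rightarrow> real"
  assumes f: "square_int f" and S: "S \<in> sets borel" "emeasure lborel S = ennreal V" "0 \<le> V"
  shows "(\<integral>\<^sup>+y. (\<integral>\<^sup>+x. ennreal ((f x - f y)\<^sup>2) * indicator S x * indicator S y \<partial>lborel) \<partial>lborel)
     = ennreal (2 * (V * (\<integral>x. (f x)\<^sup>2 * indicator S x \<partial>lborel) - (\<integral>x. f x * indicator S x \<partial>lborel)\<^sup>2))"
      (is ?eq)
    and "0 \<le> V * (\<integral>x. (f x)\<^sup>2 * indicator S x \<partial>lborel) - (\<integral>x. f x * indicator S x \<partial>lborel)\<^sup>2" (is ?nonneg)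
proof -
  define A where "A = (\<integral>x. (f x)\<^sup>2 * indicator S x \<partial>lborel)"
  define m where "m = (\<integral>x. f x * indicator S x \<partial>lborel)"
  have sqS: "square_int (indicator S :: 'a \<Rightarrow> real)"
    using S by (intro square_intI) (auto simp: power2_eq_square ennreal_mult ennreal_indicator simp flip: indicator_inter_arith)
  have i1: "integrable lborel (\<lambda>x. f x * indicator S x)" by (rule square_int_mult[OF f sqS])
  have i2: "integrable lborel (\<lambda>x. (f x)\<^sup>2 * indicator S x)"
    using integrable_mult_indicator[of S lborel "\<lambda>x. (f x)\<^sup>2"] f S(1) by (simp add: square_int_def mult.commute)
  have i0: "integrable lborel (indicator S :: 'a \<Rightarrow> real)"
    using S by (simp add: integrable_indicator_iff)
  have V: "(\<integral>x. indicator S x \<partial>lborel) = V" using S by (simp add: measure_def)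
  have inner: "(\<integral>\<^sup>+x. ennreal ((f x - t)\<^sup>2) * indicator S x \<partial>lborel) = ennreal (A - 2 * t * m + t\<^sup>2 * V)" 
    and nn: "0 \<le> A - 2 * t * m + t\<^sup>2 * V" for t
  proof -
    have eq: "(\<lambda>x. (f x - t)\<^sup>2 * indicator S x) = (\<lambda>x. (f x)\<^sup>2 * indicator S x - 2 * t * (f x * indicator S x) + t\<^sup>2 * indicator S x)"
      by (auto simp: power2_diff algebra_simps)
    have int: "integrable lborel (\<lambda>x. (f x - t)\<^sup>2 * indicator S x)"
      unfolding eq using i0 i1 i2 by (intro Bochner_Integration.integrable_add Bochner_Integration.integrable_diff integrable_mult_right)
    have val: "(\<integral>x. (f x - t)\<^sup>2 * indicator S x \<partial>lborel) = A - 2 * t * m + t\<^sup>2 * V"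
      unfolding eq using i0 i1 i2 V by (simp add: A_def m_def)
    have "(\<integral>\<^sup>+x. ennreal ((f x - t)\<^sup>2) * indicator S x \<partial>lborel) = (\<integral>\<^sup>+x. ennreal ((f x - t)\<^sup>2 * indicator S x) \<partial>lborel)"
      by (intro nn_integral_cong) (auto simp: indicator_def)
    also have "\<dots> = ennreal (A - 2 * t * m + t\<^sup>2 * V)"
      unfolding val[symmetric] by (rule nn_integral_eq_integral[OF int]) auto
    finally show "(\<integral>\<^sup>+x. ennreal ((f x - t)\<^sup>2) * indicator S x \<partial>lborel) = ennreal (A - 2 * t * m + t\<^sup>2 * V)" .
    have "0 \<le> (\<integral>x. (f x - t)\<^sup>2 * indicator S x \<partial>lborel)" by (intro integral_nonneg_AE AE_I2) auto
    then show "0 \<le> A - 2 * t * m + t\<^sup>2 * V" unfolding val .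
  qed
  have [measurable]: "f \<in> borel_measurable borel" using f by (simp add: square_int_def)
  have eq: "(\<lambda>y. (A - 2 * f y * m + (f y)\<^sup>2 * V) * indicator S y)
      = (\<lambda>y. A * indicator S y - 2 * m * (f y * indicator S y) + V * ((f y)\<^sup>2 * indicator S y))"
    by (auto simp: algebra_simps)
  have int: "integrable lborel (\<lambda>y. (A - 2 * f y * m + (f y)\<^sup>2 * V) * indicator S y)"
    unfolding eq using i0 i1 i2 by (intro Bochner_Integration.integrable_add Bochner_Integration.integrable_diff integrable_mult_right)
  have val: "(\<integral>y. (A - 2 * f y * m + (f y)\<^sup>2 * V) * indicator S y \<partial>lborel) = 2 * (V * A - m\<^sup>2)"
  proof -
    have "(\<integral>y. (A - 2 * f y * m + (f y)\<^sup>2 * V) * indicator S y \<partial>lborel) = A * V - 2 * m * m + V * A"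
      unfolding eq using i0 i1 i2 V by (simp add: A_def[symmetric] m_def[symmetric])
    then show ?thesis by (simp add: power2_eq_square algebra_simps)
  qed
  have "(\<integral>\<^sup>+y. (\<integral>\<^sup>+x. ennreal ((f x - f y)\<^sup>2) * indicator S x * indicator S y \<partial>lborel) \<partial>lborel)
     = (\<integral>\<^sup>+y. ennreal ((A - 2 * f y * m + (f y)\<^sup>2 * V) * indicator S y) \<partial>lborel)"
  proof (rule nn_integral_cong)
    fix y
    have "(\<integral>\<^sup>+x. ennreal ((f x - f y)\<^sup>2) * indicator S x * indicator S y \<partial>lborel)
       = (\<integral>\<^sup>+x. ennreal ((f x - f y)\<^sup>2) * indicator S x \<partial>lborel) * indicator S y"
      using S(1) by (intro nn_integral_multc borel_measurable_times_ennreal borel_measurable_indicator) auto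
    then show "(\<integral>\<^sup>+x. ennreal ((f x - f y)\<^sup>2) * indicator S x * indicator S y \<partial>lborel)
      = ennreal ((A - 2 * f y * m + (f y)\<^sup>2 * V) * indicator S y)"
      unfolding inner by (auto simp: indicator_def)
  qed
  also have "\<dots> = ennreal (2 * (V * A - m\<^sup>2))"
    unfolding val[symmetric] by (rule nn_integral_eq_integral[OF int]) (auto simp: nn)
  finally show ?eq by (simp add: A_def m_def)
  have "0 \<le> (\<integral>y. (A - 2 * f y * m + (f y)\<^sup>2 * V) * indicator S y \<partial>lborel)"
    using nn by (intro integral_nonneg_AE AE_I2) auto
  then show ?nonneg unfolding val by (simp add: A_def m_def)
qed

definition grid_cell :: "real \<Rightarrow> ('a::euclidean_space \<Rightarrow> int) \<Rightarrow> 'a set" where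
  "grid_cell d k = {x. \<forall>b\<in>Basis. of_int (k b) * d \<le> x \<bullet> b \<and> x \<bullet> b < (of_int (k b) + 1) * d}"

lemma grid_cell_borel [measurable]: "grid_cell d k \<in> sets borel"
  unfolding grid_cell_def by measurable

lemma emeasure_grid_cell:
  assumes "0 < d"
  shows "emeasure lborel (grid_cell d k :: 'a::euclidean_space set) = ennreal (d ^ DIM('a))"
proof -
  define l u :: 'a where "l = (\<Sum>b\<in>Basis. (of_int (k b) * d) *\<^sub>R b)"
    and "u = (\<Sum>b\<in>Basis. ((of_int (k b) + 1) * d) *\<^sub>R b)"
  have lu: "l \<bullet> b = of_int (k b) * d" "u \<bullet> b = (of_int (k b) + 1) * d" if "b \<in> Basis" for b
    using that by (simp_all add: l_def u_def)
  have le: "l \<bullet> b \<le> u \<bullet> b" if "b \<in> Basis" for b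
    using assms lu[OF that] by (simp add: mult_right_mono)
  have prod: "(\<Prod>b\<in>Basis. (u - l) \<bullet> b) = d ^ DIM('a)"
    using lu by (simp add: inner_diff_left algebra_simps)
  have "box l u \<subseteq> grid_cell d k" "grid_cell d k \<subseteq> cbox l u"
    by (auto simp: grid_cell_def mem_box lu less_imp_le)
  then have "emeasure lborel (box l u) \<le> emeasure lborel (grid_cell d k)"
      "emeasure lborel (grid_cell d k) \<le> emeasure lborel (cbox l u)"
    by (auto intro!: emeasure_mono)
  moreover have "emeasure lborel (box l u) = ennreal (d ^ DIM('a))"
    using emeasure_lborel_box[OF le] prod by simp
  moreover have "emeasure lborel (cbox l u) = ennreal (d ^ DIM('a))"
    using emeasure_lborel_cbox_eq[of l u] le prod by simp
  ultimately show ?thesis by (metis antisym)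
qed

lemma grid_cell_iff:
  assumes "0 < d" "k \<in> extensional Basis"
  shows "x \<in> grid_cell d k \<longleftrightarrow> k = (\<lambda>b\<in>Basis. \<lfloor>(x \<bullet> b) / d\<rfloor>)"
proof -
  have "x \<in> grid_cell d k \<longleftrightarrow> (\<forall>b\<in>Basis. k b = \<lfloor>(x \<bullet> b) / d\<rfloor>)"
    unfolding grid_cell_def mem_Collect_eq
  proof (intro ball_cong refl)
    fix b
    have "k b = \<lfloor>(x \<bullet> b) / d\<rfloor> \<longleftrightarrow> of_int (k b) \<le> (x \<bullet> b) / d \<and> (x \<bullet> b) / d < of_int (k b) + 1"
      by (metis floor_eq_iff)
    also have "\<dots> \<longleftrightarrow> of_int (k b) * d \<le> x \<bullet> b \<and> x \<bullet> b < (of_int (k b) + 1) * d"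
      using assms(1) by (simp add: pos_le_divide_eq pos_divide_less_eq)
    finally show "(of_int (k b) * d \<le> x \<bullet> b \<and> x \<bullet> b < (of_int (k b) + 1) * d) = (k b = \<lfloor>(x \<bullet> b) / d\<rfloor>)"
      by simp
  qed
  also have "\<dots> \<longleftrightarrow> k = (\<lambda>b\<in>Basis. \<lfloor>(x \<bullet> b) / d\<rfloor>)"
    using assms(2) by (auto simp: extensional_def restrict_def fun_eq_iff)
  finally show ?thesis .
qed

lemma sum_grid_indicator:
  assumes "0 < d" "finite I" "I \<subseteq> extensional Basis"
  shows "(\<Sum>k\<in>I. indicator (grid_cell d k) x) = (if (\<lambda>b\<in>Basis. \<lfloor>(x \<bullet> b) / d\<rfloor>) \<in> I then 1 else (0::'b::{semiring_1}))"
proof -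
  have "(\<Sum>k\<in>I. indicator (grid_cell d k) x) = (\<Sum>k\<in>I. if k = (\<lambda>b\<in>Basis. \<lfloor>(x \<bullet> b) / d\<rfloor>) then 1 else (0::'b))"
    using grid_cell_iff[OF assms(1)] assms(3) by (intro sum.cong) (auto simp: indicator_def)
  also have "\<dots> = (if (\<lambda>b\<in>Basis. \<lfloor>(x \<bullet> b) / d\<rfloor>) \<in> I then 1 else 0)"
    using assms(2) by simp
  finally show ?thesis .
qed

text \<open>Two points of one cell differ by a vector of the cube \<open>D = [-d, d]\<^sup>n\<close>. So the sum is at
  most the integral over \<open>h \<in> D\<close> of \<open>\<parallel>\<phi>(\<cdot> + h) -
  \<phi>\<parallel>\<^sup>2\<close>, which the translation estimate controls.\<close>

lemma grid_variance_sum: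
  fixes \<phi> :: "'a::euclidean_space \<Rightarrow> real" and d :: real
  assumes \<phi>: "test_fun \<Omega> \<phi>" and d: "0 < d" and I: "finite I" "I \<subseteq> extensional Basis"
  shows "(\<Sum>k\<in>I. \<integral>\<^sup>+y. (\<integral>\<^sup>+x. ennreal ((\<phi> x - \<phi> y)\<^sup>2) * indicator (grid_cell d k) x * indicator (grid_cell d k) y \<partial>lborel) \<partial>lborel)
     \<le> ennreal ((2 * d) ^ DIM('a) * (DIM('a) * d\<^sup>2 * dirichlet_energy \<phi>))"
proof -
  define D where "D = (cbox (- d *\<^sub>R One) (d *\<^sub>R One) :: 'a set)"
  have [measurable]: "D \<in> sets borel" by (simp add: D_def)
  have [measurable]: "\<phi> \<in> borel_measurable borel"
    using square_int_test[OF \<phi>] by (simp add: square_int_def)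
  have D: "emeasure lborel D = ennreal ((2 * d) ^ DIM('a))"
  proof -
    have "(\<Prod>b\<in>Basis. (d *\<^sub>R One - (- d) *\<^sub>R One) \<bullet> (b::'a)) = (\<Prod>b\<in>(Basis::'a set). 2 * d)"
      by (intro prod.cong) (auto simp: inner_diff_left inner_add_left)
    then show ?thesis unfolding D_def emeasure_lborel_cbox_eq using d by simp
  qed
  have normD: "(norm h)\<^sup>2 \<le> DIM('a) * d\<^sup>2" if "h \<in> D" for h
  proof -
    have "(norm h)\<^sup>2 = (\<Sum>b\<in>Basis. (h \<bullet> b)\<^sup>2)"
      unfolding power2_norm_eq_inner euclidean_inner[of h h] by (simp add: power2_eq_square)
    also have "\<dots> \<le> (\<Sum>b\<in>(Basis::'a set). d\<^sup>2)"
    proof (rule sum_mono)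
      fix b :: 'a assume b: "b \<in> Basis"
      then have "\<bar>h \<bullet> b\<bar> \<le> d" using that by (auto simp: D_def mem_box abs_le_iff)
      then show "(h \<bullet> b)\<^sup>2 \<le> d\<^sup>2" using d by (simp add: abs_le_square_iff[symmetric])
    qed
    finally show ?thesis by simp
  qed
  have cells: "(\<Sum>k\<in>I. indicator (grid_cell d k) x * indicator (grid_cell d k) y) \<le> (indicator D (x - y) :: ennreal)" for x y
  proof (cases "x - y \<in> D")
    case True
    have "(\<Sum>k\<in>I. indicator (grid_cell d k) x * indicator (grid_cell d k) y) \<le> (\<Sum>k\<in>I. indicator (grid_cell d k) x :: ennreal)"
      by (intro sum_mono) (auto simp: indicator_def)
    also have "\<dots> \<le> 1" unfolding sum_grid_indicator[OF d I] by simp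
    finally show ?thesis using True by simp
  next
    case False
    have "x \<notin> grid_cell d k \<or> y \<notin> grid_cell d k" for k
    proof (rule ccontr)
      assume "\<not> ?thesis"
      then have "\<bar>(x - y) \<bullet> b\<bar> \<le> d" if "b \<in> Basis" for b
        using that by (force simp: grid_cell_def inner_diff_left algebra_simps abs_le_iff)
      then have "x - y \<in> D" by (auto simp: D_def mem_box abs_le_iff) (smt (verit))
      then show False using False by simp
    qed
    then have "(\<Sum>k\<in>I. indicator (grid_cell d k) x * indicator (grid_cell d k) y) = (0::ennreal)"
      by (intro sum.neutral) (auto simp: indicator_def)
    then show ?thesis by simp
  qed
  have "(\<Sum>k\<in>I. \<integral>\<^sup>+y. (\<integral>\<^sup>+x. ennreal ((\<phi> x - \<phi> y)\<^sup>2) * indicator (grid_cell d k) x * indicator (grid_cell d k) y \<partial>lborel) \<partial>lborel)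
     = (\<integral>\<^sup>+y. (\<integral>\<^sup>+x. (\<Sum>k\<in>I. ennreal ((\<phi> x - \<phi> y)\<^sup>2) * indicator (grid_cell d k) x * indicator (grid_cell d k) y) \<partial>lborel) \<partial>lborel)"
    by (simp add: nn_integral_sum)
  also have "\<dots> \<le> (\<integral>\<^sup>+y. (\<integral>\<^sup>+x. ennreal ((\<phi> x - \<phi> y)\<^sup>2) * indicator D (x - y) \<partial>lborel) \<partial>lborel)"
    using cells by (intro nn_integral_mono) (auto simp: mult.assoc sum_distrib_left[symmetric] intro!: mult_left_mono)
  also have "\<dots> = (\<integral>\<^sup>+y. (\<integral>\<^sup>+h. ennreal ((\<phi> (y + h) - \<phi> y)\<^sup>2) * indicator D h \<partial>lborel) \<partial>lborel)"
  proof (rule nn_integral_cong)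
    fix y
    have "(\<lambda>x. ennreal ((\<phi> x - \<phi> y)\<^sup>2) * indicator D (x - y)) \<in> borel_measurable borel" by measurable
    from nn_integral_translate[OF this, of y]
    show "(\<integral>\<^sup>+x. ennreal ((\<phi> x - \<phi> y)\<^sup>2) * indicator D (x - y) \<partial>lborel)
       = (\<integral>\<^sup>+h. ennreal ((\<phi> (y + h) - \<phi> y)\<^sup>2) * indicator D h \<partial>lborel)" by simp
  qed
  also have "\<dots> = (\<integral>\<^sup>+h. (\<integral>\<^sup>+y. ennreal ((\<phi> (y + h) - \<phi> y)\<^sup>2) * indicator D h \<partial>lborel) \<partial>lborel)"
    by (rule lborel_pair.Fubini') measurable
  also have "\<dots> \<le> (\<integral>\<^sup>+h. ennreal (DIM('a) * d\<^sup>2 * dirichlet_energy \<phi>) * indicator D h \<partial>lborel)"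
  proof (rule nn_integral_mono)
    fix h :: 'a
    have "(\<integral>\<^sup>+y. ennreal ((\<phi> (y + h) - \<phi> y)\<^sup>2) * indicator D h \<partial>lborel)
       = (\<integral>\<^sup>+y. ennreal ((\<phi> (y + h) - \<phi> y)\<^sup>2) \<partial>lborel) * indicator D h"
      by (intro nn_integral_multc) measurable
    also have "\<dots> \<le> ennreal ((norm h)\<^sup>2 * dirichlet_energy \<phi>) * indicator D h"
      by (intro mult_right_mono translation_estimate[OF \<phi>]) simp
    also have "\<dots> \<le> ennreal (DIM('a) * d\<^sup>2 * dirichlet_energy \<phi>) * indicator D h"
      using normD[of h] by (auto simp: indicator_def intro!: ennreal_leI mult_right_mono dirichlet_energy_nonneg)
    finally show "(\<integral>\<^sup>+y. ennreal ((\<phi> (y + h) - \<phi> y)\<^sup>2) * indicator D h \<partial>lborel)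
       \<le> ennreal (DIM('a) * d\<^sup>2 * dirichlet_energy \<phi>) * indicator D h" .
  qed
  also have "\<dots> = ennreal ((2 * d) ^ DIM('a) * (DIM('a) * d\<^sup>2 * dirichlet_energy \<phi>))"
  proof (subst nn_integral_cmult_indicator)
    show "ennreal (DIM('a) * d\<^sup>2 * dirichlet_energy \<phi>) * emeasure lborel D
       = ennreal ((2 * d) ^ DIM('a) * (DIM('a) * d\<^sup>2 * dirichlet_energy \<phi>))"
      unfolding D using d by (subst ennreal_mult[symmetric]) (auto simp: dirichlet_energy_nonneg mult.commute)
  qed simp
  finally show ?thesis .
qed

text \<open>The coordinates along the normalised cell indicators are the cell means of \<open>\<phi>\<close>; what they
  miss of \<open>\<parallel>\<phi>\<parallel>\<^sup>2\<close> is the sum of the variances on the cells.\<close>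

lemma finite_rank_estimate_test:
  fixes \<Omega> :: "'a::euclidean_space set"
  assumes \<Omega>: "\<Omega> \<subseteq> ball 0 R" and e: "0 < e"
  shows "\<exists>W. finite W \<and> (\<forall>w\<in>W. norm w \<le> 1) \<and>
    (\<forall>\<phi>. test_fun \<Omega> \<phi> \<longrightarrow> (norm (abs_l2 \<phi>))\<^sup>2 \<le> e * dirichlet_energy \<phi> + (\<Sum>w\<in>W. (inner (abs_l2 \<phi>) w)\<^sup>2))"
proof -
  \<comment> \<open>This mesh width makes the constant \<open>2\<^sup>n n d\<^sup>2\<close> of the grid estimate equal to \<open>e\<close>.\<close>
  define d where "d = sqrt (e / (2 ^ DIM('a) * DIM('a)))"
  have d: "0 < d" using e by (simp add: d_def)
  have d2: "2 ^ DIM('a) * (DIM('a) * d\<^sup>2) = e" using e by (simp add: d_def)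
  define V where "V = d ^ DIM('a)"
  have V: "0 < V" using d by (simp add: V_def)
  \<comment> \<open>Indices of all cells that can meet the ball of radius \<open>R\<close>.\<close>
  define I where "I = (PiE (Basis::'a set) (\<lambda>_. {- \<lceil>\<bar>R\<bar> / d\<rceil> - 1 .. \<lceil>\<bar>R\<bar> / d\<rceil> + 1}))"
  have I: "finite I" "I \<subseteq> extensional Basis"
    unfolding I_def by (rule finite_PiE) (auto simp: PiE_def)
  have cover: "(\<lambda>b\<in>Basis. \<lfloor>(x \<bullet> b) / d\<rfloor>) \<in> I" if "x \<in> \<Omega>" for x
  proof -
    have "\<lfloor>(x \<bullet> b) / d\<rfloor> \<in> {- \<lceil>\<bar>R\<bar> / d\<rceil> - 1 .. \<lceil>\<bar>R\<bar> / d\<rceil> + 1}" if "b \<in> Basis" for b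
    proof -
      have "norm x < R" using \<Omega> \<open>x \<in> \<Omega>\<close> by auto
      then have "\<bar>x \<bullet> b\<bar> \<le> \<bar>R\<bar>" using Basis_le_norm[OF that, of x] by linarith
      then have "\<bar>(x \<bullet> b) / d\<bar> \<le> \<bar>R\<bar> / d" using d by (simp add: divide_right_mono)
      then have "- (\<bar>R\<bar> / d) \<le> (x \<bullet> b) / d" "(x \<bullet> b) / d \<le> \<bar>R\<bar> / d" by linarith+
      then show ?thesis unfolding atLeastAtMost_iff by linarith
    qed
    then show ?thesis by (auto simp: I_def)
  qed
  define g where "g k = (\<lambda>x::'a. (1 / sqrt V) * indicator (grid_cell d k) x)" for k
  have sqi: "square_int (indicator (grid_cell d k) :: 'a \<Rightarrow> real)" for k
    using emeasure_grid_cell[OF d, of k]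
    by (intro square_intI) (auto simp: power2_eq_square ennreal_mult ennreal_indicator simp flip: indicator_inter_arith)
  have sqg: "square_int (g k)" for k unfolding g_def by (rule square_int_scale[OF sqi])
  define w where "w k = abs_l2 (g k)" for k
  have ip: "inner (w k) (w l) = (if k = l then 1 else 0)" if "k \<in> I" "l \<in> I" for k l
  proof -
    have "inner (w k) (w l) = (\<integral>x. g k x * g l x \<partial>lborel)"
      unfolding w_def by (rule inner_l2.abs_eq) (auto simp: ae_rel_def sqg)
    also have "\<dots> = (\<integral>x. (1 / V) * indicator (grid_cell d k \<inter> grid_cell d l) x \<partial>lborel)"
      using V by (intro Bochner_Integration.integral_cong) (auto simp: g_def indicator_def)
    also have "grid_cell d k \<inter> grid_cell d l = (if k = l then grid_cell d k else {})"
    proof (cases "k = l")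
      case False
      have "k \<in> extensional Basis" "l \<in> extensional Basis" using I(2) that by auto
      then have "x \<notin> grid_cell d k \<or> x \<notin> grid_cell d l" for x
        using grid_cell_iff[OF d, of k x] grid_cell_iff[OF d, of l x] False by metis
      then show ?thesis using False by auto
    qed simp
    also have "(\<integral>x. (1 / V) * indicator (if k = l then grid_cell d k else {}) x \<partial>lborel) = (if k = l then 1 else 0)"
      using V d emeasure_grid_cell[OF d, of k] by (cases "k = l") (auto simp: measure_def V_def)
    finally show ?thesis .
  qed
  have nw: "norm (w k) = 1" if "k \<in> I" for k using ip[OF that that] by (simp add: norm_eq_1)
  have "inj_on w I" by (rule inj_onI) (metis ip zero_neq_one)
  have est: "(norm (abs_l2 \<phi>))\<^sup>2 \<le> e * dirichlet_energy \<phi> + (\<Sum>k\<in>I. (inner (abs_l2 \<phi>) (w k))\<^sup>2)" if \<phi>: "test_fun \<Omega> \<phi>" for \<phi>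
  proof -
    have sq: "square_int \<phi>" by (rule square_int_test[OF \<phi>])
    define A where "A k = (\<integral>x. (\<phi> x)\<^sup>2 * indicator (grid_cell d k) x \<partial>lborel)" for k
    define m where "m k = (\<integral>x. \<phi> x * indicator (grid_cell d k) x \<partial>lborel)" for k
    have sumA: "(\<Sum>k\<in>I. A k) = (norm (abs_l2 \<phi>))\<^sup>2"
    proof -
      have "(\<Sum>k\<in>I. A k) = (\<integral>x. (\<Sum>k\<in>I. (\<phi> x)\<^sup>2 * indicator (grid_cell d k) x) \<partial>lborel)"
        unfolding A_def
      proof (rule Bochner_Integration.integral_sum[symmetric])
        fix k
        show "integrable lborel (\<lambda>x. (\<phi> x)\<^sup>2 * indicator (grid_cell d k) x)"
          using integrable_mult_indicator[of "grid_cell d k" lborel "\<lambda>x. (\<phi> x)\<^sup>2"] sq by (simp add: square_int_def mult.commute)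
      qed
      also have "\<dots> = (\<integral>x. (\<phi> x)\<^sup>2 \<partial>lborel)"
      proof (rule Bochner_Integration.integral_cong[OF refl])
        fix x show "(\<Sum>k\<in>I. (\<phi> x)\<^sup>2 * indicator (grid_cell d k) x) = (\<phi> x)\<^sup>2"
          unfolding sum_distrib_left[symmetric] sum_grid_indicator[OF d I]
          using cover[of x] test_fun_outside[OF \<phi>, of x] by (cases "x \<in> \<Omega>") auto
      qed
      finally show ?thesis by (simp add: norm_abs_sq[OF sq])
    qed
    have mw: "inner (abs_l2 \<phi>) (w k) = m k / sqrt V" for k
    proof -
      have "inner (abs_l2 \<phi>) (w k) = (\<integral>x. \<phi> x * g k x \<partial>lborel)"
        unfolding w_def by (rule inner_l2.abs_eq) (auto simp: ae_rel_def sqg sq)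
      also have "\<dots> = (\<integral>x. (1 / sqrt V) * (\<phi> x * indicator (grid_cell d k) x) \<partial>lborel)"
        by (intro Bochner_Integration.integral_cong) (auto simp: g_def)
      finally show ?thesis by (simp add: m_def)
    qed
    have nn: "0 \<le> V * A k - (m k)\<^sup>2" for k
      using double_integral_variance(2)[OF sq grid_cell_borel emeasure_grid_cell[OF d] less_imp_le[OF V[unfolded V_def]]]
      by (simp add: A_def m_def V_def)
    have "ennreal (\<Sum>k\<in>I. 2 * (V * A k - (m k)\<^sup>2)) = (\<Sum>k\<in>I. ennreal (2 * (V * A k - (m k)\<^sup>2)))"
      by (rule sum_ennreal[symmetric]) (use nn in simp)
    also have "\<dots> \<le> ennreal ((2 * d) ^ DIM('a) * (DIM('a) * d\<^sup>2 * dirichlet_energy \<phi>))"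
      using grid_variance_sum[OF \<phi> d I] V
      unfolding double_integral_variance(1)[OF sq grid_cell_borel emeasure_grid_cell[OF d] less_imp_le[OF V[unfolded V_def]]]
      by (simp add: A_def m_def V_def)
    also have "(2 * d) ^ DIM('a) * (DIM('a) * d\<^sup>2 * dirichlet_energy \<phi>) = V * (e * dirichlet_energy \<phi>)"
      unfolding d2[symmetric] by (simp add: V_def power_mult_distrib)
    finally have "(\<Sum>k\<in>I. 2 * (V * A k - (m k)\<^sup>2)) \<le> V * (e * dirichlet_energy \<phi>)"
      using V e dirichlet_energy_nonneg[of \<phi>] by (subst (asm) ennreal_le_iff) auto
    then have "2 * (V * (norm (abs_l2 \<phi>))\<^sup>2 - (\<Sum>k\<in>I. (m k)\<^sup>2)) \<le> V * (e * dirichlet_energy \<phi>)"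
      by (simp add: sum_distrib_left[symmetric] sum_subtractf sumA)
    then have "V * (norm (abs_l2 \<phi>))\<^sup>2 \<le> V * (e * dirichlet_energy \<phi>) + (\<Sum>k\<in>I. (m k)\<^sup>2)"
    proof -
      have "0 \<le> V * (e * dirichlet_energy \<phi>)" using V e dirichlet_energy_nonneg[of \<phi>] by simp
      then show ?thesis using \<open>2 * (V * (norm (abs_l2 \<phi>))\<^sup>2 - (\<Sum>k\<in>I. (m k)\<^sup>2)) \<le> V * (e * dirichlet_energy \<phi>)\<close>
        by argo
    qed
    moreover have "(\<Sum>k\<in>I. (m k)\<^sup>2) = V * (\<Sum>k\<in>I. (inner (abs_l2 \<phi>) (w k))\<^sup>2)"
      using V by (simp add: mw power_divide sum_distrib_left)
    ultimately have "V * (norm (abs_l2 \<phi>))\<^sup>2 \<le> V * (e * dirichlet_energy \<phi> + (\<Sum>k\<in>I. (inner (abs_l2 \<phi>) (w k))\<^sup>2))"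
      by (simp add: distrib_left)
    then show ?thesis using V by simp
  qed
  show ?thesis
  proof (intro exI[of _ "w ` I"] conjI)
    show "finite (w ` I)" using I by simp
    show "\<forall>w\<in>w ` I. norm w \<le> 1" using nw by simp
    show "\<forall>\<phi>. test_fun \<Omega> \<phi> \<longrightarrow> (norm (abs_l2 \<phi>))\<^sup>2 \<le> e * dirichlet_energy \<phi> + (\<Sum>w\<in>w ` I. (inner (abs_l2 \<phi>) w)\<^sup>2)"
      using est \<open>inj_on w I\<close> by (simp add: sum.reindex)
  qed
qed

section \<open>The estimates on \<open>H\<^sub>0\<^sup>1\<close>\<close>

lemma H01_approx:
  assumes "u \<in> H01 \<Omega>"
  obtains \<phi> where "\<And>n. test_fun \<Omega> (\<phi> n)" "(\<lambda>n. abs_l2 (\<phi> n)) \<longlonglongrightarrow> u"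
    "(\<lambda>n. dirichlet_energy (\<phi> n)) \<longlonglongrightarrow> (\<Sum>b\<in>Basis. (norm (weak_deriv \<Omega> b u))\<^sup>2)"
proof -
  obtain \<phi> where \<phi>: "\<And>n. test_fun \<Omega> (\<phi> n)" "(\<lambda>n. abs_l2 (\<phi> n)) \<longlonglongrightarrow> u"
     "\<And>b. b \<in> Basis \<Longrightarrow> (\<lambda>n. abs_l2 (partial_deriv b (\<phi> n))) \<longlonglongrightarrow> weak_deriv \<Omega> b u"
    using assms by (auto simp: H01_def)
  have "(\<lambda>n. dirichlet_energy (\<phi> n)) \<longlonglongrightarrow> (\<Sum>b\<in>Basis. (norm (weak_deriv \<Omega> b u))\<^sup>2)"
    unfolding dirichlet_energy_def by (intro tendsto_intros \<phi>(3))
  with \<phi>(1,2) show ?thesis by (rule that)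
qed

lemma poincare_H01:
  assumes R: "\<Omega> \<subseteq> ball 0 R" "0 < R" and u: "u \<in> H01 \<Omega>"
  shows "(norm u)\<^sup>2 \<le> 2 * R\<^sup>2 * (\<Sum>b\<in>Basis. (norm (weak_deriv \<Omega> b u))\<^sup>2)"
proof -
  obtain \<phi> where \<phi>: "\<And>n. test_fun \<Omega> (\<phi> n)" "(\<lambda>n. abs_l2 (\<phi> n)) \<longlonglongrightarrow> u"
    "(\<lambda>n. dirichlet_energy (\<phi> n)) \<longlonglongrightarrow> (\<Sum>b\<in>Basis. (norm (weak_deriv \<Omega> b u))\<^sup>2)"
    using H01_approx[OF u] by metis
  show ?thesis
  proof (rule LIMSEQ_le)
    show "(\<lambda>n. (norm (abs_l2 (\<phi> n)))\<^sup>2) \<longlonglongrightarrow> (norm u)\<^sup>2" by (intro tendsto_intros \<phi>)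
    show "(\<lambda>n. 2 * R\<^sup>2 * dirichlet_energy (\<phi> n)) \<longlonglongrightarrow> 2 * R\<^sup>2 * (\<Sum>b\<in>Basis. (norm (weak_deriv \<Omega> b u))\<^sup>2)"
      by (intro tendsto_intros \<phi>)
    show "\<exists>N. \<forall>n\<ge>N. (norm (abs_l2 (\<phi> n)))\<^sup>2 \<le> 2 * R\<^sup>2 * dirichlet_energy (\<phi> n)"
      using poincare_test[OF \<phi>(1) R] by blast
  qed
qed

lemma finite_rank_estimate_H01:
  fixes \<Omega> :: "'a::euclidean_space set"
  assumes \<Omega>: "\<Omega> \<subseteq> ball 0 R" and e: "0 < e"
  shows "\<exists>W. finite W \<and> (\<forall>w\<in>W. norm w \<le> 1) \<and>
    (\<forall>u\<in>H01 \<Omega>. (norm u)\<^sup>2 \<le> e * (\<Sum>b\<in>Basis. (norm (weak_deriv \<Omega> b u))\<^sup>2) + (\<Sum>w\<in>W. (inner u w)\<^sup>2))"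
proof -
  obtain W where W: "finite W" "\<forall>w\<in>W. norm w \<le> 1"
      "\<And>\<phi>. test_fun \<Omega> \<phi> \<Longrightarrow> (norm (abs_l2 \<phi>))\<^sup>2 \<le> e * dirichlet_energy \<phi> + (\<Sum>w\<in>W. (inner (abs_l2 \<phi>) w)\<^sup>2)"
    using finite_rank_estimate_test[OF assms] by blast
  have "(norm u)\<^sup>2 \<le> e * (\<Sum>b\<in>Basis. (norm (weak_deriv \<Omega> b u))\<^sup>2) + (\<Sum>w\<in>W. (inner u w)\<^sup>2)"
    if u: "u \<in> H01 \<Omega>" for u
  proof -
    obtain \<phi> where \<phi>: "\<And>n. test_fun \<Omega> (\<phi> n)" "(\<lambda>n. abs_l2 (\<phi> n)) \<longlonglongrightarrow> u"
      "(\<lambda>n. dirichlet_energy (\<phi> n)) \<longlonglongrightarrow> (\<Sum>b\<in>Basis. (norm (weak_deriv \<Omega> b u))\<^sup>2)"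
      using H01_approx[OF u] by metis
    show ?thesis
    proof (rule LIMSEQ_le)
      show "(\<lambda>n. (norm (abs_l2 (\<phi> n)))\<^sup>2) \<longlonglongrightarrow> (norm u)\<^sup>2" by (intro tendsto_intros \<phi>)
      show "(\<lambda>n. e * dirichlet_energy (\<phi> n) + (\<Sum>w\<in>W. (inner (abs_l2 (\<phi> n)) w)\<^sup>2)) \<longlonglongrightarrow>
          e * (\<Sum>b\<in>Basis. (norm (weak_deriv \<Omega> b u))\<^sup>2) + (\<Sum>w\<in>W. (inner u w)\<^sup>2)"
        by (intro tendsto_intros \<phi>)
      show "\<exists>N. \<forall>n\<ge>N. (norm (abs_l2 (\<phi> n)))\<^sup>2 \<le> e * dirichlet_energy (\<phi> n) + (\<Sum>w\<in>W. (inner (abs_l2 (\<phi> n)) w)\<^sup>2)"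
        using W(3)[OF \<phi>(1)] by blast
    qed
  qed
  with W(1,2) show ?thesis by blast
qed

section \<open>The inverse Laplacian and the normal operator\<close>

text \<open>The adjoint is a definite description, so a candidate must satisfy the adjoint relation and be separated from
  other candidates by the inner product.\<close>

lemma hilbert_adjointI:
  assumes "y \<in> Y" "x \<in> X" and adj: "\<And>z. z \<in> X \<Longrightarrow> ipY (T z) y = ipX z x"
    and sep: "\<And>x'. x' \<in> X \<Longrightarrow> (\<And>z. z \<in> X \<Longrightarrow> ipX z x' = ipX z x) \<Longrightarrow> x' = x"
  shows "hilbert_adjoint X ipX Y ipY T y = x"
proof -
  have "(THE x. x \<in> X \<and> (\<forall>z\<in>X. ipY (T z) y = ipX z x)) = x"
    using assms by (intro the_equality) auto
  then show ?thesis using assms(1) by (simp add: hilbert_adjoint_def)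
qed

lemma dom_U_L2: "u \<in> dom_U \<Omega> \<Longrightarrow> u \<in> L2 \<Omega>"
  unfolding dom_U_def using sobolev_L2 by blast

context
  fixes \<Omega> :: "'a::euclidean_space set"
  assumes op: "open \<Omega>"
    and bij: "bij_betw (neg_laplacian \<Omega>) (dom_U \<Omega>) (L2 \<Omega>)"
begin

lemma neg_laplacian_L2: "u \<in> dom_U \<Omega> \<Longrightarrow> neg_laplacian \<Omega> u \<in> L2 \<Omega>"
  using bij by (auto simp: bij_betw_def)

lemma inv_laplacian_dom: "f \<in> L2 \<Omega> \<Longrightarrow> inv_laplacian \<Omega> f \<in> dom_U \<Omega>"
  unfolding inv_laplacian_def using bij by (metis bij_betw_imp_surj_on inv_into_into)

lemma inv_laplacian_L2: "f \<in> L2 \<Omega> \<Longrightarrow> inv_laplacian \<Omega> f \<in> L2 \<Omega>"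
  by (rule dom_U_L2[OF inv_laplacian_dom])

lemma laplacian_inv [simp]: "f \<in> L2 \<Omega> \<Longrightarrow> neg_laplacian \<Omega> (inv_laplacian \<Omega> f) = f"
  unfolding inv_laplacian_def using bij by (metis bij_betw_inv_into_right)

lemma inv_laplacian [simp]: "u \<in> dom_U \<Omega> \<Longrightarrow> inv_laplacian \<Omega> (neg_laplacian \<Omega> u) = u"
  unfolding inv_laplacian_def using bij by (metis bij_betw_inv_into_left)

lemma inner_inv_laplacian:
  assumes "f \<in> L2 \<Omega>" "g \<in> L2 \<Omega>"
  shows "inner f (inv_laplacian \<Omega> g) =
    (\<Sum>b\<in>Basis. inner (weak_deriv \<Omega> b (inv_laplacian \<Omega> f)) (weak_deriv \<Omega> b (inv_laplacian \<Omega> g)))"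
  using inner_neg_laplacian[OF op, of "inv_laplacian \<Omega> f" "inv_laplacian \<Omega> g"]
    inv_laplacian_dom assms by (simp add: dom_U_def)

lemma inv_laplacian_sym:
  assumes "f \<in> L2 \<Omega>" "g \<in> L2 \<Omega>"
  shows "inner (inv_laplacian \<Omega> f) g = inner f (inv_laplacian \<Omega> g)"
proof -
  have "inner (inv_laplacian \<Omega> f) g = inner g (inv_laplacian \<Omega> f)" by (rule inner_commute)
  also have "\<dots> = inner f (inv_laplacian \<Omega> g)"
    unfolding inner_inv_laplacian[OF assms] inner_inv_laplacian[OF assms(2,1)]
    by (intro sum.cong refl inner_commute)
  finally show ?thesis .
qed

lemma inv_laplacian_linear:
  assumes "f \<in> L2 \<Omega>" "g \<in> L2 \<Omega>"
  shows "inv_laplacian \<Omega> (a *\<^sub>R f + b *\<^sub>R g) = a *\<^sub>R inv_laplacian \<Omega> f + b *\<^sub>R inv_laplacian \<Omega> g"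
  by (rule symmetric_imp_linear[OF subspace_L2 inv_laplacian_L2 inv_laplacian_sym assms])

lemma inv_laplacian_inj:
  assumes "f \<in> L2 \<Omega>" "inv_laplacian \<Omega> f = 0"
  shows "f = 0"
proof -
  have 0: "(0 :: 'a l2) \<in> L2 \<Omega>" by (rule subspace_0[OF subspace_L2])
  have "inv_laplacian \<Omega> 0 = 0" using inv_laplacian_linear[OF 0 0, of 0 0] by simp
  then show ?thesis using laplacian_inv[OF assms(1)] laplacian_inv[OF 0] assms(2) by metis
qed

lemma inv_laplacian_energy:
  assumes "f \<in> L2 \<Omega>"
  shows "(\<Sum>b\<in>Basis. (norm (weak_deriv \<Omega> b (inv_laplacian \<Omega> f)))\<^sup>2) = inner f (inv_laplacian \<Omega> f)"
  unfolding inner_inv_laplacian[OF assms assms] by (simp add: power2_norm_eq_inner)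

text \<open>The energy \<open>\<parallel>\<nabla>u\<parallel>\<^sup>2\<close> of \<open>u = B f\<close> equals
  \<open>\<langle>f, u\<rangle>\<close>, so the Poincare inequality becomes a bound for the operator.\<close>

lemma inv_laplacian_bound:
  assumes R: "\<Omega> \<subseteq> ball 0 R" "0 < R" and f: "f \<in> L2 \<Omega>"
  shows "norm (inv_laplacian \<Omega> f) \<le> 2 * R\<^sup>2 * norm f"
proof -
  let ?u = "inv_laplacian \<Omega> f"
  have "(norm ?u)\<^sup>2 \<le> 2 * R\<^sup>2 * inner f ?u"
    using poincare_H01[OF R, of ?u] inv_laplacian_dom[OF f] unfolding inv_laplacian_energy[OF f]
    by (simp add: dom_U_def)
  also have "\<dots> \<le> 2 * R\<^sup>2 * (norm f * norm ?u)"
    by (intro mult_left_mono norm_cauchy_schwarz) auto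
  finally have "norm ?u * norm ?u \<le> (2 * R\<^sup>2 * norm f) * norm ?u"
    by (simp add: power2_eq_square mult.assoc)
  then show ?thesis by (cases "norm ?u = 0") auto
qed

lemma inv_laplacian_finite_rank_estimate:
  assumes R: "\<Omega> \<subseteq> ball 0 R" "0 < R" and e: "0 < e"
  shows "\<exists>W. finite W \<and> (\<forall>w\<in>W. norm w \<le> 1) \<and> (\<forall>f\<in>L2 \<Omega>.
    (norm (inv_laplacian \<Omega> f))\<^sup>2 \<le> e * (norm f)\<^sup>2 + (\<Sum>w\<in>W. (inner (inv_laplacian \<Omega> f) w)\<^sup>2))"
proof -
  let ?C = "2 * R\<^sup>2"
  have C: "0 < ?C" using R by simp
  obtain W where W: "finite W" "\<forall>w\<in>W. norm w \<le> 1"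
    "\<And>u. u \<in> H01 \<Omega> \<Longrightarrow> (norm u)\<^sup>2 \<le> (e / ?C) * (\<Sum>b\<in>Basis. (norm (weak_deriv \<Omega> b u))\<^sup>2) + (\<Sum>w\<in>W. (inner u w)\<^sup>2)"
    using finite_rank_estimate_H01[OF R(1), of "e / ?C"] e C by (metis divide_pos_pos)
  have "(norm (inv_laplacian \<Omega> f))\<^sup>2 \<le> e * (norm f)\<^sup>2 + (\<Sum>w\<in>W. (inner (inv_laplacian \<Omega> f) w)\<^sup>2)"
    if f: "f \<in> L2 \<Omega>" for f
  proof -
    let ?u = "inv_laplacian \<Omega> f"
    have "inner f ?u \<le> norm f * norm ?u" by (rule norm_cauchy_schwarz)
    also have "\<dots> \<le> norm f * (?C * norm f)" by (intro mult_left_mono inv_laplacian_bound[OF R f]) simp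
    finally have "(e / ?C) * inner f ?u \<le> (e / ?C) * (norm f * (?C * norm f))"
      using e C by (intro mult_left_mono) auto
    also have "\<dots> = e * (norm f)\<^sup>2" using R(2) by (simp add: power2_eq_square)
    finally show ?thesis
      using W(3)[of ?u] inv_laplacian_dom[OF f] unfolding inv_laplacian_energy[OF f] by (simp add: dom_U_def)
  qed
  with W(1,2) show ?thesis by blast
qed

lemma small_eigenvalue_inv_laplacian_sq:
  assumes "\<Omega> \<noteq> {}" "bounded \<Omega>" "0 < e"
  shows "\<exists>m. 0 < m \<and> m < e \<and> m \<in> eigenvalues (L2 \<Omega>) (inv_laplacian \<Omega> \<circ> inv_laplacian \<Omega>)"
proof -
  obtain R where R: "\<Omega> \<subseteq> ball 0 R" "0 < R"
    using bounded_subset_ballD[OF assms(2), of 0] by blast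
  show ?thesis
    by (rule small_eigenvalue_exists[OF subspace_L2 complete_L2[OF op] L2_not_finite_dim[OF op assms(1)]
      inv_laplacian_L2 inv_laplacian_sym inv_laplacian_inj inv_laplacian_bound[OF R]
      inv_laplacian_finite_rank_estimate[OF R] assms(3)])
qed

lemma inv_transf_op:
  assumes "f \<in> L2 \<Omega>" "g \<in> L2 \<Omega>"
  shows "inv_into (dom_U \<Omega> \<times> L2 \<Omega>) (transf_op \<Omega>) (f, g) = (inv_laplacian \<Omega> f, g)"
proof (rule inv_into_f_eq)
  show "inj_on (transf_op \<Omega>) (dom_U \<Omega> \<times> L2 \<Omega>)"
    using bij by (auto simp: transf_op_def inj_on_def bij_betw_def)
qed (use assms inv_laplacian_dom in \<open>auto simp: transf_op_def\<close>)

text \<open>The term \<open>\<langle>v, q\<rangle>\<close> equals \<open>\<langle>A v, B q\<rangle>\<close> by symmetry of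
  \<open>B\<close>, which brings the pairing with \<open>G (v, t)\<close> into the form of the inner product of
  \<open>U \<times> L\<^sup>2(\<Omega>)\<close>. Uniqueness is tested on the pair whose image under
  \<open>T\<close> is the difference of the images of two candidates.\<close>

lemma adjoint_forward_op:
  assumes "p \<in> L2 \<Omega>" "q \<in> L2 \<Omega>"
  shows "hilbert_adjoint (dom_U \<Omega> \<times> L2 \<Omega>) (inner_UL2 \<Omega>) (L2 \<Omega> \<times> L2 \<Omega>) inner (forward_op \<Omega>) (p, q)
    = (inv_laplacian \<Omega> (p + inv_laplacian \<Omega> q), - p)"
proof (rule hilbert_adjointI)
  have pq: "p + inv_laplacian \<Omega> q \<in> L2 \<Omega>"
    by (intro subspace_add[OF subspace_L2] assms inv_laplacian_L2)
  show "(p, q) \<in> L2 \<Omega> \<times> L2 \<Omega>" using assms by simp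
  show x: "(inv_laplacian \<Omega> (p + inv_laplacian \<Omega> q), - p) \<in> dom_U \<Omega> \<times> L2 \<Omega>"
    using inv_laplacian_dom[OF pq] subspace_neg[OF subspace_L2 assms(1)] by simp
  show "inner (forward_op \<Omega> z) (p, q) = inner_UL2 \<Omega> z (inv_laplacian \<Omega> (p + inv_laplacian \<Omega> q), - p)"
    if zX: "z \<in> dom_U \<Omega> \<times> L2 \<Omega>" for z
  proof -
    obtain v t where z: "z = (v, t)" "v \<in> dom_U \<Omega>" "t \<in> L2 \<Omega>" using zX by auto
    have "inner v q = inner (neg_laplacian \<Omega> v) (inv_laplacian \<Omega> q)"
      using inv_laplacian_sym[OF neg_laplacian_L2[OF z(2)] assms(2)] z(2) by simp
    then show ?thesis
      using laplacian_inv[OF pq] by (simp add: z(1) forward_op_def inner_UL2_def inner_diff_left inner_add_right)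
  qed
  fix x' assume x': "x' \<in> dom_U \<Omega> \<times> L2 \<Omega>"
    and eq: "\<And>z. z \<in> dom_U \<Omega> \<times> L2 \<Omega> \<Longrightarrow> inner_UL2 \<Omega> z x' = inner_UL2 \<Omega> z (inv_laplacian \<Omega> (p + inv_laplacian \<Omega> q), - p)"
  obtain u t where ut: "x' = (u, t)" "u \<in> dom_U \<Omega>" "t \<in> L2 \<Omega>" using x' by auto
  define a where "a = neg_laplacian \<Omega> u - (p + inv_laplacian \<Omega> q)"
  define c where "c = t - - p"
  have a: "a \<in> L2 \<Omega>" unfolding a_def by (intro subspace_diff[OF subspace_L2] neg_laplacian_L2 ut pq)
  have c: "c \<in> L2 \<Omega>" unfolding c_def by (intro subspace_diff[OF subspace_L2] subspace_neg[OF subspace_L2] ut assms)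
  have "(inv_laplacian \<Omega> a, c) \<in> dom_U \<Omega> \<times> L2 \<Omega>" using inv_laplacian_dom[OF a] c by simp
  from eq[OF this] have "inner a (neg_laplacian \<Omega> u) + inner c t = inner a (p + inv_laplacian \<Omega> q) + inner c (- p)"
    unfolding inner_UL2_def ut fst_conv snd_conv laplacian_inv[OF pq] laplacian_inv[OF a] .
  moreover have "inner a a = inner a (neg_laplacian \<Omega> u) - inner a (p + inv_laplacian \<Omega> q)"
    by (subst (2) a_def) (rule inner_diff_right)
  moreover have "inner c c = inner c t - inner c (- p)"
    by (subst (2) c_def) (rule inner_diff_right)
  ultimately have "inner a a + inner c c = 0" by linarith
  then have "inner a a = 0" "inner c c = 0" using inner_ge_zero[of a] inner_ge_zero[of c] by linarith+
  then have "neg_laplacian \<Omega> u = p + inv_laplacian \<Omega> q" "t = - p"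
    unfolding inner_eq_zero_iff a_def c_def by (simp_all only: right_minus_eq)
  then show "x' = (inv_laplacian \<Omega> (p + inv_laplacian \<Omega> q), - p)"
    using inv_laplacian[OF ut(2)] by (simp add: ut(1))
qed

lemma adjoint_inv_transf_op:
  assumes "u \<in> dom_U \<Omega>" "t \<in> L2 \<Omega>"
  shows "hilbert_adjoint (L2 \<Omega> \<times> L2 \<Omega>) inner (dom_U \<Omega> \<times> L2 \<Omega>) (inner_UL2 \<Omega>)
      (inv_into (dom_U \<Omega> \<times> L2 \<Omega>) (transf_op \<Omega>)) (u, t) = (neg_laplacian \<Omega> u, t)"
proof (rule hilbert_adjointI)
  show "(u, t) \<in> dom_U \<Omega> \<times> L2 \<Omega>" using assms by simp
  show x: "(neg_laplacian \<Omega> u, t) \<in> L2 \<Omega> \<times> L2 \<Omega>" using assms neg_laplacian_L2 by simp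
  show "inner_UL2 \<Omega> (inv_into (dom_U \<Omega> \<times> L2 \<Omega>) (transf_op \<Omega>) z) (u, t) = inner z (neg_laplacian \<Omega> u, t)"
    if "z \<in> L2 \<Omega> \<times> L2 \<Omega>" for z
    using that by (auto simp: inv_transf_op inner_UL2_def)
  fix x' assume x': "x' \<in> L2 \<Omega> \<times> L2 \<Omega>"
    and eq: "\<And>z. z \<in> L2 \<Omega> \<times> L2 \<Omega> \<Longrightarrow> inner z x' = inner z (neg_laplacian \<Omega> u, t)"
  have "x' - (neg_laplacian \<Omega> u, t) \<in> L2 \<Omega> \<times> L2 \<Omega>"
    using x x' by (auto intro!: subspace_diff[OF subspace_L2])
  from eq[OF this] have "inner (x' - (neg_laplacian \<Omega> u, t)) (x' - (neg_laplacian \<Omega> u, t)) = 0"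
    by (subst inner_diff_right) simp
  then show "x' = (neg_laplacian \<Omega> u, t)" by simp
qed

lemma normal_op_eq:
  assumes "f \<in> L2 \<Omega>" "g \<in> L2 \<Omega>"
  shows "normal_op \<Omega> (f, g) = (f + inv_laplacian \<Omega> (inv_laplacian \<Omega> f) - g, - f + g)"
proof -
  let ?h = "f - g + inv_laplacian \<Omega> (inv_laplacian \<Omega> f)"
  have fg: "f - g \<in> L2 \<Omega>" by (intro subspace_diff[OF subspace_L2] assms)
  have h: "?h \<in> L2 \<Omega>" by (intro subspace_add[OF subspace_L2] fg inv_laplacian_L2 assms)
  have n: "- (f - g) \<in> L2 \<Omega>" by (intro subspace_neg[OF subspace_L2] fg)
  show ?thesis
    unfolding normal_op_def Let_def o_apply inv_transf_op[OF assms]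
    unfolding forward_op_def prod.case laplacian_inv[OF assms(1)]
    unfolding forward_op_def[symmetric] adjoint_forward_op[OF fg inv_laplacian_L2[OF assms(1)]]
      adjoint_inv_transf_op[OF inv_laplacian_dom[OF h] n] laplacian_inv[OF h]
    by simp
qed

lemma inv_laplacian_sq_eigenvalue_pos:
  assumes "m \<in> eigenvalues (L2 \<Omega>) (inv_laplacian \<Omega> \<circ> inv_laplacian \<Omega>)"
  shows "0 < m"
proof -
  obtain g where g: "g \<in> L2 \<Omega>" "g \<noteq> 0" "inv_laplacian \<Omega> (inv_laplacian \<Omega> g) = m *\<^sub>R g"
    using assms by (auto simp: eigenvalues_def)
  have "m * inner g g = inner (inv_laplacian \<Omega> (inv_laplacian \<Omega> g)) g" by (simp add: g(3))
  also have "\<dots> = inner (inv_laplacian \<Omega> g) (inv_laplacian \<Omega> g)"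
    by (rule inv_laplacian_sym[OF inv_laplacian_L2[OF g(1)] g(1)])
  also have "\<dots> > 0" using inv_laplacian_inj[OF g(1)] g(2) by auto
  finally have "0 < m * inner g g" .
  moreover have "0 < inner g g" using g(2) by simp
  ultimately show ?thesis by (rule zero_less_mult_pos2)
qed

end

section \<open>Eigenvalues of the normal operator\<close>

text \<open>Completing the square.\<close>

lemma quadratic_roots:
  fixes m l :: real
  shows "l\<^sup>2 - l * (2 + m) + m = 0 \<longleftrightarrow> l = (2 + m) / 2 + sqrt (m\<^sup>2 / 4 + 1) \<or> l = (2 + m) / 2 - sqrt (m\<^sup>2 / 4 + 1)"
proof -
  have s: "(sqrt (m\<^sup>2 / 4 + 1))\<^sup>2 = m\<^sup>2 / 4 + 1" by simp
  have "l\<^sup>2 - l * (2 + m) + m = (l - (2 + m) / 2)\<^sup>2 - (sqrt (m\<^sup>2 / 4 + 1))\<^sup>2"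
    unfolding s by (simp add: power2_eq_square field_simps)
  then have "l\<^sup>2 - l * (2 + m) + m = 0 \<longleftrightarrow> (l - (2 + m) / 2)\<^sup>2 = (sqrt (m\<^sup>2 / 4 + 1))\<^sup>2" by linarith
  also have "\<dots> \<longleftrightarrow> l - (2 + m) / 2 = sqrt (m\<^sup>2 / 4 + 1) \<or> l - (2 + m) / 2 = - sqrt (m\<^sup>2 / 4 + 1)"
    by (rule power2_eq_iff)
  also have "\<dots> \<longleftrightarrow> l = (2 + m) / 2 + sqrt (m\<^sup>2 / 4 + 1) \<or> l = (2 + m) / 2 - sqrt (m\<^sup>2 / 4 + 1)"
    by argo
  finally show ?thesis .
qed

lemma lam1_eq: "lam1 m = (2 + m) / 2 + sqrt (m\<^sup>2 / 4 + 1)"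
  by (simp add: lam1_def add.commute add_divide_distrib)

text \<open>The two roots have product \<open>m\<close>; \<open>lam2\<close> is written as the quotient that avoids
  cancellation.\<close>

lemma lam2_eq:
  assumes "0 < m"
  shows "lam2 m = (2 + m) / 2 - sqrt (m\<^sup>2 / 4 + 1)"
proof -
  let ?s = "sqrt (1 + m\<^sup>2 / 4)"
  have s: "?s * ?s = 1 + m\<^sup>2 / 4" by simp
  have p: "0 < 1 + m / 2 + ?s" using assms by (intro add_pos_nonneg) auto
  have "(1 + m / 2 + ?s) * ((2 + m) / 2 - ?s) = (1 + m / 2) * (1 + m / 2) - ?s * ?s"
    by (simp add: algebra_simps add_divide_distrib)
  also have "\<dots> = m" unfolding s by (simp add: power2_eq_square algebra_simps)
  finally show ?thesis using p unfolding lam2_def by (simp add: divide_eq_eq add.commute mult.commute)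
qed

lemma lam1_gt_2: "0 < m \<Longrightarrow> 2 < lam1 m"
proof -
  assume "0 < m"
  moreover have "1 \<le> sqrt (1 + m\<^sup>2 / 4)" by simp
  ultimately show ?thesis unfolding lam1_def by linarith
qed

lemma lam2_pos: "0 < m \<Longrightarrow> 0 < lam2 m"
  unfolding lam2_def by (intro divide_pos_pos add_pos_nonneg) auto

lemma lam_limits:
  "(lam1 \<longlongrightarrow> 2) (at 0)" "(lam2 \<longlongrightarrow> 0) (at 0)"
  "((\<lambda>\<mu>. (lam1 \<mu> - 2) / \<mu>) \<longlongrightarrow> 1 / 2) (at 0)" "((\<lambda>\<mu>. lam2 \<mu> / \<mu>) \<longlongrightarrow> 1 / 2) (at 0)"
  unfolding lam1_def[abs_def] lam2_def[abs_def] by real_asymp+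

lemma islimpt_image_of_small:
  fixes h :: "real \<Rightarrow> real"
  assumes lim: "(h \<longlongrightarrow> c) (at 0)" and small: "\<And>e. 0 < e \<Longrightarrow> \<exists>m\<in>M. 0 < m \<and> m < e"
    and ne: "\<And>m. m \<in> M \<Longrightarrow> h m \<noteq> c"
  shows "c islimpt h ` M"
  unfolding islimpt_approachable
proof (intro allI impI)
  fix e :: real assume "0 < e"
  then obtain d where d: "0 < d" "\<And>x. x \<noteq> 0 \<Longrightarrow> dist x 0 < d \<Longrightarrow> dist (h x) c < e"
    using lim unfolding tendsto_iff eventually_at by (metis UNIV_I)
  obtain m where "m \<in> M" "0 < m" "m < d" using small[OF d(1)] by blast
  then show "\<exists>x'\<in>h ` M. x' \<noteq> c \<and> dist x' c < e" using d(2)[of m] ne by auto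
qed

lemma block_eigenvector_imp:
  fixes K :: "'v::real_vector \<Rightarrow> 'v"
  assumes K0: "K 0 = 0" and Kscale: "\<And>c. K (c *\<^sub>R g) = c *\<^sub>R K g"
    and ne: "(f, g) \<noteq> 0"
    and ev: "(f + K f - g, - f + g) = l *\<^sub>R (f, g)"
  shows "l \<noteq> 1" "K g = (l * (2 - l) / (1 - l)) *\<^sub>R g" "f = (1 - l) *\<^sub>R g" "g \<noteq> 0"
    "l\<^sup>2 - l * (2 + l * (2 - l) / (1 - l)) + l * (2 - l) / (1 - l) = 0"
proof -
  have e1: "f + K f - g = l *\<^sub>R f" and e2: "- f + g = l *\<^sub>R g" using ev by auto
  show f: "f = (1 - l) *\<^sub>R g" using e2 by (simp add: algebra_simps)
  show l: "l \<noteq> 1"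
  proof
    assume "l = 1"
    then have "f = 0" using f by simp
    then have "g = 0" using e1 K0 by simp
    then show False using ne \<open>f = 0\<close> by (simp add: zero_prod_def)
  qed
  show "g \<noteq> 0" using ne f by (auto simp: zero_prod_def)
  have "(1 - l) *\<^sub>R K g = K f" using Kscale[of "1 - l"] f by simp
  also have "\<dots> = l *\<^sub>R f - f + g" using e1 by (simp add: algebra_simps)
  also have "\<dots> = (l * (1 - l) - (1 - l) + 1) *\<^sub>R g"
    unfolding f by (simp only: scaleR_left_diff_distrib scaleR_left_distrib scaleR_one scaleR_right_diff_distrib scaleR_scaleR right_diff_distrib mult_1_right)
  also have "l * (1 - l) - (1 - l) + 1 = l * (2 - l)" by (simp add: algebra_simps)
  finally have "(1 / (1 - l)) *\<^sub>R ((1 - l) *\<^sub>R K g) = (1 / (1 - l)) *\<^sub>R ((l * (2 - l)) *\<^sub>R g)" by simp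
  then show "K g = (l * (2 - l) / (1 - l)) *\<^sub>R g" using l by simp
  show "l\<^sup>2 - l * (2 + l * (2 - l) / (1 - l)) + l * (2 - l) / (1 - l) = 0"
    using l by (simp add: field_simps power2_eq_square)
qed

lemma block_eigenvector_of_root:
  fixes K :: "'v::real_vector \<Rightarrow> 'v"
  assumes Kscale: "\<And>c. K (c *\<^sub>R g) = c *\<^sub>R K g" and g: "K g = m *\<^sub>R g"
    and root: "l\<^sup>2 - l * (2 + m) + m = 0"
  shows "((1 - l) *\<^sub>R g + K ((1 - l) *\<^sub>R g) - g, - ((1 - l) *\<^sub>R g) + g) = l *\<^sub>R ((1 - l) *\<^sub>R g, g)"
proof -
  have "(1 - l) *\<^sub>R g + K ((1 - l) *\<^sub>R g) - g = ((1 - l) + (1 - l) * m - 1) *\<^sub>R g"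
    unfolding Kscale g by (simp add: algebra_simps)
  also have "(1 - l) + (1 - l) * m - 1 = l * (1 - l)" using root by (simp add: algebra_simps power2_eq_square)
  finally show ?thesis by (simp add: algebra_simps)
qed

theorem mainTheorem1:
  fixes \<Omega> :: "'a::euclidean_space set"
  assumes "open \<Omega>" and "connected \<Omega>" and "\<Omega> \<noteq> {}" and "bounded \<Omega>"
    and "bij_betw (neg_laplacian \<Omega>) (dom_U \<Omega>) (L2 \<Omega>)"
  defines "Ainv2 \<equiv> inv_laplacian \<Omega> \<circ> inv_laplacian \<Omega>"
    and "E \<equiv> eigenvalues (L2 \<Omega> \<times> L2 \<Omega>) (normal_op \<Omega>)"
  defines "M \<equiv> eigenvalues (L2 \<Omega>) Ainv2"
  shows
    "(\<forall>f\<in>L2 \<Omega>. \<forall>g\<in>L2 \<Omega>. normal_op \<Omega> (f, g) = (f + Ainv2 f - g, - f + g)) \<and>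
     (\<forall>l. \<forall>f\<in>L2 \<Omega>. \<forall>g\<in>L2 \<Omega>. (f, g) \<noteq> 0 \<and> normal_op \<Omega> (f, g) = l *\<^sub>R (f, g) \<longrightarrow>
        l \<noteq> 1 \<and> Ainv2 g = (l * (2 - l) / (1 - l)) *\<^sub>R g \<and> f = (1 - l) *\<^sub>R g \<and>
        (let \<mu> = l * (2 - l) / (1 - l) in \<mu> \<in> M \<and> l\<^sup>2 - l * (2 + \<mu>) + \<mu> = 0)) \<and>
     (\<forall>\<mu>\<in>M. \<forall>l. l\<^sup>2 - l * (2 + \<mu>) + \<mu> = 0 \<longleftrightarrow> l = lam1 \<mu> \<or> l = lam2 \<mu>) \<and>
     (\<forall>\<mu>\<in>M. lam1 \<mu> = (2 + \<mu>) / 2 + sqrt (\<mu>\<^sup>2 / 4 + 1) \<and>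
             lam2 \<mu> = (2 + \<mu>) / 2 - sqrt (\<mu>\<^sup>2 / 4 + 1)) \<and>
     E = lam1 ` M \<union> lam2 ` M \<and>
     (lam1 \<longlongrightarrow> 2) (at 0) \<and> (lam2 \<longlongrightarrow> 0) (at 0) \<and>
     2 islimpt E \<and> 0 islimpt E \<and>
     ((\<lambda>\<mu>. (lam1 \<mu> - 2) / \<mu>) \<longlongrightarrow> 1 / 2) (at 0) \<and>
     ((\<lambda>\<mu>. lam2 \<mu> / \<mu>) \<longlongrightarrow> 1 / 2) (at 0)"
proof -
  note ctx = assms(1,5)
  have normal: "normal_op \<Omega> (f, g) = (f + Ainv2 f - g, - f + g)" if "f \<in> L2 \<Omega>" "g \<in> L2 \<Omega>" for f g
    using normal_op_eq[OF ctx that] by (simp add: Ainv2_def)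
  have A0: "inv_laplacian \<Omega> (c *\<^sub>R g) = c *\<^sub>R inv_laplacian \<Omega> g" if "g \<in> L2 \<Omega>" for c g
    using inv_laplacian_linear[OF ctx that that, of c 0] by simp
  have Kscale: "Ainv2 (c *\<^sub>R g) = c *\<^sub>R Ainv2 g" if "g \<in> L2 \<Omega>" for c g
    using A0 that inv_laplacian_L2[OF ctx that] by (simp add: Ainv2_def)
  have zero: "(0 :: 'a l2) \<in> L2 \<Omega>" by (rule subspace_0[OF subspace_L2])
  have K0: "Ainv2 0 = 0" using Kscale[OF zero, of 0] by simp
  have eig: "l \<noteq> 1" "Ainv2 g = (l * (2 - l) / (1 - l)) *\<^sub>R g" "f = (1 - l) *\<^sub>R g"
      "l * (2 - l) / (1 - l) \<in> M" "l\<^sup>2 - l * (2 + l * (2 - l) / (1 - l)) + l * (2 - l) / (1 - l) = 0"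
    if "f \<in> L2 \<Omega>" "g \<in> L2 \<Omega>" "(f, g) \<noteq> 0" "normal_op \<Omega> (f, g) = l *\<^sub>R (f, g)" for l f g
  proof -
    have "(f + Ainv2 f - g, - f + g) = l *\<^sub>R (f, g)" using normal that by simp
    note b = block_eigenvector_imp[OF K0 Kscale[OF that(2)] that(3) this]
    show "l \<noteq> 1" "Ainv2 g = (l * (2 - l) / (1 - l)) *\<^sub>R g" "f = (1 - l) *\<^sub>R g"
      "l\<^sup>2 - l * (2 + l * (2 - l) / (1 - l)) + l * (2 - l) / (1 - l) = 0" by (fact b)+
    show "l * (2 - l) / (1 - l) \<in> M" unfolding M_def eigenvalues_def using b(2,4) that(2) by blast
  qed
  have Mpos: "0 < \<mu>" if "\<mu> \<in> M" for \<mu>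
    using inv_laplacian_sq_eigenvalue_pos[OF ctx] that by (simp add: M_def Ainv2_def)
  have form: "lam1 \<mu> = (2 + \<mu>) / 2 + sqrt (\<mu>\<^sup>2 / 4 + 1)" "lam2 \<mu> = (2 + \<mu>) / 2 - sqrt (\<mu>\<^sup>2 / 4 + 1)"
    if "\<mu> \<in> M" for \<mu>
    using lam1_eq lam2_eq[OF Mpos[OF that]] by auto
  have roots: "l\<^sup>2 - l * (2 + \<mu>) + \<mu> = 0 \<longleftrightarrow> l = lam1 \<mu> \<or> l = lam2 \<mu>" if "\<mu> \<in> M" for \<mu> l
    unfolding form[OF that] by (rule quadratic_roots)
  have E: "E = lam1 ` M \<union> lam2 ` M"
  proof (rule set_eqI, rule iffI)
    fix l assume "l \<in> E"
    then obtain f g where fg: "f \<in> L2 \<Omega>" "g \<in> L2 \<Omega>" "(f, g) \<noteq> 0" "normal_op \<Omega> (f, g) = l *\<^sub>R (f, g)"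
      by (auto simp: E_def eigenvalues_def)
    show "l \<in> lam1 ` M \<union> lam2 ` M" using roots[OF eig(4)[OF fg]] eig(4,5)[OF fg] by blast
  next
    fix l assume "l \<in> lam1 ` M \<union> lam2 ` M"
    then obtain \<mu> where \<mu>: "\<mu> \<in> M" "l\<^sup>2 - l * (2 + \<mu>) + \<mu> = 0" using roots by blast
    then obtain g where g: "g \<in> L2 \<Omega>" "g \<noteq> 0" "Ainv2 g = \<mu> *\<^sub>R g" by (auto simp: M_def eigenvalues_def)
    have f: "(1 - l) *\<^sub>R g \<in> L2 \<Omega>" by (rule subspace_scale[OF subspace_L2 g(1)])
    have "normal_op \<Omega> ((1 - l) *\<^sub>R g, g) = l *\<^sub>R ((1 - l) *\<^sub>R g, g)"
      unfolding normal[OF f g(1)] by (rule block_eigenvector_of_root[OF Kscale[OF g(1)] g(3) \<mu>(2)])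
    moreover have "((1 - l) *\<^sub>R g, g) \<noteq> 0" using g(2) by (simp add: zero_prod_def)
    ultimately show "l \<in> E" unfolding E_def eigenvalues_def using f g(1) by blast
  qed
  have small: "\<exists>\<mu>\<in>M. 0 < \<mu> \<and> \<mu> < e" if "0 < e" for e
    using small_eigenvalue_inv_laplacian_sq[OF ctx assms(3,4) that] by (auto simp: M_def Ainv2_def)
  have lam1_ne: "lam1 \<mu> \<noteq> 2" and lam2_ne: "lam2 \<mu> \<noteq> 0" if "\<mu> \<in> M" for \<mu>
    using lam1_gt_2[OF Mpos[OF that]] lam2_pos[OF Mpos[OF that]] by simp_all
  have "2 islimpt lam1 ` M"
    by (rule islimpt_image_of_small[OF lam_limits(1) small lam1_ne])
  then have lim2: "2 islimpt E" unfolding E by (simp add: islimpt_Un)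
  have "0 islimpt lam2 ` M"
    by (rule islimpt_image_of_small[OF lam_limits(2) small lam2_ne])
  then have lim0: "0 islimpt E" unfolding E by (simp add: islimpt_Un)
  show ?thesis
    unfolding Let_def
  proof (intro conjI ballI allI impI)
    show "l \<noteq> 1" "Ainv2 g = (l * (2 - l) / (1 - l)) *\<^sub>R g" "f = (1 - l) *\<^sub>R g"
      "l * (2 - l) / (1 - l) \<in> M" "l\<^sup>2 - l * (2 + l * (2 - l) / (1 - l)) + l * (2 - l) / (1 - l) = 0"
      if "f \<in> L2 \<Omega>" "g \<in> L2 \<Omega>" "(f, g) \<noteq> 0 \<and> normal_op \<Omega> (f, g) = l *\<^sub>R (f, g)" for l f g
      using eig[OF that(1,2)] that(3) by simp_all
  qed (fact normal roots form E lim2 lim0 lam_limits)+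
qed

end
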